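(* Let $n\ge1$, let $\lambda=(\lambda_1\ge\dots\ge\lambda_n)$ be a real spectrum and let $F:\mathcal{O}(\lambda)\to\mathbb{R}^{n(n-1)/2}$ be the Gelfand--Cetlin map. (i) For any value $\Lambda$ of $F$, $$\dim F^{-1}(\Lambda)=\dim F^{-1}(\Lambda_0)-\sum_{l_\alpha=l_{\alpha-1}}l_\alpha\ \le\ \dim F^{-1}(\Lambda_0),$$ where $F^{-1}(\Lambda_0)$ denotes a regular (Lagrangian) fiber of the system, and the sum runs over all connected chains of equalities in the Gelfand--Cetlin triangle of $\Lambda$ and, for each such chain with associated sequence $l_1,\dots,l_s$, over all indices $2\le\alpha\le s$ with $l_\alpha=l_{\alpha-1}$. (ii) The equality $\dim F^{-1}(\Lambda)=\dim F^{-1}(\Lambda_0)$ holds if and only if each connected chain of equalities in the Gelfand--Cetlin triangle of $\Lambda$ is axially symmetric (so that $l_\alpha\ne l_{\alpha-1}$ everywhere in every chain). In the case of a generic coadjoint orbit ($\lambda_1>\dots>\lambda_n$) it means that each chain is a union of symmetrically overlapping diamonds.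
   Context: $\mathcal{O}(\lambda)$ is the set of Hermitian $n\times n$ complex matrices with spectrum $\lambda$ (a coadjoint orbit of $U(n)$ with its Kirillov--Kostant--Souriau symplectic form). For $A\in\mathcal{O}(\lambda)$ let $A_k$ be its upper-left $k\times k$ submatrix, with eigenvalues $F_{1,k}(A)\ge\dots\ge F_{k,k}(A)$. The Gelfand--Cetlin map is $F=(F_{i,j})_{1\le i\le j<n}$. Its non-constant components form a completely integrable system, whose fibers are smooth submanifolds. A regular value $\Lambda_0$ is a value whose triangle has no equalities other than those forced by the equalities among $\lambda_1,\dots,\lambda_n$; the regular fibers are Lagrangian, of dimension $\frac12\dim\mathcal{O}(\lambda)$. Gelfand--Cetlin triangle of $\Lambda=(\lambda_{i,j})_{1\le i\le j<n}$: the array of numbers $\lambda_{i,j}$, $1\le i\le j\le n$, with $\lambda_{i,n}:=\lambda_i$; horizontal line (row) $j$ contains $\lambda_{1,j}\ge\dots\ge\lambda_{j,j}$, and $\lambda_{i,j+1}\ge\lambda_{i,j}\ge\lambda_{i+1,j+1}$. The row $j$ is drawn below the row $j+1$, with entry $(i,j)$ placed at horizontal coordinate $2i-j$ (so $(i,j)$ lies midway between $(i,j+1)$ and $(i+1,j+1)$). Two entries are neighbours if they are $(i,j),(i+1,j)$, or $(i,j),(i,j+1)$, or $(i,j),(i+1,j+1)$. A connected chain of equalities is a connected component (for the relation "neighbouring entries with equal values") of the set of positions in the triangle. Its sequence $l_1,\dots,l_s$ lists, from the lowest row it meets up to the highest row it meets, the number of entries of the chain in each successive row (these rows are consecutive and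 the intersections with rows are intervals). A chain is axially symmetric if it is symmetric under reflection in a vertical axis. A diamond of size $l\ge1$ is a set of positions consisting, for some $i,k$ with $i\geq 1$, $i+l-1\le k$, $k+l-1\le n$, of the positions $(a,j)$ with $k-l+1\le j\le k$ and $i\le a\le i+l-1-(k-j)$, together with the positions $(a,j)$ with $k\le j\le k+l-1$ and $i+(j-k)\le a\le i+l-1$. Diamonds overlap symmetrically if they have the same vertical symmetry axis. *)

theory Defs
  imports "HOL-Analysis.Analysis" "Jordan_Normal_Form.Char_Poly"
begin

section \<open>Smooth submanifolds of Euclidean spaces\<close>

text \<open>Meant for open \<open>U\<close> and finite-dimensional spaces: there, a differentiable map is of class
  \<open>C\<^sup>k\<^sup>+\<^sup>1\<close> iff all its directional derivatives are of class \<open>C\<^sup>k\<close>.\<close>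

fun Ck_on :: "nat \<Rightarrow> 'a::euclidean_space set \<Rightarrow> ('a \<Rightarrow> 'b::euclidean_space) \<Rightarrow> bool" where
  "Ck_on 0 U f \<longleftrightarrow> continuous_on U f"
| "Ck_on (Suc k) U f \<longleftrightarrow>
     (\<forall>x\<in>U. f differentiable (at x)) \<and> (\<forall>v. Ck_on k U (\<lambda>x. frechet_derivative f (at x) v))"

definition smooth_on :: "'a::euclidean_space set \<Rightarrow> ('a \<Rightarrow> 'b::euclidean_space) \<Rightarrow> bool" where
  "smooth_on U f \<longleftrightarrow> (\<forall>k. Ck_on k U f)"

text \<open>Embedded submanifolds without boundary, given by slice charts: near each of its points
  \<open>S\<close> is carried by a diffeomorphism of open sets of the ambient space to a \<open>d\<close>-dimensional
  linear subspace.\<close>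

definition smooth_submanifold :: "nat \<Rightarrow> 'a::euclidean_space set \<Rightarrow> bool" where
  "smooth_submanifold d S \<longleftrightarrow>
     (\<forall>p\<in>S. \<exists>(U::'a set) (V::'a set) \<phi> \<psi> L.
        open U \<and> p \<in> U \<and> open V \<and>
        homeomorphism U V \<phi> \<psi> \<and> smooth_on U \<phi> \<and> smooth_on V \<psi> \<and>
        subspace L \<and> dim L = d \<and> \<phi> ` (U \<inter> S) = V \<inter> L)"

text \<open>Only meaningful when \<open>S\<close> is a nonempty submanifold of some dimension.\<close>

definition submanifold_dim :: "'a::euclidean_space set \<Rightarrow> nat" where
  "submanifold_dim S = (THE d. smooth_submanifold d S)"

section \<open>The Gelfand--Cetlin map\<close>

text \<open>Matrices of size \<open>n = CARD('n)\<close> are elements of the Euclidean space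
  \<open>complex ^ 'n ^ 'n\<close>; the linear order on the index type \<open>'n\<close> provides the numbering
  of rows and columns that leading submatrices need.  The function below enumerates \<open>'n\<close> in
  increasing order, counting from \<open>0\<close>, as the entries of \<open>Matrix.mat\<close> do.
  All other indices (of eigenvalues and of triangle entries) start at \<open>1\<close>.\<close>

type_synonym 'n cmatrix = "((complex, 'n) Finite_Cartesian_Product.vec, 'n) Finite_Cartesian_Product.vec"

definition nth_index :: "nat \<Rightarrow> 'n::{finite,linorder}" where
  "nth_index i = sorted_list_of_set UNIV ! i"

definition leading_submatrix :: "'n::{finite,linorder} cmatrix \<Rightarrow> nat \<Rightarrow> complex mat" where
  "leading_submatrix A k =
     Matrix.mat k k (\<lambda>(i, j). vec_nth (vec_nth A (nth_index i)) (nth_index j))"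

definition hermitian :: "'n::{finite,linorder} cmatrix \<Rightarrow> bool" where
  "hermitian A \<longleftrightarrow> (\<forall>i j. vec_nth (vec_nth A i) j = cnj (vec_nth (vec_nth A j) i))"

text \<open>Eigenvalues of \<open>A\<^sub>k\<close>, with algebraic multiplicity.\<close>

definition eigenvalue_mset :: "'n::{finite,linorder} cmatrix \<Rightarrow> nat \<Rightarrow> complex multiset" where
  "eigenvalue_mset A k = proots (char_poly (leading_submatrix A k))"

definition coadjoint_orbit :: "(nat \<Rightarrow> real) \<Rightarrow> 'n::{finite,linorder} cmatrix set" where
  "coadjoint_orbit lam =
     {A. hermitian A \<and>
         eigenvalue_mset A CARD('n) =
           image_mset (\<lambda>i. complex_of_real (lam i)) (mset_set {1..CARD('n)})}"

text \<open>\<open>F\<^sub>i\<^sub>,\<^sub>k(A)\<close>, the \<open>i\<close>-th largest eigenvalue of \<open>A\<^sub>k\<close>.  It is used for Hermitian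
  \<open>A\<close> only, whose leading submatrices have real eigenvalues.\<close>

definition gc_eigenvalue :: "'n::{finite,linorder} cmatrix \<Rightarrow> nat \<Rightarrow> nat \<Rightarrow> real" where
  "gc_eigenvalue A i k =
     rev (sorted_list_of_multiset (image_mset Re (eigenvalue_mset A k))) ! (i - 1)"

definition gc_map :: "'n::{finite,linorder} cmatrix \<Rightarrow> nat \<times> nat \<Rightarrow> real" where
  "gc_map A = (\<lambda>(i, j)\<in>{(i, j). 1 \<le> i \<and> i \<le> j \<and> j < CARD('n)}. gc_eigenvalue A i j)"

definition gc_fiber ::
  "(nat \<Rightarrow> real) \<Rightarrow> (nat \<times> nat \<Rightarrow> real) \<Rightarrow> 'n::{finite,linorder} cmatrix set" where
  "gc_fiber lam \<Lambda> = {A \<in> coadjoint_orbit lam. gc_map A = \<Lambda>}"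

section \<open>Gelfand--Cetlin triangles and chains of equalities\<close>

definition gc_triangle :: "nat \<Rightarrow> (nat \<Rightarrow> real) \<Rightarrow> (nat \<times> nat \<Rightarrow> real) \<Rightarrow> nat \<times> nat \<Rightarrow> real" where
  "gc_triangle n lam \<Lambda> = (\<lambda>(i, j). if j = n then lam i else \<Lambda> (i, j))"

definition positions :: "nat \<Rightarrow> (nat \<times> nat) set" where
  "positions n = {(i, j). 1 \<le> i \<and> i \<le> j \<and> j \<le> n}"

definition neighbours :: "nat \<times> nat \<Rightarrow> nat \<times> nat \<Rightarrow> bool" where
  "neighbours p q \<longleftrightarrow>
     (\<exists>i j. {p, q} = {(i, j), (i + 1, j)} \<or>
            {p, q} = {(i, j), (i, j + 1)} \<or>
            {p, q} = {(i, j), (i + 1, j + 1)})"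

definition interlacing :: "nat \<Rightarrow> (nat \<times> nat \<Rightarrow> real) \<Rightarrow> bool" where
  "interlacing n T \<longleftrightarrow>
     (\<forall>i j. 1 \<le> i \<and> i \<le> j \<and> j < n \<longrightarrow> T (i + 1, j + 1) \<le> T (i, j) \<and> T (i, j) \<le> T (i, j + 1))"

text \<open>An equality between neighbours is forced by the top row \<open>lam\<close> if it holds in every
  interlacing triangle with that top row.\<close>

definition regular_value :: "nat \<Rightarrow> (nat \<Rightarrow> real) \<Rightarrow> (nat \<times> nat \<Rightarrow> real) \<Rightarrow> bool" where
  "regular_value n lam \<Lambda> \<longleftrightarrow>
     (\<forall>p\<in>positions n. \<forall>q\<in>positions n.
        neighbours p q \<and> gc_triangle n lam \<Lambda> p = gc_triangle n lam \<Lambda> q \<longrightarrow>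
        (\<forall>\<Lambda>'. interlacing n (gc_triangle n lam \<Lambda>') \<longrightarrow>
              gc_triangle n lam \<Lambda>' p = gc_triangle n lam \<Lambda>' q))"

definition equality_edges :: "nat \<Rightarrow> (nat \<times> nat \<Rightarrow> real) \<Rightarrow> ((nat \<times> nat) \<times> (nat \<times> nat)) set" where
  "equality_edges n T =
     {(p, q). p \<in> positions n \<and> q \<in> positions n \<and> neighbours p q \<and> T p = T q}"

text \<open>Connected components; an entry different from all its neighbours is a chain, too.\<close>

definition chains :: "nat \<Rightarrow> (nat \<times> nat \<Rightarrow> real) \<Rightarrow> (nat \<times> nat) set set" where
  "chains n T = {(equality_edges n T)\<^sup>* `` {p} | p. p \<in> positions n}"

text \<open>The row with number \<open>1\<close> is the lowest one.\<close>

definition chain_sequence :: "(nat \<times> nat) set \<Rightarrow> nat list" where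
  "chain_sequence C =
     map (\<lambda>j. card {p \<in> C. snd p = j}) [Min (snd ` C)..<Suc (Max (snd ` C))]"

definition repeat_indices :: "nat list \<Rightarrow> nat set" where
  "repeat_indices l = {\<alpha>. 2 \<le> \<alpha> \<and> \<alpha> \<le> length l \<and> l ! (\<alpha> - 1) = l ! (\<alpha> - 2)}"

text \<open>Sum of the \<open>l\<^sub>\<alpha>\<close> with \<open>l\<^sub>\<alpha> = l\<^sub>\<alpha>\<^sub>-\<^sub>1\<close>, where \<open>\<alpha>\<close> counts from \<open>1\<close> and list positions count
  from \<open>0\<close>.\<close>

definition dimension_defect :: "(nat \<times> nat) set set \<Rightarrow> nat" where
  "dimension_defect \<C> =
     (\<Sum>C\<in>\<C>. \<Sum>\<alpha>\<in>repeat_indices (chain_sequence C). chain_sequence C ! (\<alpha> - 1))"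

text \<open>Entry \<open>(i, j)\<close> is drawn at height \<open>j\<close> and horizontal coordinate \<open>2 * i - j\<close>.\<close>

definition drawing :: "nat \<times> nat \<Rightarrow> real \<times> real" where
  "drawing = (\<lambda>(i, j). (2 * real i - real j, real j))"

definition vertical_axis :: "real \<Rightarrow> (nat \<times> nat) set \<Rightarrow> bool" where
  "vertical_axis c C \<longleftrightarrow> (\<lambda>(x, y). (2 * c - x, y)) ` drawing ` C = drawing ` C"

definition axially_symmetric :: "(nat \<times> nat) set \<Rightarrow> bool" where
  "axially_symmetric C \<longleftrightarrow> (\<exists>c. vertical_axis c C)"

section \<open>Diamonds\<close>

text \<open>Row \<open>k\<close> is the widest row, with columns \<open>i, \<dots>, i + l - 1\<close>.  All bounds are
  written without subtraction of natural numbers.\<close>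

definition diamond :: "nat \<Rightarrow> nat \<Rightarrow> nat \<Rightarrow> (nat \<times> nat) set" where
  "diamond l i k =
     {(a, j). k < j + l \<and> j \<le> k \<and> i \<le> a \<and> a + k < i + l + j} \<union>
     {(a, j). k \<le> j \<and> j < k + l \<and> i + j \<le> a + k \<and> a < i + l}"

definition diamonds :: "nat \<Rightarrow> (nat \<times> nat) set set" where
  "diamonds n =
     {diamond l i k | l i k. 1 \<le> l \<and> 1 \<le> i \<and> i + l \<le> k + 1 \<and> k + l \<le> n + 1}"

definition overlap_symmetrically :: "(nat \<times> nat) set \<Rightarrow> (nat \<times> nat) set \<Rightarrow> bool" where
  "overlap_symmetrically D D' \<longleftrightarrow> (\<exists>c. vertical_axis c D \<and> vertical_axis c D')"

definition union_of_symmetric_diamonds :: "nat \<Rightarrow> (nat \<times> nat) set \<Rightarrow> bool" where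
  "union_of_symmetric_diamonds n C \<longleftrightarrow>
     (\<exists>\<D>\<subseteq>diamonds n. (\<forall>D\<in>\<D>. \<forall>D'\<in>\<D>. overlap_symmetrically D D') \<and> C = \<Union>\<D>)"

end

theory Submission
  imports Defs
begin

text \<open>A matrix \<open>A\<close> is built by bordering: \<open>A\<^sub>k\<^sub>+\<^sub>1\<close> arises from \<open>A\<^sub>k\<close> by a column \<open>b\<close> and a corner entry \<open>c\<close>.
  If \<open>A\<^sub>k\<close> has the eigenvalues \<open>m\<close> with multiplicities \<open>a\<^sub>k(m)\<close> and \<open>r\<^sub>m\<close> is the squared length of the component
  of \<open>b\<close> in the eigenspace of \<open>m\<close>, the secular equation
  \<open>det (x - A\<^sub>k\<^sub>+\<^sub>1) = det (x - A\<^sub>k) (x - c - \<Sum>\<^sub>m r\<^sub>m / (x - m))\<close>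
  shows that prescribing the spectrum of \<open>A\<^sub>k\<^sub>+\<^sub>1\<close> means prescribing \<open>c\<close> and all \<open>r\<^sub>m\<close>, and that \<open>r\<^sub>m \<noteq> 0\<close> exactly if
  \<open>a\<^sub>k\<^sub>+\<^sub>1(m) < a\<^sub>k(m)\<close>.  So each step adds to the fiber a product of spheres of dimensions \<open>2 a\<^sub>k(m) - 1\<close>, over
  the values \<open>m\<close> whose multiplicity drops.  Replacing the eigenprojections of \<open>A\<^sub>k\<close> by Lagrange polynomials in
  \<open>A\<^sub>k\<close>, one gets polynomial equations on all matrices, and the inverse function theorem turns them
  into slice charts.

  In the triangle, an entry \<open>m\<close> occupies an interval of each row, whose ends move by at most one position from
  row to row; the chains are the maximal runs of rows in which \<open>m\<close> occurs.  Telescoping the squares of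
  the multiplicities gives \<open>2 dim + 2 \<Sum> l\<^sub>\<alpha> + \<Sum>\<^sub>m a\<^sub>n(m)\<^sup>2 = n\<^sup>2\<close>, the middle sum being over the repetitions
  \<open>l\<^sub>\<alpha> = l\<^sub>\<alpha>\<^sub>-\<^sub>1\<close>.  A repetition is the same as a shift of the centre of the interval.\<close>

section \<open>Smooth maps and slice charts\<close>

text \<open>A slice chart needs equations that make sense for all matrices X near a point A of the
  fiber, Hermitian or not and with any spectrum. Lagrange polynomials whose nodes are frozen at the
  spectrum of A are polynomial in X, also where a multiple eigenvalue of A splits; the price is that
  they project to eigenspaces only if X has that spectrum. So the equations are read column by
  column: column k is interpreted once the k-th leading block is known to have the right spectrum.
  The injectivity of the derivative follows the same order.

  That an eigencomponent vanishes must be expressed by as many equations as the eigenspace has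
  dimensions. It is therefore tested in the eigenbasis of A, on the open set where a determinant is
  nonzero.

  The dimension of the orbit never enters. The multiplicities in the top row are the same for all
  values of F, so two fibers are compared by subtracting two instances of the telescoped identity.
  For the regular one it suffices to exhibit an interlacing triangle without unforced equalities; it
  need not be shown to come from a matrix.\<close>

lemma has_derivative_frechet_derivative:
  "f differentiable (at x) \<Longrightarrow> (f has_derivative frechet_derivative f (at x)) (at x)"
  by (simp add: frechet_derivative_works)

lemma Ck_on_cong:
  assumes "open U" "\<And>x. x \<in> U \<Longrightarrow> f x = g x" "Ck_on k U f"
  shows "Ck_on k U g"
  using assms(2,3)
proof (induction k arbitrary: f g)
  case 0
  then show ?case by (auto cong: continuous_on_cong)
next
  case (Suc k)
  have der: "(g has_derivative frechet_derivative f (at x)) (at x)" if "x \<in> U" for x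
    using has_derivative_transform_within_open[of f "frechet_derivative f (at x)" x UNIV U g]
      has_derivative_frechet_derivative Suc.prems that assms(1) by auto
  have eq: "frechet_derivative f (at x) = frechet_derivative g (at x)" if "x \<in> U" for x
    using der[OF that] frechet_derivative_at by blast
  show ?case
    using Suc.prems(2) der eq Suc.IH[of "\<lambda>x. frechet_derivative f (at x) v" "\<lambda>x. frechet_derivative g (at x) v" for v]
    by (auto simp: differentiable_def)
qed

text \<open>\<open>Ck_on\<close> is stated with the chosen derivative
  \<open>frechet_derivative\<close>. Since derivatives are unique, any explicitly computed
  derivative may take its place, which is how all closure properties below are proved.\<close>

lemma Ck_on_SucI:
  assumes "open U" "\<And>x. x \<in> U \<Longrightarrow> (f has_derivative f' x) (at x)"
    "\<And>v. Ck_on k U (\<lambda>x. f' x v)"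
  shows "Ck_on (Suc k) U f"
proof -
  have eq: "f' x = frechet_derivative f (at x)" if "x \<in> U" for x
    using assms(2)[OF that] frechet_derivative_at by blast
  show ?thesis
    using assms(2) eq Ck_on_cong[OF assms(1) _ assms(3)]
    by (auto simp: differentiable_def)
qed

lemma Ck_on_SucD:
  assumes "Ck_on (Suc k) U f" "x \<in> U"
  shows "(f has_derivative frechet_derivative f (at x)) (at x)"
  using assms has_derivative_frechet_derivative by auto

lemma Ck_on_Suc_imp: "Ck_on (Suc k) U f \<Longrightarrow> Ck_on k U f"
proof (induction k arbitrary: f)
  case 0
  then show ?case
    by (auto intro!: continuous_at_imp_continuous_on differentiable_imp_continuous_within)
qed auto

lemma Ck_on_const: "Ck_on k U (\<lambda>x. c)"
  by (induction k arbitrary: c) (auto simp: frechet_derivative_const)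

lemma Ck_on_linear: "open U \<Longrightarrow> bounded_linear f \<Longrightarrow> Ck_on k U f"
proof (cases k)
  case (Suc j)
  assume "open U" "bounded_linear f"
  then show ?thesis unfolding Suc
    by (intro Ck_on_SucI[where f' = "\<lambda>_. f"]) (auto intro: bounded_linear_imp_has_derivative Ck_on_const)
qed (auto intro: linear_continuous_on)

lemma Ck_on_linear_compose:
  assumes "open U" "bounded_linear T"
  shows "Ck_on k U f \<Longrightarrow> Ck_on k U (\<lambda>x. T (f x))"
proof (induction k arbitrary: f)
  case 0
  then show ?case using assms by (auto intro: bounded_linear.continuous_on)
next
  case (Suc k)
  show ?case
    by (rule Ck_on_SucI[OF assms(1), where f' = "\<lambda>x v. T (frechet_derivative f (at x) v)"])
      (use Suc assms(2) Ck_on_SucD[OF Suc.prems] in \<open>auto intro: bounded_linear.has_derivative\<close>)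
qed

lemma Ck_on_add:
  assumes "open U"
  shows "Ck_on k U f \<Longrightarrow> Ck_on k U g \<Longrightarrow> Ck_on k U (\<lambda>x. f x + g x)"
proof (induction k arbitrary: f g)
  case 0
  then show ?case by (auto intro: continuous_on_add)
next
  case (Suc k)
  show ?case
    by (rule Ck_on_SucI[OF assms(1), where f' = "\<lambda>x v. frechet_derivative f (at x) v + frechet_derivative g (at x) v"])
      (use Suc Ck_on_SucD[OF Suc.prems(1)] Ck_on_SucD[OF Suc.prems(2)] in \<open>auto intro: has_derivative_add\<close>)
qed

lemma Ck_on_sum:
  assumes "open U" "\<And>i. i \<in> I \<Longrightarrow> Ck_on k U (f i)"
  shows "Ck_on k U (\<lambda>x. \<Sum>i\<in>I. f i x)"
proof (cases "finite I")
  case True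
  then show ?thesis using assms(2)
    by (induction I) (auto simp: Ck_on_const intro: Ck_on_add[OF assms(1)])
qed (simp add: Ck_on_const)

lemma Ck_on_bilinear:
  assumes "open U" "bounded_bilinear B"
  shows "Ck_on k U f \<Longrightarrow> Ck_on k U g \<Longrightarrow> Ck_on k U (\<lambda>x. B (f x) (g x))"
proof (induction k arbitrary: f g)
  case 0
  then show ?case by (auto intro: bounded_bilinear.continuous_on[OF assms(2)])
next
  case (Suc k)
  show ?case
    by (rule Ck_on_SucI[OF assms(1), where f' = "\<lambda>x v. B (f x) (frechet_derivative g (at x) v)
        + B (frechet_derivative f (at x) v) (g x)"])
      (use Suc.prems Ck_on_SucD[OF Suc.prems(1)] Ck_on_SucD[OF Suc.prems(2)] in
        \<open>auto intro!: bounded_bilinear.FDERIV[OF assms(2)] Ck_on_add[OF assms(1)] Suc.IH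
          Ck_on_Suc_imp[OF Suc.prems(1)] Ck_on_Suc_imp[OF Suc.prems(2)]\<close>)
qed

lemma smooth_on_const: "smooth_on U (\<lambda>x. c)"
  by (simp add: smooth_on_def Ck_on_const)

lemma smooth_on_linear: "open U \<Longrightarrow> bounded_linear f \<Longrightarrow> smooth_on U f"
  by (simp add: smooth_on_def Ck_on_linear)

lemma smooth_on_linear_compose:
  "open U \<Longrightarrow> bounded_linear T \<Longrightarrow> smooth_on U f \<Longrightarrow> smooth_on U (\<lambda>x. T (f x))"
  by (simp add: smooth_on_def Ck_on_linear_compose)

lemma smooth_on_add: "open U \<Longrightarrow> smooth_on U f \<Longrightarrow> smooth_on U g \<Longrightarrow> smooth_on U (\<lambda>x. f x + g x)"
  by (simp add: smooth_on_def Ck_on_add)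

lemma smooth_on_diff: "open U \<Longrightarrow> smooth_on U f \<Longrightarrow> smooth_on U g \<Longrightarrow> smooth_on U (\<lambda>x. f x - g x)"
  using smooth_on_add[of U f "\<lambda>x. - g x"] smooth_on_linear_compose[of U uminus g]
  by (simp add: bounded_linear_minus bounded_linear_ident)

lemma smooth_on_sum: "open U \<Longrightarrow> (\<And>i. i \<in> I \<Longrightarrow> smooth_on U (f i)) \<Longrightarrow> smooth_on U (\<lambda>x. \<Sum>i\<in>I. f i x)"
  by (simp add: smooth_on_def Ck_on_sum)

lemma smooth_on_bilinear: "open U \<Longrightarrow> bounded_bilinear B \<Longrightarrow> smooth_on U f \<Longrightarrow> smooth_on U g
   \<Longrightarrow> smooth_on U (\<lambda>x. B (f x) (g x))"
  by (simp add: smooth_on_def Ck_on_bilinear)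

lemma smooth_on_subset: "smooth_on U f \<Longrightarrow> V \<subseteq> U \<Longrightarrow> smooth_on V f"
proof -
  have "Ck_on k U f \<Longrightarrow> V \<subseteq> U \<Longrightarrow> Ck_on k V f" for k
    by (induction k arbitrary: f) (auto intro: continuous_on_subset)
  then show "smooth_on U f \<Longrightarrow> V \<subseteq> U \<Longrightarrow> smooth_on V f"
    by (auto simp: smooth_on_def)
qed

lemma smooth_on_differentiable: "smooth_on U f \<Longrightarrow> x \<in> U \<Longrightarrow> f differentiable (at x)"
  unfolding smooth_on_def by (metis Ck_on.simps(2))

lemma smooth_on_frechet_derivative: "smooth_on U f \<Longrightarrow> smooth_on U (\<lambda>x. frechet_derivative f (at x) v)"
  unfolding smooth_on_def by (metis Ck_on.simps(2))

lemma smooth_on_continuous_on: "smooth_on U f \<Longrightarrow> continuous_on U f"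
  unfolding smooth_on_def by (metis Ck_on.simps(1))

section \<open>Smoothness of inverse functions\<close>

lemma linear_eq_sum_Basis:
  fixes f :: "'a::euclidean_space \<Rightarrow> 'b::real_vector"
  assumes "linear f"
  shows "f w = (\<Sum>b\<in>Basis. (w \<bullet> b) *\<^sub>R f b)"
proof -
  have "f w = f (\<Sum>b\<in>Basis. (w \<bullet> b) *\<^sub>R b)" by (simp add: euclidean_representation)
  then show ?thesis by (simp add: linear_sum[OF assms] linear_scale[OF assms])
qed

text \<open>Write G for the inverse of D. Then G(y) v - G(x) v = - G(y) (D(y) - D(x)) w with the
  fixed vector w = G(x) v. Hence D has to be differentiable only along w, while its continuity in
  the operator norm keeps G(y) bounded near x.\<close>

lemma has_derivative_inverse_apply:
  fixes D :: "'a::euclidean_space \<Rightarrow> 'a \<Rightarrow>\<^sub>L 'a"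
  assumes U: "open U" "x \<in> U" and cont: "continuous_on U D"
    and bij: "\<And>y. y \<in> U \<Longrightarrow> bij (blinfun_apply (D y))"
    and C': "((\<lambda>y. D y (inv_into UNIV (blinfun_apply (D x)) v)) has_derivative C') (at x)"
  shows "((\<lambda>y. inv_into UNIV (blinfun_apply (D y)) v) has_derivative (\<lambda>h. - inv_into UNIV (blinfun_apply (D x)) (C' h))) (at x)"
proof -
  define G where "G y = inv_into UNIV (blinfun_apply (D y))" for y
  have GD: "G y (D y u) = u" and DG: "D y (G y u) = u" if "y \<in> U" for y u
    using bij[OF that] by (auto simp: G_def bij_is_inj bij_is_surj surj_f_inv_f)
  have linG: "linear (G y)" if "y \<in> U" for y
    unfolding G_def using bij[OF that]
    by (meson blinfun.bounded_linear_right bounded_linear.linear bij_is_inj bij_is_surj inj_linear_imp_inv_linear)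
  obtain K where K: "K > 0" "\<And>u. norm (G x u) \<le> K * norm u"
    using linear_bounded_pos[OF linG[OF U(2)]] by blast
  have blC: "bounded_linear C'" using C' has_derivative_bounded_linear by blast
  then obtain B where B: "B > 0" "\<And>h. norm (C' h) \<le> B * norm h"
    by (metis bounded_linear.pos_bounded mult.commute)
  have blG: "bounded_linear (G x)" using linG[OF U(2)] linear_conv_bounded_linear by blast
  show ?thesis
    unfolding has_derivative_at_alt G_def[symmetric]
  proof (intro conjI allI impI)
    show "bounded_linear (\<lambda>h. - G x (C' h))"
      using bounded_linear_minus[OF bounded_linear_compose[OF blG blC]] by simp
  next
    fix e :: real assume e: "e > 0"
    \<comment> \<open>The first bound turns the final factor \<eta> * 2K(1 + KB) into at most e; the
      second makes the perturbation D(x) - D(y) a contraction by 1/2 after applying G(x), as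
      \<open>nG\<close> needs.\<close>
    define \<eta> where "\<eta> = min (e / (2 * K * (1 + K * B))) (1 / (2 * K))"
    have pos: "2 * K * (1 + K * B) > 0" using K B by (auto intro!: mult_pos_pos add_pos_pos)
    have \<eta>: "\<eta> > 0" "\<eta> * (2 * K * (1 + K * B)) \<le> e" "K * \<eta> \<le> 1/2"
    proof -
      have "\<eta> \<le> e / (2 * K * (1 + K * B))" "\<eta> \<le> 1 / (2 * K)" by (simp_all add: \<eta>_def)
      then show "\<eta> * (2 * K * (1 + K * B)) \<le> e" "K * \<eta> \<le> 1/2"
        using pos_le_divide_eq[OF pos] pos_le_divide_eq[of "2 * K" \<eta> 1] K(1) by (simp_all add: mult_ac)
      show "\<eta> > 0" using e K(1) pos by (simp add: \<eta>_def)
    qed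
    obtain d1 where d1: "d1 > 0" "ball x d1 \<subseteq> U" using U open_contains_ball by blast
    obtain d2 where d2: "d2 > 0" "\<And>y. y \<in> U \<Longrightarrow> dist y x < d2 \<Longrightarrow> dist (D y) (D x) < \<eta>"
      using cont U(2) \<eta>(1) unfolding continuous_on_iff by metis
    obtain d3 where d3: "d3 > 0" "\<And>y. norm (y - x) < d3 \<Longrightarrow>
        norm (D y (G x v) - D x (G x v) - C' (y - x)) \<le> \<eta> * norm (y - x)"
      using C' \<eta>(1) unfolding has_derivative_at_alt G_def by metis
    show "\<exists>d>0. \<forall>y. norm (y - x) < d \<longrightarrow> norm (G y v - G x v - - G x (C' (y - x))) \<le> e * norm (y - x)"
    proof (intro exI[of _ "min d1 (min d2 d3)"] conjI allI impI)
      show "0 < min d1 (min d2 d3)" using d1 d2 d3 by simp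
      fix y assume y: "norm (y - x) < min d1 (min d2 d3)"
      have yU: "y \<in> U" using y d1 by (auto simp: subset_iff dist_norm norm_minus_commute)
      have nD: "norm (D x u - D y u) \<le> \<eta> * norm u" for u
      proof -
        have "norm (D x u - D y u) = norm ((D x - D y) u)" by (simp add: blinfun.diff_left)
        also have "\<dots> \<le> norm (D x - D y) * norm u" by (rule norm_blinfun)
        also have "\<dots> \<le> \<eta> * norm u"
          using d2(2)[OF yU] y by (intro mult_right_mono) (auto simp: dist_norm norm_minus_commute)
        finally show ?thesis .
      qed
      \<comment> \<open>For z = G(y) u, the vector D(x) z differs from u by at most \<eta> |z|.
        Applying G(x) costs a factor K, and since K \<eta> \<le> 1/2 the term with |z| is absorbed
        on the left.\<close>
      have nG: "norm (G y u) \<le> 2 * K * norm u" for u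
      proof -
        let ?z = "G y u"
        have "?z = G x (D x ?z)" using GD U(2) by simp
        also have "D x ?z = u + (D x ?z - D y ?z)" using DG[OF yU] by simp
        finally have "norm ?z \<le> K * norm (u + (D x ?z - D y ?z))" using K(2) by metis
        also have "\<dots> \<le> K * (norm u + \<eta> * norm ?z)"
          using K(1) norm_triangle_ineq[of u "D x ?z - D y ?z"] nD[of ?z] by (intro mult_left_mono) auto
        also have "\<dots> = K * norm u + (K * \<eta>) * norm ?z" by (simp add: algebra_simps)
        also have "\<dots> \<le> K * norm u + 1/2 * norm ?z"
          using \<eta>(3) by (intro add_left_mono mult_right_mono) auto
        finally show ?thesis by simp
      qed
      let ?h = "y - x" let ?z = "G x (C' ?h)"
      have lin: "G y (a + b) = G y a + G y b" "G y (a - b) = G y a - G y b" for a b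
        using linG[OF yU] by (auto simp: linear_add linear_diff)
      have "G y v - G x v - - ?z = - G y ((D y (G x v) - D x (G x v) - C' ?h) + (D x ?z - D y ?z))"
        by (simp add: lin GD[OF yU] DG[OF U(2)])
      then have "norm (G y v - G x v - - ?z) = norm (G y ((D y (G x v) - D x (G x v) - C' ?h) + (D x ?z - D y ?z)))"
        by (simp only: norm_minus_cancel)
      also have "\<dots> \<le> 2 * K * norm ((D y (G x v) - D x (G x v) - C' ?h) + (D x ?z - D y ?z))" by (rule nG)
      also have "\<dots> \<le> 2 * K * (\<eta> * norm ?h + \<eta> * (K * (B * norm ?h)))"
      proof (intro mult_left_mono norm_triangle_le add_mono)
        show "norm (D y (G x v) - D x (G x v) - C' ?h) \<le> \<eta> * norm ?h" using d3 y by auto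
        have "norm (D x ?z - D y ?z) \<le> \<eta> * norm ?z" by (rule nD)
        also have "\<dots> \<le> \<eta> * (K * norm (C' ?h))" using \<eta>(1) K by (intro mult_left_mono) auto
        also have "\<dots> \<le> \<eta> * (K * (B * norm ?h))" using \<eta>(1) K B by (intro mult_left_mono) auto
        finally show "norm (D x ?z - D y ?z) \<le> \<eta> * (K * (B * norm ?h))" .
      qed (use K in auto)
      also have "\<dots> = \<eta> * (2 * K * (1 + K * B)) * norm ?h" by (simp add: algebra_simps)
      also have "\<dots> \<le> e * norm ?h" using \<eta>(2) by (intro mult_right_mono) auto
      finally show "norm (G y v - G x v - - ?z) \<le> e * norm ?h" .
    qed
  qed
qed

lemma continuous_on_Blinfun_derivative:
  fixes f :: "'a::euclidean_space \<Rightarrow> 'b::euclidean_space"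
  assumes "smooth_on U f"
  shows "continuous_on U (\<lambda>x. Blinfun (frechet_derivative f (at x)))"
proof (rule continuous_on_blinfun_componentwise)
  fix i :: 'a
  have "blinfun_apply (Blinfun (frechet_derivative f (at x))) = frechet_derivative f (at x)" if "x \<in> U" for x
    using smooth_on_differentiable[OF assms that]
    by (simp add: bounded_linear_Blinfun_apply frechet_derivative_works has_derivative_bounded_linear)
  moreover have "continuous_on U (\<lambda>x. frechet_derivative f (at x) i)"
    using smooth_on_frechet_derivative[OF assms] smooth_on_continuous_on by blast
  ultimately show "continuous_on U (\<lambda>x. blinfun_apply (Blinfun (frechet_derivative f (at x))) i)"
    by (simp cong: continuous_on_cong)
qed

text \<open>The derivative of x \<mapsto> Df(x)^-1 v in direction u is - Df(x)^-1 applied to the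
  second derivative of f at u and Df(x)^-1 v. It is composed of functions of the same kind and of
  smooth ones, so the order of differentiability climbs by induction, for all v at once.\<close>

lemma smooth_on_inverse_derivative:
  fixes f :: "'a::euclidean_space \<Rightarrow> 'a"
  assumes U: "open U" and f: "smooth_on U f"
    and bij: "\<And>x. x \<in> U \<Longrightarrow> bij (frechet_derivative f (at x))"
  shows "smooth_on U (\<lambda>x. inv_into UNIV (frechet_derivative f (at x)) v)"
proof -
  let ?D = "\<lambda>x. frechet_derivative f (at x)"
  let ?E = "\<lambda>b u x. frechet_derivative (\<lambda>y. ?D y b) (at x) u"
  define W where "W x v = inv_into UNIV (?D x) v" for x v
  have bl: "bounded_linear (?D x)" if "x \<in> U" for x
    using smooth_on_differentiable[OF f that] by (simp add: frechet_derivative_works has_derivative_bounded_linear)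
  have app: "blinfun_apply (Blinfun (?D x)) = ?D x" if "x \<in> U" for x
    by (simp add: bl that bounded_linear_Blinfun_apply)
  note cont = continuous_on_Blinfun_derivative[OF f]
  have expand: "?D x w = (\<Sum>b\<in>Basis. (w \<bullet> b) *\<^sub>R ?D x b)" if "x \<in> U" for x w
    using linear_eq_sum_Basis[OF bounded_linear.linear[OF bl[OF that]]] .
  have linW: "linear (W x)" if "x \<in> U" for x
    unfolding W_def using bij[OF that] bl[OF that]
    by (meson bounded_linear.linear bij_is_inj bij_is_surj inj_linear_imp_inv_linear)
  have der: "((\<lambda>y. W y v) has_derivative (\<lambda>h. - W x (\<Sum>b\<in>Basis. (W x v \<bullet> b) *\<^sub>R ?E b h x))) (at x)"
    if x: "x \<in> U" for x v
  proof -
    have "((\<lambda>y. \<Sum>b\<in>Basis. (W x v \<bullet> b) *\<^sub>R ?D y b) has_derivative (\<lambda>h. \<Sum>b\<in>Basis. (W x v \<bullet> b) *\<^sub>R ?E b h x)) (at x)"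
      using smooth_on_differentiable[OF smooth_on_frechet_derivative[OF f] x]
      by (intro has_derivative_sum has_derivative_scaleR_right has_derivative_frechet_derivative) auto
    then have "((\<lambda>y. Blinfun (?D y) (W x v)) has_derivative (\<lambda>h. \<Sum>b\<in>Basis. (W x v \<bullet> b) *\<^sub>R ?E b h x)) (at x)"
      by (rule has_derivative_transform_within_open[OF _ U x]) (simp add: app expand[symmetric])
    then have "((\<lambda>y. inv_into UNIV (blinfun_apply (Blinfun (?D y))) v) has_derivative
       (\<lambda>h. - inv_into UNIV (blinfun_apply (Blinfun (?D x))) (\<Sum>b\<in>Basis. (W x v \<bullet> b) *\<^sub>R ?E b h x))) (at x)"
      by (intro has_derivative_inverse_apply[OF U x cont]) (use bij app x in \<open>auto simp: W_def\<close>)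
    then have "((\<lambda>y. inv_into UNIV (blinfun_apply (Blinfun (?D y))) v) has_derivative
       (\<lambda>h. - W x (\<Sum>b\<in>Basis. (W x v \<bullet> b) *\<^sub>R ?E b h x))) (at x)"
      by (simp add: app x W_def)
    then show ?thesis
      by (rule has_derivative_transform_within_open[OF _ U x]) (simp add: app W_def)
  qed
  \<comment> \<open>This allows the argument of \<open>W x\<close> to vary with x: the induction
    hypothesis is only about fixed vectors and is applied to the basis vectors.\<close>
  have expW: "W x z = (\<Sum>e\<in>Basis. (z \<bullet> e) *\<^sub>R W x e)" if "x \<in> U" for x z
    using linear_eq_sum_Basis[OF linW[OF that]] .
  have "Ck_on k U (\<lambda>x. W x v)" for k v
  proof (induction k arbitrary: v)
    case 0
    show ?case
      using der by (auto intro!: continuous_at_imp_continuous_on has_derivative_continuous)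
  next
    case (Suc k)
    have E: "Ck_on k U (?E b u)" for b u
      using smooth_on_frechet_derivative[OF smooth_on_frechet_derivative[OF f]] by (auto simp: smooth_on_def)
    show ?case
    proof (rule Ck_on_SucI[OF U der])
      fix u
      have "Ck_on k U (\<lambda>x. - (\<Sum>e\<in>Basis. ((\<Sum>b\<in>Basis. (W x v \<bullet> b) *\<^sub>R ?E b u x) \<bullet> e) *\<^sub>R W x e))"
        by (intro Ck_on_linear_compose[OF U, of uminus] Ck_on_sum[OF U] Ck_on_bilinear[OF U bounded_bilinear_scaleR]
            Ck_on_bilinear[OF U bounded_bilinear_inner] Suc Ck_on_const E bounded_linear_minus bounded_linear_ident)
      then show "Ck_on k U (\<lambda>x. - W x (\<Sum>b\<in>Basis. (W x v \<bullet> b) *\<^sub>R ?E b u x))"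
        by (rule Ck_on_cong[OF U, rotated]) (simp add: expW[symmetric])
    qed
  qed
  then show ?thesis by (simp add: smooth_on_def W_def)
qed

theorem smooth_inverse_function:
  fixes f :: "'a::euclidean_space \<Rightarrow> 'a"
  assumes W: "open W" "p \<in> W" and f: "smooth_on W f"
    and inj: "\<And>h. frechet_derivative f (at p) h = 0 \<Longrightarrow> h = 0"
  obtains U V g where "open U" "p \<in> U" "U \<subseteq> W" "open V" "homeomorphism U V f g" "smooth_on U f" "smooth_on V g"
proof -
  let ?D = "\<lambda>x. frechet_derivative f (at x)"
  have bl: "bounded_linear (?D x)" if "x \<in> W" for x
    using smooth_on_differentiable[OF f that] by (simp add: frechet_derivative_works has_derivative_bounded_linear)
  have app: "blinfun_apply (Blinfun (?D x)) = ?D x" if "x \<in> W" for x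
    by (simp add: bl that bounded_linear_Blinfun_apply)
  note cont = continuous_on_Blinfun_derivative[OF f]
  have lin: "linear (?D p)" using bl[OF W(2)] bounded_linear.linear by blast
  have "inj (?D p)" using inj linear_injective_0[OF lin] by blast
  then obtain L where L: "linear L" "L \<circ> ?D p = id" using linear_injective_left_inverse[OF lin] by blast
  have Lb: "blinfun_apply (Blinfun L) = L" using L(1) by (simp add: bounded_linear_Blinfun_apply linear_conv_bounded_linear)
  have inv: "Blinfun L o\<^sub>L Blinfun (?D p) = id_blinfun"
    using L(2) by (intro blinfun_eqI) (simp add: Lb app[OF W(2)] fun_eq_iff)
  have der: "(f has_derivative blinfun_apply (Blinfun (?D x))) (at x)" if "x \<in> W" for x
    using smooth_on_differentiable[OF f that] by (simp add: app[OF that] frechet_derivative_works)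
  obtain U V g g' where UV: "open U" "U \<subseteq> W" "p \<in> U" "open V" "f p \<in> V" "homeomorphism U V f g"
    and g: "\<And>y. y \<in> V \<Longrightarrow> (g has_derivative (g' y)) (at y)"
    "\<And>y. y \<in> V \<Longrightarrow> g' y = inv_into UNIV (blinfun_apply (Blinfun (?D (g y))))"
    "\<And>y. y \<in> V \<Longrightarrow> bij (blinfun_apply (Blinfun (?D (g y))))"
    using inverse_function_theorem[OF W(1) der cont W(2) inv] by metis
  have gU: "g y \<in> U" if "y \<in> V" for y using UV(6) that by (auto simp: homeomorphism_def)
  have g'': "g' y = inv_into UNIV (?D (g y))" if "y \<in> V" for y using g(2)[OF that] gU[OF that] UV(2) app by auto
  have bij: "bij (?D x)" if "x \<in> U" for x
  proof -
    have "f x \<in> V" "g (f x) = x" using UV(6) that by (auto simp: homeomorphism_def)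
    then show ?thesis using g(3)[of "f x"] app that UV(2) by auto
  qed
  have fU: "smooth_on U f" using smooth_on_subset[OF f UV(2)] .
  \<comment> \<open>The claim is made for h o g with arbitrary smooth h instead of g alone: each
    directional derivative of h o g is again a smooth function on U composed with g, so the
    induction closes.\<close>
  have key: "smooth_on U h \<Longrightarrow> Ck_on k V (\<lambda>y. h (g y))" for k and h :: "'a \<Rightarrow> 'a"
  proof (induction k arbitrary: h)
    case 0
    have "continuous_on V g" "g ` V = U" using UV(6) by (auto simp: homeomorphism_def)
    then show ?case using smooth_on_continuous_on[OF 0] by (auto intro: continuous_on_compose2)
  next
    case (Suc k)
    show ?case
    proof (rule Ck_on_SucI[OF UV(4)])
      fix y assume y: "y \<in> V"
      have "(h has_derivative frechet_derivative h (at (g y))) (at (g y))"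
        using smooth_on_differentiable[OF Suc.prems gU[OF y]] by (simp add: frechet_derivative_works)
      then show "((\<lambda>y. h (g y)) has_derivative (\<lambda>v. frechet_derivative h (at (g y)) (inv_into UNIV (?D (g y)) v))) (at y)"
        using has_derivative_compose[OF g(1)[OF y]] g''[OF y] by simp
    next
      fix v
      have bh: "linear (frechet_derivative h (at x))" if "x \<in> U" for x
        using smooth_on_differentiable[OF Suc.prems that] linear_frechet_derivative by blast
      have ex: "frechet_derivative h (at x) z = (\<Sum>b\<in>Basis. (z \<bullet> b) *\<^sub>R frechet_derivative h (at x) b)" if "x \<in> U" for x z
        using linear_eq_sum_Basis[OF bh[OF that]] .
      have "smooth_on U (\<lambda>x. \<Sum>b\<in>Basis. (inv_into UNIV (?D x) v \<bullet> b) *\<^sub>R frechet_derivative h (at x) b)"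
        by (intro smooth_on_sum[OF UV(1)] smooth_on_bilinear[OF UV(1) bounded_bilinear_scaleR]
            smooth_on_bilinear[OF UV(1) bounded_bilinear_inner] smooth_on_const
            smooth_on_frechet_derivative[OF Suc.prems] smooth_on_inverse_derivative[OF UV(1) fU bij])
      then have "Ck_on k V (\<lambda>y. \<Sum>b\<in>Basis. (inv_into UNIV (?D (g y)) v \<bullet> b) *\<^sub>R frechet_derivative h (at (g y)) b)"
        using Suc.IH[of "\<lambda>x. \<Sum>b\<in>Basis. (inv_into UNIV (?D x) v \<bullet> b) *\<^sub>R frechet_derivative h (at x) b"] by simp
      then show "Ck_on k V (\<lambda>y. frechet_derivative h (at (g y)) (inv_into UNIV (?D (g y)) v))"
        by (rule Ck_on_cong[OF UV(4), rotated]) (simp add: ex[OF gU, symmetric])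
    qed
  qed
  have "smooth_on V g"
    using key[of "\<lambda>x. x"] smooth_on_linear[OF UV(1) bounded_linear_ident] by (simp add: smooth_on_def)
  then show ?thesis using that UV fU by blast
qed

text \<open>The change from one chart to another at a common point embeds a nonempty open subset of
  L continuously into L', so invariance of dimension applies. By symmetry the dimension is unique,
  which gives \<open>submanifold_dim\<close> its meaning.\<close>

lemma smooth_submanifold_dim_le:
  fixes S :: "'a::euclidean_space set"
  assumes "smooth_submanifold d S" "smooth_submanifold e S" "S \<noteq> {}"
  shows "d \<le> e"
proof -
  obtain p where p: "p \<in> S" using assms(3) by blast
  obtain U and V :: "'a set" and \<phi> \<psi> L where "open U \<and> p \<in> U \<and> open V \<and> homeomorphism U V \<phi> \<psi> \<and>
      smooth_on U \<phi> \<and> smooth_on V \<psi> \<and> subspace L \<and> dim L = d \<and> \<phi> ` (U \<inter> S) = V \<inter> L"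
    using bspec[OF assms(1)[unfolded smooth_submanifold_def] p] by (elim exE) (erule that)
  then have 1: "open U" "p \<in> U" "open V" "homeomorphism U V \<phi> \<psi>" "subspace L" "dim L = d"
    "\<phi> ` (U \<inter> S) = V \<inter> L" by simp_all
  obtain U' and V' :: "'a set" and \<phi>' \<psi>' L' where "open U' \<and> p \<in> U' \<and> open V' \<and> homeomorphism U' V' \<phi>' \<psi>' \<and>
      smooth_on U' \<phi>' \<and> smooth_on V' \<psi>' \<and> subspace L' \<and> dim L' = e \<and> \<phi>' ` (U' \<inter> S) = V' \<inter> L'"
    using bspec[OF assms(2)[unfolded smooth_submanifold_def] p] by (elim exE) (erule that)
  then have 2: "open U'" "p \<in> U'" "open V'" "homeomorphism U' V' \<phi>' \<psi>'" "subspace L'" "dim L' = e"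
    "\<phi>' ` (U' \<inter> S) = V' \<inter> L'" by simp_all
  let ?W = "\<phi> ` (U \<inter> U')"
  have sub: "x \<in> ?W \<inter> L \<Longrightarrow> \<psi> x \<in> U \<inter> U' \<inter> S" for x
  proof -
    assume x: "x \<in> ?W \<inter> L"
    then obtain u where u: "u \<in> U \<inter> U'" "x = \<phi> u" by blast
    then have "x \<in> V \<inter> L" using x 1(4) by (auto simp: homeomorphism_def)
    then obtain s where s: "s \<in> U \<inter> S" "x = \<phi> s" using 1(7) by blast
    then have "s = u" using u 1(4) unfolding homeomorphism_def by (metis IntD1)
    then show ?thesis using s u 1(4) by (simp add: homeomorphism_def)
  qed
  have "openin (top_of_set U) (U \<inter> U')" using 2(1) by (simp add: openin_open_Int)
  then have "openin (top_of_set V) ?W" using homeomorphism_imp_open_map[OF 1(4)] by blast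
  then have "open ?W" using 1(3) openin_open_eq by blast
  then have op: "openin (top_of_set L) (?W \<inter> L)" by (metis Int_commute openin_open_Int)
  have "dim L \<le> dim L'"
  proof (rule invariance_of_dimension_subspaces[OF op 1(5) 2(5)])
    have c1: "continuous_on (?W \<inter> L) \<psi>"
      by (rule continuous_on_subset[of V]) (use 1(4) in \<open>auto simp: homeomorphism_def\<close>)
    have c2: "continuous_on (\<psi> ` (?W \<inter> L)) \<phi>'"
      by (rule continuous_on_subset[of U']) (use sub 2(4) in \<open>auto simp: homeomorphism_def\<close>)
    show "continuous_on (?W \<inter> L) (\<phi>' \<circ> \<psi>)" using continuous_on_compose[OF c1 c2] .
    show "\<phi>' \<circ> \<psi> \<in> ?W \<inter> L \<rightarrow> L'"
    proof
      fix x assume "x \<in> ?W \<inter> L"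
      then have "\<psi> x \<in> U' \<inter> S" using sub by blast
      then show "(\<phi>' \<circ> \<psi>) x \<in> L'" using 2(7) by auto
    qed
    show "inj_on (\<phi>' \<circ> \<psi>) (?W \<inter> L)"
    proof (rule comp_inj_on)
      have "\<phi> (\<psi> x) = x" if "x \<in> ?W \<inter> L" for x using that 1(4) by (auto simp: homeomorphism_def)
      then show "inj_on \<psi> (?W \<inter> L)" by (metis inj_on_inverseI)
      have "\<psi>' (\<phi>' x) = x" if "x \<in> \<psi> ` (?W \<inter> L)" for x using that sub 2(4) by (auto simp: homeomorphism_def)
      then show "inj_on \<phi>' (\<psi> ` (?W \<inter> L))" by (metis inj_on_inverseI)
    qed
    show "?W \<inter> L \<noteq> {}" using 1(2,7) 2(2) p by blast
  qed
  then show ?thesis using 1(6) 2(6) by simp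
qed

lemma submanifold_dim_eqI:
  assumes "smooth_submanifold d S" "S \<noteq> {}"
  shows "submanifold_dim S = d"
  unfolding submanifold_dim_def
  by (rule the_equality[where P = "\<lambda>d. smooth_submanifold d S", OF assms(1)]) (meson antisym assms smooth_submanifold_dim_le)

section \<open>Hermitian matrices\<close>

definition hadj :: "complex mat \<Rightarrow> complex mat" where
  "hadj A = Matrix.mat (dim_col A) (dim_row A) (\<lambda>(i, j). cnj (A $$ (j, i)))"

lemma hadj_carrier[simp]: "A \<in> carrier_mat n m \<Longrightarrow> hadj A \<in> carrier_mat m n"
  by (auto simp: hadj_def)

lemma hadj_index[simp]: "i < dim_col A \<Longrightarrow> j < dim_row A \<Longrightarrow> hadj A $$ (i, j) = cnj (A $$ (j, i))"
  by (simp add: hadj_def)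

lemma hadj_dim[simp]: "dim_row (hadj A) = dim_col A" "dim_col (hadj A) = dim_row A"
  by (auto simp: hadj_def)

lemma hadj_mult:
  assumes "A \<in> carrier_mat n m" "B \<in> carrier_mat m l"
  shows "hadj (A * B) = hadj B * hadj A"
  using assms by (intro eq_matI) (auto simp: scalar_prod_def mult.commute)

lemma mat_mult_assoc4:
  fixes A :: "complex mat"
  assumes "A \<in> carrier_mat n n" "B \<in> carrier_mat n n" "C \<in> carrier_mat n n" "D \<in> carrier_mat n n"
  shows "A * (B * C * D) = A * B * C * D" "A * B * (C * D) = A * (B * C) * D"
  using assms by (simp_all add: assoc_mult_mat[of _ n n _ n _ n])

lemma mat_mult_assoc5:
  fixes A :: "complex mat"
  assumes "A \<in> carrier_mat n n" "B \<in> carrier_mat n n" "C \<in> carrier_mat n n" "D \<in> carrier_mat n n" "E \<in> carrier_mat n n"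
  shows "A * (B * C * D) * E = A * B * C * (D * E)"
  using assms by (simp add: assoc_mult_mat[of _ n n _ n _ n])

text \<open>The Householder reflection in the hyperplane orthogonal to \<open>q - e\<^sub>0\<close>; as \<open>q\<^sub>0 \<le> 0\<close>, this
  vector is nonzero.\<close>

lemma unitary_with_first_column:
  fixes q :: "nat \<Rightarrow> complex"
  assumes n: "n > 0" and norm: "(\<Sum>i<n. (cmod (q i))\<^sup>2) = 1" and q0: "q 0 = complex_of_real t" "t \<le> 0"
  obtains U where "U \<in> carrier_mat n n" "hadj U = U" "U * U = 1\<^sub>m n" "\<And>i. i < n \<Longrightarrow> U $$ (i, 0) = q i"
proof -
  define w where "w i = q i - (if i = 0 then 1 else 0)" for i
  \<comment> \<open>As q has norm 1, the squared norm of w is 2 - 2t, so a is 2 / |w|^2, the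
    constant of the Householder reflection.\<close>
  define a where "a = 1 / (1 - complex_of_real t)"
  have t1: "1 - complex_of_real t \<noteq> 0"
  proof -
    have "complex_of_real (1 - t) \<noteq> 0" using q0(2) by (simp only: of_real_eq_0_iff)
    then show ?thesis by simp
  qed
  define U where "U = Matrix.mat n n (\<lambda>(i, j). (if i = j then 1 else 0) - a * w i * cnj (w j))"
  have cw: "(\<Sum>s<n. w s * cnj (w s)) = 2 / a"
  proof -
    have "(\<Sum>s<n. w s * cnj (w s)) = (\<Sum>s<n. q s * cnj (q s) - (if s = 0 then q s + cnj (q s) - 1 else 0))"
      by (intro sum.cong) (auto simp: w_def algebra_simps)
    also have "\<dots> = (\<Sum>s<n. q s * cnj (q s)) - (\<Sum>s<n. if s = 0 then q s + cnj (q s) - 1 else 0)"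
      by (rule sum_subtractf)
    also have "(\<Sum>s<n. q s * cnj (q s)) = complex_of_real (\<Sum>i<n. (cmod (q i))\<^sup>2)"
      by (simp only: of_real_sum complex_norm_square)
    also have "\<dots> = 1" by (simp add: norm)
    also have "(\<Sum>s<n. if s = 0 then q s + cnj (q s) - 1 else 0) = q 0 + cnj (q 0) - 1"
      using n by simp
    finally show ?thesis using t1 by (simp add: a_def q0 field_simps)
  qed
  have ca: "cnj a = a" by (simp add: a_def)
  have a0: "a \<noteq> 0" using t1 by (simp add: a_def)
  have U: "U \<in> carrier_mat n n" by (simp add: U_def)
  moreover have "hadj U = U"
    by (rule eq_matI) (auto simp: U_def ca mult_ac)
  moreover have "U * U = 1\<^sub>m n"
  proof (rule eq_matI)
    fix i j assume ij: "i < dim_row (1\<^sub>m n :: complex mat)" "j < dim_col (1\<^sub>m n :: complex mat)"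
    then have "(U * U) $$ (i, j) = (\<Sum>s<n. ((if i = s then 1 else 0) - a * w i * cnj (w s)) * ((if s = j then 1 else 0) - a * w s * cnj (w j)))"
      by (auto simp: U_def scalar_prod_def lessThan_atLeast0)
    also have "\<dots> = (\<Sum>s<n. (if s = i then (if i = j then 1 else 0) - a * w i * cnj (w j) else 0)
        - (if s = j then a * w i * cnj (w j) else 0) + a * a * w i * cnj (w j) * (w s * cnj (w s)))"
      by (intro sum.cong) (auto simp: algebra_simps)
    also have "\<dots> = ((if i = j then 1 else 0) - a * w i * cnj (w j)) - a * w i * cnj (w j)
        + a * a * w i * cnj (w j) * (\<Sum>s<n. w s * cnj (w s))"
      using ij by (simp add: sum.distrib sum_subtractf sum_distrib_left)
    also have "\<dots> = (if i = j then 1 else 0)" using a0 by (simp add: cw)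
    finally show "(U * U) $$ (i, j) = 1\<^sub>m n $$ (i, j)" using ij by simp
  qed (use U in auto)
  moreover have "U $$ (i, 0) = q i" if "i < n" for i
  proof -
    have "U $$ (i, 0) = (if i = 0 then 1 else 0) - a * w i * cnj (w 0)" using that n by (simp add: U_def)
    also have "a * w i * cnj (w 0) = - w i" using t1 by (simp add: w_def[of 0] q0 a_def field_simps)
    finally show ?thesis by (simp add: w_def)
  qed
  ultimately show ?thesis using that by blast
qed

text \<open>The phase of an eigenvector is free. It is used to make entry 0 real and nonpositive,
  the normalisation that \<open>unitary_with_first_column\<close> expects.\<close>

lemma unit_eigenvector:
  fixes A :: "complex mat"
  assumes A: "A \<in> carrier_mat n n" and ev: "eigenvalue A e"
  obtains q :: "nat \<Rightarrow> complex" and t where "(\<Sum>i<n. (cmod (q i))\<^sup>2) = 1" "q 0 = complex_of_real t" "t \<le> 0"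
    "\<And>i. i < n \<Longrightarrow> (\<Sum>s<n. A $$ (i, s) * q s) = e * q i"
proof -
  obtain v where v: "v \<in> carrier_vec n" "v \<noteq> 0\<^sub>v n" "A *\<^sub>v v = e \<cdot>\<^sub>v v"
    using ev A unfolding eigenvalue_def eigenvector_def by auto
  define N where "N = (\<Sum>i<n. (cmod (v $ i))\<^sup>2)"
  obtain i0 where i0: "i0 < n" "v $ i0 \<noteq> 0" using v(1,2) by (metis carrier_vecD eq_vecI index_zero_vec(1) index_zero_vec(2))
  have "N > 0" unfolding N_def
    by (rule sum_pos2[of _ i0]) (use i0 in auto)
  define z where "z = (if v $ 0 = 0 then 1 else - cnj (v $ 0) / cmod (v $ 0)) / sqrt N"
  have zn: "cmod z = 1 / sqrt N" using \<open>N > 0\<close> by (simp add: z_def norm_divide norm_mult)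
  define q where "q i = z * v $ i" for i
  have "(\<Sum>i<n. (cmod (q i))\<^sup>2) = (cmod z)\<^sup>2 * N"
    by (simp add: q_def norm_mult power_mult_distrib sum_distrib_left N_def)
  then have 1: "(\<Sum>i<n. (cmod (q i))\<^sup>2) = 1" using zn \<open>N > 0\<close> by (simp add: power_divide)
  have 2: "q 0 = complex_of_real (- (cmod (v $ 0) / sqrt N))"
  proof (cases "v $ 0 = 0")
    case False
    have "cnj (v $ 0) * v $ 0 = complex_of_real ((cmod (v $ 0))\<^sup>2)"
      by (subst complex_norm_square) (rule mult.commute)
    then have "cnj (v $ 0) * v $ 0 = complex_of_real (cmod (v $ 0)) * complex_of_real (cmod (v $ 0))"
      by (simp only: power2_eq_square of_real_mult)
    moreover have "(- c / a) / s * u = - ((c * u) / a) / s" for a c s u :: complex by simp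
    moreover have "q 0 = (- cnj (v $ 0) / complex_of_real (cmod (v $ 0))) / complex_of_real (sqrt N) * v $ 0"
      using False by (simp only: q_def z_def if_False)
    ultimately have "q 0 = - complex_of_real (cmod (v $ 0)) / complex_of_real (sqrt N)"
      using False by (simp only: nonzero_mult_div_cancel_left of_real_eq_0_iff norm_eq_zero not_False_eq_True)
    then show ?thesis by simp
  qed (simp add: q_def)
  have 3: "(\<Sum>s<n. A $$ (i, s) * q s) = e * q i" if "i < n" for i
  proof -
    have "(A *\<^sub>v v) $ i = (e \<cdot>\<^sub>v v) $ i" using v(3) by simp
    then have "(\<Sum>s<n. A $$ (i, s) * v $ s) = e * v $ i"
      using that A v(1) by (simp add: scalar_prod_def lessThan_atLeast0)
    then show ?thesis by (simp add: q_def sum_distrib_left[symmetric] mult.left_commute)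
  qed
  show ?thesis by (rule that[OF 1 2 _ 3]) (use \<open>N > 0\<close> in auto)
qed

text \<open>Deflation: conjugation by a unitary whose first column is an eigenvector for
  \<open>d 0\<close> clears column 0 off the diagonal, and the Hermitian symmetry clears row 0 as
  well. Cancelling one linear factor leaves the hypothesis for the remaining block. Taking
  \<open>d 0\<close> first keeps the prescribed order of the eigenvalues.\<close>

lemma hermitian_unitarily_diagonalisable:
  assumes "A \<in> carrier_mat n n" "hadj A = A" "char_poly A = (\<Prod>i<n. [:- complex_of_real (d i), 1:])"
  shows "\<exists>Q. Q \<in> carrier_mat n n \<and> hadj Q * Q = 1\<^sub>m n \<and> Q * hadj Q = 1\<^sub>m n \<and>
    A = Q * mat_diag n (\<lambda>i. complex_of_real (d i)) * hadj Q"
  using assms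
proof (induction n arbitrary: A d)
  case 0
  show ?case by (rule exI[of _ "1\<^sub>m 0"]) (use 0 in auto)
next
  case (Suc n)
  note A = Suc.prems(1) and herm = Suc.prems(2)
  have "poly (char_poly A) (d 0) = 0" unfolding Suc.prems(3) prod.lessThan_Suc_shift by simp
  then have ev: "eigenvalue A (complex_of_real (d 0))" using eigenvalue_root_char_poly[OF A] by simp
  obtain q :: "nat \<Rightarrow> complex" and t where q: "(\<Sum>i<Suc n. (cmod (q i))\<^sup>2) = 1" "q 0 = complex_of_real t" "t \<le> 0"
    "\<And>i. i < Suc n \<Longrightarrow> (\<Sum>s<Suc n. A $$ (i, s) * q s) = d 0 * q i"
    by (rule unit_eigenvector[OF A ev]) (rule that)
  obtain U where U: "U \<in> carrier_mat (Suc n) (Suc n)" "hadj U = U" "U * U = 1\<^sub>m (Suc n)"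
    "\<And>i. i < Suc n \<Longrightarrow> U $$ (i, 0) = q i"
    by (rule unitary_with_first_column[OF zero_less_Suc q(1-3)]) (rule that)
  define H where "H = U * A * U"
  have H: "H \<in> carrier_mat (Suc n) (Suc n)" using U A by (auto simp: H_def)
  have AH: "A = U * H * U"
    using A U(1) U(3) by (simp add: H_def assoc_mult_mat[of _ "Suc n" "Suc n" _ "Suc n" _ "Suc n"])
      (simp add: assoc_mult_mat[of _ "Suc n" "Suc n" _ "Suc n" _ "Suc n", symmetric])
  have "similar_mat A H"
    by (rule similar_matI[of _ _ U U "Suc n"]) (use A H U AH in auto)
  then have cpH: "char_poly H = (\<Prod>i<Suc n. [:- complex_of_real (d i), 1:])"
    using char_poly_similar Suc.prems(3) by metis
  have hH: "hadj H = H"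
    using A U(1) by (simp add: H_def hadj_mult[of _ "Suc n" "Suc n" _ "Suc n"] U(2) herm assoc_mult_mat[of _ "Suc n" "Suc n" _ "Suc n" _ "Suc n"])
  have col0: "H $$ (i, 0) = (if i = 0 then d 0 else 0)" if i: "i < Suc n" for i
  proof -
    have AU: "(A * U) $$ (s, 0) = d 0 * U $$ (s, 0)" if "s < Suc n" for s
      using that A U(1) q(4)[OF that] U(4) by (simp add: scalar_prod_def lessThan_atLeast0[symmetric] del: sum.lessThan_Suc)
    have "H $$ (i, 0) = (U * (A * U)) $$ (i, 0)"
      using A U(1) by (simp add: H_def)
    also have "\<dots> = (\<Sum>s<Suc n. U $$ (i, s) * (A * U) $$ (s, 0))"
      using i A U(1) by (subst index_mult_mat) (auto simp: scalar_prod_def lessThan_atLeast0[symmetric] simp del: sum.lessThan_Suc)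
    also have "\<dots> = d 0 * (\<Sum>s<Suc n. U $$ (i, s) * U $$ (s, 0))"
      by (simp add: AU sum_distrib_left mult_ac del: sum.lessThan_Suc)
    also have "(\<Sum>s<Suc n. U $$ (i, s) * U $$ (s, 0)) = (U * U) $$ (i, 0)"
      using i U(1) by (auto simp: scalar_prod_def lessThan_atLeast0[symmetric] simp del: sum.lessThan_Suc)
    finally show ?thesis using i U(3) by simp
  qed
  have row0: "H $$ (0, j) = (if j = 0 then d 0 else 0)" if j: "j < Suc n" for j
  proof -
    have "H $$ (0, j) = hadj H $$ (0, j)" using hH by simp
    also have "\<dots> = cnj (H $$ (j, 0))" using H j by simp
    finally show ?thesis using col0[OF j] by simp
  qed
  define H' where "H' = Matrix.mat n n (\<lambda>(i, j). H $$ (Suc i, Suc j))"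
  let ?one = "Matrix.mat 1 1 (\<lambda>_. complex_of_real (d 0))"
  have H': "H' \<in> carrier_mat n n" by (simp add: H'_def)
  have HB: "H = four_block_mat ?one (0\<^sub>m 1 n) (0\<^sub>m n 1) H'"
    by (rule eq_matI) (use H col0 row0 in \<open>auto simp: H'_def\<close>)
  have "char_poly H = char_poly ?one * char_poly H'"
    unfolding HB by (rule char_poly_four_block_zeros_col) (auto simp: H')
  also have "char_poly ?one = [:- complex_of_real (d 0), 1:]"
    by (subst char_poly_upper_triangular[of _ 1]) (auto simp: diag_mat_def)
  finally have "[:- complex_of_real (d 0), 1:] * char_poly H' = [:- complex_of_real (d 0), 1:] * (\<Prod>i<n. [:- complex_of_real (d (Suc i)), 1:])"
    using cpH by (simp only: prod.lessThan_Suc_shift)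
  then have cpH': "char_poly H' = (\<Prod>i<n. [:- complex_of_real (d (Suc i)), 1:])"
    by (metis mult_left_cancel pCons_eq_0_iff one_neq_zero)
  have "hadj H' = H'"
  proof (rule eq_matI)
    fix i j assume ij: "i < dim_row H'" "j < dim_col H'"
    have "H $$ (Suc i, Suc j) = hadj H $$ (Suc i, Suc j)" using hH by simp
    also have "\<dots> = cnj (H $$ (Suc j, Suc i))" using H ij by (simp add: H'_def)
    finally show "hadj H' $$ (i, j) = H' $$ (i, j)" using ij by (simp add: H'_def)
  qed (auto simp: H'_def)
  from Suc.IH[OF H' this cpH'] obtain P where P: "P \<in> carrier_mat n n" "hadj P * P = 1\<^sub>m n" "P * hadj P = 1\<^sub>m n"
    "H' = P * mat_diag n (\<lambda>i. complex_of_real (d (Suc i))) * hadj P" by auto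
  define R where "R = four_block_mat (1\<^sub>m 1) (0\<^sub>m 1 n) (0\<^sub>m n 1) P"
  have R: "R \<in> carrier_mat (Suc n) (Suc n)" using P(1) by (auto simp: R_def)
  have hR: "hadj R = four_block_mat (1\<^sub>m 1) (0\<^sub>m 1 n) (0\<^sub>m n 1) (hadj P)"
    by (rule eq_matI) (use P(1) in \<open>auto simp: R_def\<close>)
  let ?D = "mat_diag (Suc n) (\<lambda>i. complex_of_real (d i))"
  let ?D' = "mat_diag n (\<lambda>i. complex_of_real (d (Suc i)))"
  have DB: "?D = four_block_mat ?one (0\<^sub>m 1 n) (0\<^sub>m n 1) ?D'"
    by (rule eq_matI) (auto simp: mat_diag_def)
  have one: "(1\<^sub>m (Suc n) :: complex mat) = four_block_mat (1\<^sub>m 1) (0\<^sub>m 1 n) (0\<^sub>m n 1) (1\<^sub>m n)"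
    by (rule eq_matI) auto
  have D': "?D' \<in> carrier_mat n n" by simp
  have zl: "0\<^sub>m (Suc 0) n * M = 0\<^sub>m (Suc 0) n" and zr: "M * 0\<^sub>m n (Suc 0) = 0\<^sub>m n (Suc 0)"
    if "M \<in> carrier_mat n n" for M :: "complex mat"
    using left_mult_zero_mat[OF that] right_mult_zero_mat[OF that] by blast+
  have PD: "P * ?D' \<in> carrier_mat n n" using P(1) by simp
  then have PDP: "P * ?D' * hadj P \<in> carrier_mat n n" by (rule mult_carrier_mat) (rule hadj_carrier[OF P(1)])
  have R1: "hadj R * R = 1\<^sub>m (Suc n)"
    unfolding hR one unfolding R_def
    by (subst mult_four_block_mat[where ?nr1.0 = 1 and ?nr2.0 = n and ?n1.0 = 1 and ?n2.0 = n and ?nc1.0 = 1 and ?nc2.0 = n]) (use P(1-3) PD left_add_zero_mat[OF PDP] in \<open>simp_all add: zl zr\<close>)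
  have R2: "R * hadj R = 1\<^sub>m (Suc n)"
    unfolding hR one unfolding R_def
    by (subst mult_four_block_mat[where ?nr1.0 = 1 and ?nr2.0 = n and ?n1.0 = 1 and ?n2.0 = n and ?nc1.0 = 1 and ?nc2.0 = n]) (use P(1-3) PD left_add_zero_mat[OF PDP] in \<open>simp_all add: zl zr\<close>)
  have RD: "R * ?D = four_block_mat ?one (0\<^sub>m 1 n) (0\<^sub>m n 1) (P * ?D')"
    unfolding DB R_def
    by (subst mult_four_block_mat[where ?nr1.0 = 1 and ?nr2.0 = n and ?n1.0 = 1 and ?n2.0 = n and ?nc1.0 = 1 and ?nc2.0 = n]) (use P(1-3) PD left_add_zero_mat[OF PDP] in \<open>simp_all add: zl zr\<close>)
  have H2: "H = R * ?D * hadj R"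
    unfolding RD hR HB P(4)
    by (subst mult_four_block_mat[where ?nr1.0 = 1 and ?nr2.0 = n and ?n1.0 = 1 and ?n2.0 = n and ?nc1.0 = 1 and ?nc2.0 = n]) (use P(1-3) PD left_add_zero_mat[OF PDP] in \<open>simp_all add: zl zr\<close>)
  define Q where "Q = U * R"
  have Q: "Q \<in> carrier_mat (Suc n) (Suc n)" using U R by (simp add: Q_def)
  have hQ: "hadj Q = hadj R * U" using U(1,2) R by (simp add: Q_def hadj_mult[of _ "Suc n" "Suc n" _ "Suc n"])
  note ca = hadj_carrier[OF R] R U(1)
  have DD: "?D \<in> carrier_mat (Suc n) (Suc n)" by simp
  have "hadj Q * Q = hadj R * (U * U) * R"
    unfolding hQ unfolding Q_def using mat_mult_assoc4(2)[OF ca(1) ca(3) ca(3) ca(2)] .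
  then have q1: "hadj Q * Q = 1\<^sub>m (Suc n)" using ca R1 by (simp add: U(3))
  have "Q * hadj Q = U * (R * hadj R) * U"
    unfolding hQ unfolding Q_def using mat_mult_assoc4(2)[OF ca(3) ca(2) ca(1) ca(3)] .
  then have q2: "Q * hadj Q = 1\<^sub>m (Suc n)" using ca R2 by (simp add: U(3))
  have "A = U * (R * ?D * hadj R) * U" using AH H2 by simp
  also have "\<dots> = Q * ?D * hadj Q"
    unfolding hQ unfolding Q_def using mat_mult_assoc5[OF ca(3) ca(2) DD ca(1) ca(3)] .
  finally show ?case using Q q1 q2 by blast
qed

text \<open>Only indices below k are constrained, so a single entry function H serves for the
  leading blocks of all sizes. Both unitarity relations are included, as neither is derived from the
  other entrywise.\<close>

definition diagonalises :: "nat \<Rightarrow> (nat \<Rightarrow> nat \<Rightarrow> complex) \<Rightarrow> (nat \<Rightarrow> real) \<Rightarrow> (nat \<Rightarrow> nat \<Rightarrow> complex) \<Rightarrow> bool" where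
  "diagonalises k H d Q \<longleftrightarrow>
    (\<forall>i<k. \<forall>j<k. (\<Sum>s<k. cnj (Q s i) * Q s j) = of_bool (i = j)) \<and>
    (\<forall>i<k. \<forall>j<k. (\<Sum>s<k. Q i s * cnj (Q j s)) = of_bool (i = j)) \<and>
    (\<forall>i<k. \<forall>j<k. (\<Sum>s<k. H i s * Q s j) = d j * Q i j)"

lemma diagonalises_exists:
  assumes herm: "\<And>i j. i < k \<Longrightarrow> j < k \<Longrightarrow> H j i = cnj (H i j)"
    and cp: "char_poly (Matrix.mat k k (\<lambda>(i, j). H i j)) = (\<Prod>i<k. [:- complex_of_real (d i), 1:])"
  shows "\<exists>Q. diagonalises k H d Q"
proof -
  let ?A = "Matrix.mat k k (\<lambda>(i, j). H i j)" let ?D = "mat_diag k (\<lambda>i. complex_of_real (d i))"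
  have A: "?A \<in> carrier_mat k k" by simp
  have "hadj ?A = ?A"
  proof (rule eq_matI)
    fix i j assume ij: "i < dim_row ?A" "j < dim_col ?A"
    then show "hadj ?A $$ (i, j) = ?A $$ (i, j)" using herm[of j i, symmetric] by simp
  qed simp_all
  from hermitian_unitarily_diagonalisable[OF A this cp] obtain P where P: "P \<in> carrier_mat k k"
    "hadj P * P = 1\<^sub>m k" "P * hadj P = 1\<^sub>m k" "?A = P * ?D * hadj P" by auto
  have D: "?D \<in> carrier_mat k k" by simp
  have "?A * P = P * ?D * (hadj P * P)"
    unfolding P(4) by (rule assoc_mult_mat[OF mult_carrier_mat[OF P(1) D] hadj_carrier[OF P(1)] P(1)])
  then have AP: "?A * P = P * ?D" using P(1,2) D by simp
  define Q where "Q i j = P $$ (i, j)" for i j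
  have "diagonalises k H d Q"
    unfolding diagonalises_def
  proof (intro conjI allI impI)
    fix i j assume ij: "i < k" "j < k"
    show "(\<Sum>s<k. cnj (Q s i) * Q s j) = of_bool (i = j)"
      using arg_cong[OF P(2), of "\<lambda>M. M $$ (i, j)"] ij P(1) by (simp add: Q_def scalar_prod_def lessThan_atLeast0)
    show "(\<Sum>s<k. Q i s * cnj (Q j s)) = of_bool (i = j)"
      using arg_cong[OF P(3), of "\<lambda>M. M $$ (i, j)"] ij P(1) by (simp add: Q_def scalar_prod_def lessThan_atLeast0)
    show "(\<Sum>s<k. H i s * Q s j) = d j * Q i j"
      using arg_cong[OF AP, of "\<lambda>M. M $$ (i, j)"] ij P(1)
      by (simp add: Q_def scalar_prod_def lessThan_atLeast0 mat_diag_mult_right mult.commute)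
  qed
  then show ?thesis by blast
qed

section \<open>Bordered Hermitian matrices\<close>

definition coord :: "nat \<Rightarrow> (nat \<Rightarrow> nat \<Rightarrow> complex) \<Rightarrow> (nat \<Rightarrow> complex) \<Rightarrow> nat \<Rightarrow> complex" where
  "coord k Q v i = (\<Sum>s<k. cnj (Q s i) * v s)"

lemma coord_expand:
  assumes "diagonalises k H d Q" "i < k"
  shows "v i = (\<Sum>j<k. Q i j * coord k Q v j)"
proof -
  have "(\<Sum>j<k. Q i j * coord k Q v j) = (\<Sum>j<k. \<Sum>s<k. v s * (Q i j * cnj (Q s j)))"
    by (simp add: coord_def sum_distrib_left mult_ac)
  also have "\<dots> = (\<Sum>s<k. v s * (\<Sum>j<k. Q i j * cnj (Q s j)))"
    by (subst sum.swap) (simp add: sum_distrib_left)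
  also have "\<dots> = (\<Sum>s<k. v s * of_bool (i = s))"
    using assms by (intro sum.cong) (auto simp: diagonalises_def)
  also have "\<dots> = v i" using assms(2) by (simp add: of_bool_def if_distrib cong: if_cong)
  finally show ?thesis by simp
qed

lemma coord_combination:
  assumes "diagonalises k H d Q" "j < k" "\<And>i. i < k \<Longrightarrow> v i = (\<Sum>l<k. Q i l * \<gamma> l)"
  shows "coord k Q v j = \<gamma> j"
proof -
  have "coord k Q v j = (\<Sum>i<k. \<Sum>l<k. \<gamma> l * (cnj (Q i j) * Q i l))"
    using assms(3) by (simp add: coord_def sum_distrib_left mult_ac)
  also have "\<dots> = (\<Sum>l<k. \<gamma> l * (\<Sum>i<k. cnj (Q i j) * Q i l))"
    by (subst sum.swap) (simp add: sum_distrib_left)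
  also have "\<dots> = (\<Sum>l<k. \<gamma> l * of_bool (j = l))"
    using assms by (intro sum.cong) (auto simp: diagonalises_def)
  also have "\<dots> = \<gamma> j" using assms(2) by (simp add: of_bool_def if_distrib cong: if_cong)
  finally show ?thesis .
qed

lemma coord_inner:
  assumes "diagonalises k H d Q"
  shows "(\<Sum>i<k. cnj (u i) * v i) = (\<Sum>j<k. cnj (coord k Q u j) * coord k Q v j)"
proof -
  have "(\<Sum>i<k. cnj (u i) * v i) = (\<Sum>i<k. cnj (u i) * (\<Sum>j<k. Q i j * coord k Q v j))"
    using coord_expand[OF assms] by (intro sum.cong) auto
  also have "\<dots> = (\<Sum>i<k. \<Sum>j<k. cnj (u i) * Q i j * coord k Q v j)"
    by (simp add: sum_distrib_left mult_ac)
  also have "\<dots> = (\<Sum>j<k. (\<Sum>i<k. cnj (u i) * Q i j) * coord k Q v j)"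
    by (subst sum.swap) (simp add: sum_distrib_right)
  also have "\<dots> = (\<Sum>j<k. cnj (coord k Q u j) * coord k Q v j)"
    by (simp add: coord_def mult.commute)
  finally show ?thesis .
qed

lemma coord_apply:
  assumes dia: "diagonalises k H d Q" and herm: "\<And>i j. i < k \<Longrightarrow> j < k \<Longrightarrow> H j i = cnj (H i j)" and j: "j < k"
  shows "coord k Q (\<lambda>i. \<Sum>s<k. H i s * v s) j = d j * coord k Q v j"
proof -
  have "coord k Q (\<lambda>i. \<Sum>s<k. H i s * v s) j = (\<Sum>i<k. \<Sum>s<k. v s * cnj (H s i * Q i j))"
    unfolding coord_def sum_distrib_left
  proof (intro sum.cong refl)
    fix i s assume "i \<in> {..<k}" "s \<in> {..<k}"
    then have "H i s = cnj (H s i)" using herm[of s i] by simp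
    then show "cnj (Q i j) * (H i s * v s) = v s * cnj (H s i * Q i j)" by (simp only: complex_cnj_mult mult_ac)
  qed
  also have "\<dots> = (\<Sum>s<k. v s * cnj (\<Sum>i<k. H s i * Q i j))"
    by (subst sum.swap) (simp add: sum_distrib_left)
  also have "\<dots> = (\<Sum>s<k. v s * cnj (d j * Q s j))"
    using dia j by (intro sum.cong) (auto simp: diagonalises_def)
  also have "\<dots> = d j * coord k Q v j" by (simp add: coord_def sum_distrib_left mult_ac)
  finally show ?thesis .
qed

section \<open>The secular equation\<close>

lemma det_bordered:
  fixes N :: "nat \<Rightarrow> nat \<Rightarrow> complex"
  assumes y: "\<And>i. i < k \<Longrightarrow> (\<Sum>s<k. N i s * y s) = - N i k"
  shows "det (Matrix.mat (Suc k) (Suc k) (\<lambda>(i, j). N i j)) =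
    det (Matrix.mat k k (\<lambda>(i, j). N i j)) * (N k k + (\<Sum>s<k. N k s * y s))"
proof -
  let ?M = "Matrix.mat (Suc k) (Suc k) (\<lambda>(i, j). N i j)" and ?M' = "Matrix.mat k k (\<lambda>(i, j). N i j)"
  \<comment> \<open>Multiplication by \<open>?Y\<close> from the right adds the combination y of the
    first k columns to the last one. By the hypothesis on y this clears the last column above the
    corner.\<close>
  let ?Y = "four_block_mat (1\<^sub>m k) (Matrix.mat k 1 (\<lambda>(i, j). y i)) (0\<^sub>m 1 k) (1\<^sub>m 1)"
  let ?e = "Matrix.mat 1 1 (\<lambda>_. N k k + (\<Sum>s<k. N k s * y s))"
  let ?B = "four_block_mat ?M' (0\<^sub>m k 1) (Matrix.mat 1 k (\<lambda>(i, j). N k j)) ?e"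
  have M: "?M = four_block_mat ?M' (Matrix.mat k 1 (\<lambda>(i, j). N i k)) (Matrix.mat 1 k (\<lambda>(i, j). N k j)) (Matrix.mat 1 1 (\<lambda>_. N k k))"
    by (rule eq_matI) (auto simp: less_Suc_eq)
  have Y: "?Y \<in> carrier_mat (Suc k) (Suc k)" by auto
  have MY: "?M * ?Y = ?B"
    unfolding M
    by (subst mult_four_block_mat[where ?nr1.0 = k and ?nr2.0 = 1 and ?n1.0 = k and ?n2.0 = 1 and ?nc1.0 = k and ?nc2.0 = 1])
      (auto intro!: cong_four_block_mat eq_matI simp: scalar_prod_def y lessThan_atLeast0[symmetric])
  have "det ?Y = 1"
    by (subst det_four_block_mat_lower_left_zero[where n = k and m = 1]) auto
  then have "det ?M = det (?M * ?Y)" by (subst det_mult[OF _ Y]) auto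
  also have "\<dots> = det ?M' * det ?e"
    unfolding MY by (subst det_four_block_mat_upper_right_zero[where n = k and m = 1]) auto
  also have "det ?e = N k k + (\<Sum>s<k. N k s * y s)" by (subst det_single) auto
  finally show ?thesis .
qed

lemma poly_char_poly_eq_det:
  fixes H :: "nat \<Rightarrow> nat \<Rightarrow> complex"
  shows "poly (char_poly (Matrix.mat k k (\<lambda>(i, j). H i j))) x =
    det (Matrix.mat k k (\<lambda>(i, j). (if i = j then x else 0) - H i j))"
proof -
  have "- char_matrix (Matrix.mat k k (\<lambda>(i, j). H i j)) x = Matrix.mat k k (\<lambda>(i, j). (if i = j then x else 0) - H i j)"
    by (rule eq_matI) (auto simp: char_matrix_def)
  then show ?thesis by (subst char_poly_matrix[of _ k]) auto
qed

lemma poly_char_poly_bordered: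
  assumes dia: "diagonalises k H d Q" and herm: "\<And>i j. i < Suc k \<Longrightarrow> j < Suc k \<Longrightarrow> H j i = cnj (H i j)"
    and cp: "char_poly (Matrix.mat k k (\<lambda>(i, j). H i j)) = (\<Prod>i<k. [:- complex_of_real (d i), 1:])"
    and x: "\<And>i. i < k \<Longrightarrow> x \<noteq> complex_of_real (d i)"
  shows "poly (char_poly (Matrix.mat (Suc k) (Suc k) (\<lambda>(i, j). H i j))) x =
    (\<Prod>i<k. x - d i) * (x - H k k - (\<Sum>i<k. complex_of_real ((cmod (coord k Q (\<lambda>s. H s k) i))\<^sup>2) / (x - d i)))"
proof -
  define \<beta> where "\<beta> = coord k Q (\<lambda>s. H s k)"
  \<comment> \<open>This is the resolvent (x - A_k)^-1 applied to the bordering column, computed in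
    the eigenbasis. With it, the corner in \<open>det_bordered\<close> becomes the Schur complement,
    that is, the secular function.\<close>
  define y where "y i = (\<Sum>j<k. Q i j * (\<beta> j / (x - d j)))" for i
  define N where "N i j = (if i = j then x else 0) - H i j" for i j
  have cy: "coord k Q y j = \<beta> j / (x - d j)" if "j < k" for j
    by (rule coord_combination[OF dia that]) (simp add: y_def)
  have "(\<Sum>s<k. N i s * y s) = - N i k" if i: "i < k" for i
  proof -
    have "(\<Sum>s<k. H i s * y s) = (\<Sum>s<k. \<Sum>j<k. (\<beta> j / (x - d j)) * (H i s * Q s j))"
      by (simp add: y_def sum_distrib_left mult_ac)
    also have "\<dots> = (\<Sum>j<k. (\<beta> j / (x - d j)) * (\<Sum>s<k. H i s * Q s j))"
      by (subst sum.swap) (simp add: sum_distrib_left)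
    also have "\<dots> = (\<Sum>j<k. (\<beta> j / (x - d j)) * (d j * Q i j))"
      using dia i by (intro sum.cong) (auto simp: diagonalises_def)
    finally have Hy: "(\<Sum>s<k. H i s * y s) = (\<Sum>j<k. (\<beta> j / (x - d j)) * (d j * Q i j))" .
    have "(\<Sum>s<k. N i s * y s) = (\<Sum>s<k. (if s = i then x * y s else 0) - H i s * y s)"
      by (intro sum.cong) (auto simp: N_def algebra_simps)
    also have "\<dots> = x * y i - (\<Sum>s<k. H i s * y s)" using i by (simp add: sum_subtractf)
    also have "\<dots> = (\<Sum>j<k. x * (Q i j * (\<beta> j / (x - d j))) - (\<beta> j / (x - d j)) * (d j * Q i j))"
      by (subst Hy) (simp add: y_def sum_distrib_left sum_subtractf)
    also have "\<dots> = (\<Sum>j<k. Q i j * \<beta> j)"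
    proof (rule sum.cong[OF refl])
      fix j assume "j \<in> {..<k}"
      then have "x - d j \<noteq> 0" using x by auto
      have "x * (q * g) - g * (D * q) = q * ((x - D) * g)" for q g D :: complex
        by (simp add: algebra_simps)
      from this[of "Q i j" "\<beta> j / (x - d j)" "d j"] show "x * (Q i j * (\<beta> j / (x - d j))) - (\<beta> j / (x - d j)) * (d j * Q i j) = Q i j * \<beta> j"
        using \<open>x - d j \<noteq> 0\<close> by simp
    qed
    also have "\<dots> = H i k" using coord_expand[OF dia i, of "\<lambda>s. H s k"] by (simp add: \<beta>_def)
    finally show ?thesis using i by (simp add: N_def)
  qed
  then have "det (Matrix.mat (Suc k) (Suc k) (\<lambda>(i, j). N i j)) =
    det (Matrix.mat k k (\<lambda>(i, j). N i j)) * (N k k + (\<Sum>s<k. N k s * y s))" by (rule det_bordered)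
  moreover have "det (Matrix.mat k k (\<lambda>(i, j). N i j)) = (\<Prod>i<k. x - d i)"
    using poly_char_poly_eq_det[of k H x] cp by (simp add: N_def poly_prod)
  moreover have "(\<Sum>s<k. N k s * y s) = - (\<Sum>i<k. complex_of_real ((cmod (\<beta> i))\<^sup>2) / (x - d i))"
  proof -
    have "(\<Sum>s<k. N k s * y s) = - (\<Sum>s<k. cnj (H s k) * y s)"
      unfolding sum_negf[symmetric] by (intro sum.cong refl) (use herm[of _ k] in \<open>auto simp: N_def\<close>)
    also have "(\<Sum>s<k. cnj (H s k) * y s) = (\<Sum>j<k. cnj (\<beta> j) * (\<beta> j / (x - d j)))"
      using coord_inner[OF dia, of "\<lambda>s. H s k" y] cy by (simp add: \<beta>_def)
    also have "\<dots> = (\<Sum>i<k. complex_of_real ((cmod (\<beta> i))\<^sup>2) / (x - d i))"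
      by (intro sum.cong refl) (simp add: complex_norm_square mult.commute del: of_real_power)
    finally show ?thesis .
  qed
  ultimately show ?thesis
    unfolding poly_char_poly_eq_det N_def[symmetric] \<beta>_def[symmetric] by (simp add: N_def[of k k])
qed

lemma poly_eq_off_finite:
  fixes p q :: "'a::{idom,ring_char_0} poly"
  assumes "finite S" "\<And>x. x \<notin> S \<Longrightarrow> poly p x = poly q x"
  shows "p = q"
proof (rule ccontr)
  assume "p \<noteq> q"
  then have "finite {x. poly (p - q) x = 0}" by (intro poly_roots_finite) simp
  moreover have "- S \<subseteq> {x. poly (p - q) x = 0}" using assms(2) by auto
  ultimately have "finite (- S)" using finite_subset by blast
  then show False using assms(1) infinite_UNIV_char_0 finite_compl by blast
qed

text \<open>The secular equation holds off the spectrum of the leading block; after clearing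
  denominators both sides are polynomials that agree outside a finite set.\<close>

lemma char_poly_bordered:
  assumes dia: "diagonalises k H d Q" and herm: "\<And>i j. i < Suc k \<Longrightarrow> j < Suc k \<Longrightarrow> H j i = cnj (H i j)"
    and cp: "char_poly (Matrix.mat k k (\<lambda>(i, j). H i j)) = (\<Prod>i<k. [:- complex_of_real (d i), 1:])"
  shows "char_poly (Matrix.mat (Suc k) (Suc k) (\<lambda>(i, j). H i j)) =
    [:- H k k, 1:] * (\<Prod>i<k. [:- complex_of_real (d i), 1:]) -
    (\<Sum>i<k. Polynomial.smult (complex_of_real ((cmod (coord k Q (\<lambda>s. H s k) i))\<^sup>2))
        (\<Prod>j\<in>{..<k} - {i}. [:- complex_of_real (d j), 1:]))"
proof (rule poly_eq_off_finite[of "(\<lambda>i. complex_of_real (d i)) ` {..<k}"])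
  fix x assume "x \<notin> (\<lambda>i. complex_of_real (d i)) ` {..<k}"
  then have x: "\<And>i. i < k \<Longrightarrow> x \<noteq> complex_of_real (d i)" by auto
  have "(\<Prod>j\<in>{..<k} - {i}. x - d j) = (\<Prod>j<k. x - d j) / (x - d i)" if "i < k" for i
    using x[OF that] that by (subst prod.remove[of "{..<k}" i]) auto
  then show "poly (char_poly (Matrix.mat (Suc k) (Suc k) (\<lambda>(i, j). H i j))) x = poly
    ([:- H k k, 1:] * (\<Prod>i<k. [:- complex_of_real (d i), 1:]) -
    (\<Sum>i<k. Polynomial.smult (complex_of_real ((cmod (coord k Q (\<lambda>s. H s k) i))\<^sup>2))
        (\<Prod>j\<in>{..<k} - {i}. [:- complex_of_real (d j), 1:]))) x"
    by (intro trans[OF poly_char_poly_bordered[OF dia herm cp x]])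
      (simp_all add: poly_prod poly_sum algebra_simps sum_distrib_left)
qed simp

text \<open>After clearing denominators the numerator vanishes identically. Its value at a pole m
  involves \<delta> m only, because the other terms keep the factor that vanishes at m.\<close>

lemma partial_fractions_unique:
  fixes S :: "complex set"
  assumes S: "finite S" and 0: "\<And>x. x \<notin> S \<Longrightarrow> \<gamma> + (\<Sum>m\<in>S. \<delta> m / (x - m)) = 0"
  shows "\<gamma> = 0" "m \<in> S \<Longrightarrow> \<delta> m = 0"
proof -
  let ?P = "\<lambda>T. \<Prod>m\<in>T. [:- m, 1:]"
  define p where "p = Polynomial.smult \<gamma> (?P S) + (\<Sum>m\<in>S. Polynomial.smult (\<delta> m) (?P (S - {m})))"
  have "p = 0"
  proof (rule poly_eq_off_finite[OF S])
    fix x assume x: "x \<notin> S"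
    have "(\<Prod>j\<in>S - {m}. x - j) = (\<Prod>j\<in>S. x - j) / (x - m)" if "m \<in> S" for m
      using x that S by (subst prod.remove[of S m]) auto
    then have "poly p x = (\<Prod>j\<in>S. x - j) * (\<gamma> + (\<Sum>m\<in>S. \<delta> m / (x - m)))"
      by (simp add: p_def poly_prod poly_sum algebra_simps sum_distrib_left)
    then show "poly p x = poly 0 x" using 0[OF x] by simp
  qed
  have \<delta>: "\<delta> m = 0" if m: "m \<in> S" for m
  proof -
    have "poly p m = (\<Sum>l\<in>S. \<delta> l * (\<Prod>j\<in>S - {l}. m - j))"
      using m S by (auto simp: p_def poly_prod poly_sum)
    also have "\<dots> = (\<Sum>l\<in>S. if l = m then \<delta> m * (\<Prod>j\<in>S - {m}. m - j) else 0)"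
      using m S by (intro sum.cong) auto
    also have "\<dots> = \<delta> m * (\<Prod>j\<in>S - {m}. m - j)" using m S by simp
    finally have "\<delta> m * (\<Prod>j\<in>S - {m}. m - j) = 0" using \<open>p = 0\<close> by simp
    then show ?thesis using S by auto
  qed
  then show "m \<in> S \<Longrightarrow> \<delta> m = 0" .
  obtain x where "x \<notin> S" using S by (meson ex_new_if_finite infinite_UNIV_char_0)
  then show "\<gamma> = 0" using 0[of x] \<delta> by simp
qed

text \<open>The number r_m of the overview: up to sign, the residue of the secular function at m.
  Although written in a basis Q, for an eigenbasis it depends only on H.\<close>

definition weight :: "nat \<Rightarrow> (nat \<Rightarrow> nat \<Rightarrow> complex) \<Rightarrow> (nat \<Rightarrow> real) \<Rightarrow> (nat \<Rightarrow> nat \<Rightarrow> complex) \<Rightarrow> real \<Rightarrow> real" where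
  "weight k H d Q m = (\<Sum>i\<in>{i\<in>{..<k}. d i = m}. (cmod (coord k Q (\<lambda>s. H s k) i))\<^sup>2)"

lemma weight_sum:
  fixes x :: complex
  shows "(\<Sum>i<k. complex_of_real ((cmod (coord k Q (\<lambda>s. H s k) i))\<^sup>2) / (x - d i)) =
    (\<Sum>m\<in>d ` {..<k}. weight k H d Q m / (x - m))"
proof -
  have "(\<Sum>i<k. complex_of_real ((cmod (coord k Q (\<lambda>s. H s k) i))\<^sup>2) / (x - d i)) =
    (\<Sum>m\<in>d ` {..<k}. \<Sum>i\<in>{i\<in>{..<k}. d i = m}. complex_of_real ((cmod (coord k Q (\<lambda>s. H s k) i))\<^sup>2) / (x - d i))"
    by (rule sum.image_gen) simp
  also have "\<dots> = (\<Sum>m\<in>d ` {..<k}. weight k H d Q m / (x - m))"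
    by (rule sum.cong) (auto simp: weight_def sum_divide_distrib)
  finally show ?thesis .
qed

text \<open>Equal spectra of the leading blocks make the first factors of the two secular equations
  agree. Then the secular functions are compared, and these are determined by their constants and
  residues. The two eigenbases may differ.\<close>

lemma char_poly_bordered_eq_iff:
  assumes dia: "diagonalises k H d Q" "diagonalises k H' d Q'"
    and herm: "\<And>i j. i < Suc k \<Longrightarrow> j < Suc k \<Longrightarrow> H j i = cnj (H i j)"
      "\<And>i j. i < Suc k \<Longrightarrow> j < Suc k \<Longrightarrow> H' j i = cnj (H' i j)"
    and cp: "char_poly (Matrix.mat k k (\<lambda>(i, j). H i j)) = (\<Prod>i<k. [:- complex_of_real (d i), 1:])"
      "char_poly (Matrix.mat k k (\<lambda>(i, j). H' i j)) = (\<Prod>i<k. [:- complex_of_real (d i), 1:])"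
  shows "char_poly (Matrix.mat (Suc k) (Suc k) (\<lambda>(i, j). H i j)) = char_poly (Matrix.mat (Suc k) (Suc k) (\<lambda>(i, j). H' i j))
    \<longleftrightarrow> H k k = H' k k \<and> (\<forall>m\<in>d ` {..<k}. weight k H d Q m = weight k H' d Q' m)" (is "?p = ?q \<longleftrightarrow> _")
proof -
  let ?S = "complex_of_real ` d ` {..<k}"
  let ?w = "\<lambda>m. complex_of_real (weight k H d Q m)" and ?w' = "\<lambda>m. complex_of_real (weight k H' d Q' m)"
  have p: "poly ?p x = (\<Prod>i<k. x - d i) * (x - H k k - (\<Sum>m\<in>d ` {..<k}. ?w m / (x - m)))"
    and q: "poly ?q x = (\<Prod>i<k. x - d i) * (x - H' k k - (\<Sum>m\<in>d ` {..<k}. ?w' m / (x - m)))"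
    if "x \<notin> ?S" for x
  proof -
    have x: "\<And>i. i < k \<Longrightarrow> x \<noteq> complex_of_real (d i)" using that by auto
    show "poly ?p x = (\<Prod>i<k. x - d i) * (x - H k k - (\<Sum>m\<in>d ` {..<k}. ?w m / (x - m)))"
      using poly_char_poly_bordered[OF dia(1) herm(1) cp(1) x] by (simp only: weight_sum)
    show "poly ?q x = (\<Prod>i<k. x - d i) * (x - H' k k - (\<Sum>m\<in>d ` {..<k}. ?w' m / (x - m)))"
      using poly_char_poly_bordered[OF dia(2) herm(2) cp(2) x] by (simp only: weight_sum)
  qed
  show ?thesis
  proof
    assume eq: "?p = ?q"
    \<comment> \<open>The poles are complex numbers whereas the weights are indexed by reals, hence
      \<open>Re\<close>.\<close>
    let ?\<delta> = "\<lambda>m. ?w' (Re m) - ?w (Re m)"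
    have *: "(H' k k - H k k) + (\<Sum>m\<in>?S. ?\<delta> m / (x - m)) = 0" if x: "x \<notin> ?S" for x
    proof -
      have "(\<Prod>i<k. x - d i) \<noteq> 0" using x by auto
      then have e: "x - H k k - (\<Sum>m\<in>d ` {..<k}. ?w m / (x - m)) = x - H' k k - (\<Sum>m\<in>d ` {..<k}. ?w' m / (x - m))"
        using p[OF x] q[OF x] eq by simp
      have "(\<Sum>m\<in>?S. ?\<delta> m / (x - m)) = (\<Sum>m\<in>d ` {..<k}. (?w' m - ?w m) / (x - m))"
        by (subst sum.reindex) (auto simp: inj_on_def)
      also have "\<dots> = (\<Sum>m\<in>d ` {..<k}. ?w' m / (x - m)) - (\<Sum>m\<in>d ` {..<k}. ?w m / (x - m))"
        by (simp add: diff_divide_distrib sum_subtractf)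
      finally have S: "(\<Sum>m\<in>?S. ?\<delta> m / (x - m)) = \<dots>" .
      show ?thesis unfolding S using e by (simp add: algebra_simps)
    qed
    have fin: "finite ?S" by simp
    have "H' k k - H k k = 0" by (rule partial_fractions_unique(1)[OF fin *])
    moreover have \<delta>0: "?\<delta> m = 0" if "m \<in> ?S" for m
      using partial_fractions_unique(2)[where \<gamma> = "H' k k - H k k" and \<delta> = ?\<delta>, OF fin * that] .
    have "weight k H d Q m = weight k H' d Q' m" if "m \<in> d ` {..<k}" for m
    proof -
      have "complex_of_real m \<in> ?S" using that by blast
      from \<delta>0[OF this] show ?thesis by simp
    qed
    with calculation(1) show "H k k = H' k k \<and> (\<forall>m\<in>d ` {..<k}. weight k H d Q m = weight k H' d Q' m)" by simp
  next
    assume R: "H k k = H' k k \<and> (\<forall>m\<in>d ` {..<k}. weight k H d Q m = weight k H' d Q' m)"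
    have w: "(\<Sum>m\<in>d ` {..<k}. ?w m / (x - m)) = (\<Sum>m\<in>d ` {..<k}. ?w' m / (x - m))" for x :: complex
      using R by (intro sum.cong) auto
    show "?p = ?q"
    proof (rule poly_eq_off_finite[of ?S])
      fix x assume x: "x \<notin> ?S"
      show "poly ?p x = poly ?q x" unfolding p[OF x] q[OF x] w conjunct1[OF R] ..
    qed simp
  qed
qed

section \<open>Multiplicities of roots and vanishing weights\<close>

lemma prod_linear_factors_split:
  fixes f :: "'b \<Rightarrow> 'a::idom"
  assumes "finite I"
  shows "(\<Prod>i\<in>I. [:- f i, 1:]) = [:- m, 1:] ^ card {i\<in>I. f i = m} * (\<Prod>i\<in>{i\<in>I. f i \<noteq> m}. [:- f i, 1:])"
    and "poly (\<Prod>i\<in>{i\<in>I. f i \<noteq> m}. [:- f i, 1:]) m \<noteq> 0"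
proof -
  have "(\<Prod>i\<in>I. [:- f i, 1:]) = (\<Prod>i\<in>{i\<in>I. f i = m}. [:- f i, 1:]) * (\<Prod>i\<in>{i\<in>I. f i \<noteq> m}. [:- f i, 1:])"
    using assms by (subst prod.union_disjoint[symmetric]) (auto intro!: prod.cong)
  also have "(\<Prod>i\<in>{i\<in>I. f i = m}. [:- f i, 1:]) = (\<Prod>i\<in>{i\<in>I. f i = m}. [:- m, 1:])" by (rule prod.cong) auto
  finally show "(\<Prod>i\<in>I. [:- f i, 1:]) = [:- m, 1:] ^ card {i\<in>I. f i = m} * (\<Prod>i\<in>{i\<in>I. f i \<noteq> m}. [:- f i, 1:])" by simp
  show "poly (\<Prod>i\<in>{i\<in>I. f i \<noteq> m}. [:- f i, 1:]) m \<noteq> 0"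
    using assms by (auto simp: poly_prod)
qed

lemma linear_power_dvd_iff:
  fixes T :: "'a::idom poly"
  assumes "poly T m \<noteq> 0"
  shows "[:- m, 1:] ^ a dvd [:- m, 1:] ^ b * T \<longleftrightarrow> a \<le> b"
proof
  assume "a \<le> b" then show "[:- m, 1:] ^ a dvd [:- m, 1:] ^ b * T" by (simp add: dvd_mult2 le_imp_power_dvd)
next
  assume dvd: "[:- m, 1:] ^ a dvd [:- m, 1:] ^ b * T"
  show "a \<le> b"
  proof (rule ccontr)
    assume "\<not> a \<le> b"
    then obtain c where c: "a = b + Suc c" using less_imp_Suc_add[of b a] by auto
    have "[:- m, 1:] ^ b * ([:- m, 1:] ^ Suc c) dvd [:- m, 1:] ^ b * T" using dvd unfolding c power_add .
    moreover have "[:- m, 1:] ^ b \<noteq> 0" by simp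
    ultimately have "[:- m, 1:] ^ Suc c dvd T" using dvd_mult_cancel_left[of "[:- m, 1:] ^ b"] by blast
    then have "[:- m, 1:] dvd T" by (metis dvd_mult_left power_Suc)
    then show False using assms by (simp add: poly_eq_0_iff_dvd)
  qed
qed

text \<open>Let a be the multiplicity of m in the leading block. In
  \<open>char_poly_bordered\<close> all terms are divisible by (X - m)^a except those with
  eigenvalue m in the last sum; together these give - r_m (X - m)^(a - 1) T with T(m) \<noteq> 0. So
  r_m vanishes exactly if m remains a root of order at least a.\<close>

lemma weight_eq_0_iff:
  assumes dia: "diagonalises k H d Q" and herm: "\<And>i j. i < Suc k \<Longrightarrow> j < Suc k \<Longrightarrow> H j i = cnj (H i j)"
    and cp: "char_poly (Matrix.mat k k (\<lambda>(i, j). H i j)) = (\<Prod>i<k. [:- complex_of_real (d i), 1:])"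
      "char_poly (Matrix.mat (Suc k) (Suc k) (\<lambda>(i, j). H i j)) = (\<Prod>i<Suc k. [:- complex_of_real (e i), 1:])"
    and m: "m \<in> d ` {..<k}"
  shows "weight k H d Q m = 0 \<longleftrightarrow> card {i\<in>{..<k}. d i = m} \<le> card {i\<in>{..<Suc k}. e i = m}"
proof -
  let ?c = "\<lambda>x. complex_of_real x" let ?X = "[:- complex_of_real m, 1:]"
  define a where "a = card {i\<in>{..<k}. d i = m}"
  define \<rho> where "\<rho> i = ?c ((cmod (coord k Q (\<lambda>s. H s k) i))\<^sup>2)" for i
  let ?P = "\<lambda>I. \<Prod>i\<in>I. [:- ?c (d i), 1:]" let ?T = "?P {i\<in>{..<k}. d i \<noteq> m}"
  note split = prod_linear_factors_split[where m = "?c m", simplified of_real_eq_iff]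
  have T: "poly ?T (?c m) \<noteq> 0" using split(2)[of "{..<k}" "\<lambda>i. ?c (d i)"] by simp
  have a: "a > 0" using m by (auto simp: a_def card_gt_0_iff)
  have Pi1: "?P ({..<k} - {i}) = ?X ^ (a - 1) * ?T" if i: "i < k" "d i = m" for i
  proof -
    have "{j \<in> {..<k} - {i}. d j = m} = {i\<in>{..<k}. d i = m} - {i}" "{j \<in> {..<k} - {i}. d j \<noteq> m} = {i\<in>{..<k}. d i \<noteq> m}"
      using i by auto
    moreover have "card ({i\<in>{..<k}. d i = m} - {i}) = a - 1" using i by (simp add: a_def)
    ultimately show ?thesis using split(1)[of "{..<k} - {i}" "\<lambda>i. ?c (d i)"] by simp
  qed
  have Pi2: "?X ^ a dvd ?P ({..<k} - {i})" if i: "i < k" "d i \<noteq> m" for i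
  proof -
    have "{j \<in> {..<k} - {i}. d j = m} = {i\<in>{..<k}. d i = m}" using i by auto
    then show ?thesis using split(1)[of "{..<k} - {i}" "\<lambda>i. ?c (d i)"] by (simp add: a_def)
  qed
  have Pk: "?X ^ a dvd ?P {..<k}" using split(1)[of "{..<k}" "\<lambda>i. ?c (d i)"] by (simp add: a_def)
  let ?q = "\<Prod>i<Suc k. [:- ?c (e i), 1:]"
  let ?I = "{i\<in>{..<k}. d i = m}" and ?J = "{i\<in>{..<k}. d i \<noteq> m}"
  have "(\<Sum>i<k. Polynomial.smult (\<rho> i) (?P ({..<k} - {i}))) =
      (\<Sum>i\<in>?I. Polynomial.smult (\<rho> i) (?P ({..<k} - {i}))) + (\<Sum>i\<in>?J. Polynomial.smult (\<rho> i) (?P ({..<k} - {i})))"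
    by (subst sum.union_disjoint[symmetric]) (auto intro!: sum.cong)
  also have "(\<Sum>i\<in>?I. Polynomial.smult (\<rho> i) (?P ({..<k} - {i}))) = (\<Sum>i\<in>?I. Polynomial.smult (\<rho> i) (?X ^ (a - 1) * ?T))"
    by (rule sum.cong) (auto simp: Pi1)
  also have "\<dots> = Polynomial.smult (?c (weight k H d Q m)) (?X ^ (a - 1) * ?T)"
    by (simp add: smult_sum \<rho>_def weight_def)
  finally have q: "?q = ([:- H k k, 1:] * ?P {..<k} - (\<Sum>i\<in>?J. Polynomial.smult (\<rho> i) (?P ({..<k} - {i}))))
     - Polynomial.smult (?c (weight k H d Q m)) (?X ^ (a - 1) * ?T)"
    using char_poly_bordered[OF dia herm cp(1)] cp(2) by (simp only: \<rho>_def[symmetric]) (simp only: diff_diff_eq add.commute)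
  have "?X ^ a dvd [:- H k k, 1:] * ?P {..<k} - (\<Sum>i\<in>?J. Polynomial.smult (\<rho> i) (?P ({..<k} - {i})))"
    by (intro dvd_diff dvd_mult Pk dvd_sum dvd_smult) (auto intro: Pi2)
  then have "?X ^ a dvd ?q \<longleftrightarrow> ?X ^ a dvd Polynomial.smult (?c (weight k H d Q m)) (?X ^ (a - 1) * ?T)"
    unfolding q by (subst dvd_diff_right_iff) auto
  also have "\<dots> \<longleftrightarrow> weight k H d Q m = 0"
  proof (cases "weight k H d Q m = 0")
    case False
    then show ?thesis using linear_power_dvd_iff[OF T, of a "a - 1"] a by (subst dvd_smult_iff) auto
  qed simp
  also have "?X ^ a dvd ?q \<longleftrightarrow> a \<le> card {i\<in>{..<Suc k}. e i = m}"
    using split(1)[of "{..<Suc k}" "\<lambda>i. ?c (e i)"] linear_power_dvd_iff split(2)[of "{..<Suc k}" "\<lambda>i. ?c (e i)"]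
    by (simp del: prod.lessThan_Suc)
  finally show ?thesis by (simp add: a_def)
qed

section \<open>Cauchy interlacing\<close>

lemma underdetermined_system:
  fixes A :: "nat \<Rightarrow> nat \<Rightarrow> complex"
  obtains x where "\<exists>j\<le>n. x j \<noteq> 0" "\<And>l. l < n \<Longrightarrow> (\<Sum>j\<le>n. A l j * x j) = 0"
proof -
  \<comment> \<open>The zero row n pads the system to a square one; every term of the Leibniz
    formula contains an entry of this row.\<close>
  let ?M = "Matrix.mat (Suc n) (Suc n) (\<lambda>(i, j). if i < n then A i j else 0)"
  have M: "?M \<in> carrier_mat (Suc n) (Suc n)" by simp
  have "det ?M = 0"
  proof -
    have "(\<Prod>i = 0..<Suc n. ?M $$ (i, p i)) = 0" if "p permutes {0..<Suc n}" for p
      using that permutes_in_image[OF that, of n] by (intro prod_zero) (auto intro!: bexI[of _ n])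
    then show ?thesis unfolding det_def'[OF M] by (intro sum.neutral) simp
  qed
  then obtain v where v: "v \<in> carrier_vec (Suc n)" "v \<noteq> 0\<^sub>v (Suc n)" "?M *\<^sub>v v = 0\<^sub>v (Suc n)"
    using det_0_iff_vec_prod_zero[OF M] by auto
  show ?thesis
  proof (rule that[of "\<lambda>j. v $ j"])
    show "\<exists>j\<le>n. v $ j \<noteq> 0" using v(1,2) by (metis carrier_vecD eq_vecI index_zero_vec(1) index_zero_vec(2) less_Suc_eq_le)
    fix l assume l: "l < n"
    have "(?M *\<^sub>v v) $ l = 0" using v(3) l by simp
    then show "(\<Sum>j\<le>n. A l j * v $ j) = 0"
      using l v(1) by (simp add: scalar_prod_def lessThan_atLeast0[symmetric] lessThan_Suc_atMost[symmetric] del: sum.lessThan_Suc)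
  qed
qed

lemma quadratic_form_coord:
  assumes "diagonalises k H d Q" "\<And>i j. i < k \<Longrightarrow> j < k \<Longrightarrow> H j i = cnj (H i j)"
  shows "(\<Sum>i<k. cnj (v i) * (\<Sum>s<k. H i s * v s)) = complex_of_real (\<Sum>j<k. d j * (cmod (coord k Q v j))\<^sup>2)"
proof -
  have "(\<Sum>i<k. cnj (v i) * (\<Sum>s<k. H i s * v s)) = (\<Sum>j<k. cnj (coord k Q v j) * (d j * coord k Q v j))"
    by (subst coord_inner[OF assms(1)]) (simp add: coord_apply[OF assms])
  also have "\<dots> = (\<Sum>j<k. complex_of_real (d j) * (complex_of_real ((cmod (coord k Q v j))\<^sup>2)))"
    by (intro sum.cong refl) (simp add: complex_norm_square mult_ac del: of_real_power)
  finally show ?thesis by simp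
qed

lemma norm_coord:
  assumes "diagonalises k H d Q"
  shows "(\<Sum>i<k. (cmod (v i))\<^sup>2) = (\<Sum>j<k. (cmod (coord k Q v j))\<^sup>2)"
proof -
  have "complex_of_real (\<Sum>i<k. (cmod (v i))\<^sup>2) = complex_of_real (\<Sum>j<k. (cmod (coord k Q v j))\<^sup>2)"
    using coord_inner[OF assms, of v v] by (simp add: complex_norm_square mult.commute del: of_real_power)
  then show ?thesis using of_real_eq_iff by blast
qed

text \<open>The Courant-Fischer argument. Among the combinations of the first i + 1 eigenvectors of
  the leading block there is a nonzero v orthogonal to the first i eigenvectors of the bordered
  matrix. Extended by 0, it has the same quadratic form for both matrices; on one side this is at
  least \<open>d i\<close> times its squared norm, on the other at most \<open>e i\<close>
  times.\<close>

lemma cauchy_interlacing_upper: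
  assumes dia: "diagonalises k H d Q" "diagonalises (Suc k) H e P"
    and herm: "\<And>i j. i < Suc k \<Longrightarrow> j < Suc k \<Longrightarrow> H j i = cnj (H i j)"
    and mono: "\<And>i j. i \<le> j \<Longrightarrow> j < k \<Longrightarrow> d j \<le> d i" "\<And>i j. i \<le> j \<Longrightarrow> j < Suc k \<Longrightarrow> e j \<le> e i"
    and i: "i < k"
  shows "d i \<le> e i"
proof -
  obtain x where x: "\<exists>j\<le>i. x j \<noteq> 0" "\<And>l. l < i \<Longrightarrow> (\<Sum>j\<le>i. (\<Sum>s<k. cnj (P s l) * Q s j) * x j) = 0"
    using underdetermined_system[of i "\<lambda>l j. \<Sum>s<k. cnj (P s l) * Q s j"] by blast
  define \<gamma> where "\<gamma> j = (if j \<le> i then x j else 0)" for j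
  define v where "v s = (if s < k then \<Sum>j<k. Q s j * \<gamma> j else 0)" for s
  have c1: "coord k Q v j = \<gamma> j" if "j < k" for j
    by (rule coord_combination[OF dia(1) that]) (simp add: v_def)
  have c2: "coord (Suc k) P v l = 0" if l: "l < i" for l
  proof -
    have "coord (Suc k) P v l = (\<Sum>s<k. \<Sum>j<k. cnj (P s l) * Q s j * \<gamma> j)"
      by (simp add: coord_def v_def sum_distrib_left mult_ac)
    also have "\<dots> = (\<Sum>j<k. (\<Sum>s<k. cnj (P s l) * Q s j) * \<gamma> j)"
      by (subst sum.swap) (simp add: sum_distrib_right)
    also have "\<dots> = (\<Sum>j\<le>i. (\<Sum>s<k. cnj (P s l) * Q s j) * x j)"
      using i by (intro sum.mono_neutral_cong_right) (auto simp: \<gamma>_def)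
    finally show ?thesis using x(2)[OF l] by simp
  qed
  define N where "N = (\<Sum>s<k. (cmod (v s))\<^sup>2)"
  have N1: "N = (\<Sum>j<k. (cmod (\<gamma> j))\<^sup>2)" unfolding N_def by (subst norm_coord[OF dia(1)]) (simp add: c1)
  have "N = (\<Sum>s<Suc k. (cmod (v s))\<^sup>2)" by (simp add: N_def v_def)
  then have N2: "N = (\<Sum>l<Suc k. (cmod (coord (Suc k) P v l))\<^sup>2)" using norm_coord[OF dia(2), of v] by (simp only:)
  have N0: "N > 0"
  proof -
    obtain j where "j \<le> i" "x j \<noteq> 0" using x(1) by auto
    then show ?thesis unfolding N1 by (intro sum_pos2[of _ j]) (use i in \<open>auto simp: \<gamma>_def\<close>)
  qed
  have hk: "H b a = cnj (H a b)" if "a < k" "b < k" for a b using herm[of a b] that by auto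
  have "(\<Sum>a<k. cnj (v a) * (\<Sum>s<k. H a s * v s)) = (\<Sum>a<Suc k. cnj (v a) * (\<Sum>s<Suc k. H a s * v s))"
    by (simp add: v_def)
  then have "complex_of_real (\<Sum>j<k. d j * (cmod (coord k Q v j))\<^sup>2) = complex_of_real (\<Sum>j<Suc k. e j * (cmod (coord (Suc k) P v j))\<^sup>2)"
    by (rule box_equals[OF _ quadratic_form_coord[OF dia(1) hk, of v] quadratic_form_coord[OF dia(2) herm, of v]])
  then have "(\<Sum>j<k. d j * (cmod (coord k Q v j))\<^sup>2) = (\<Sum>j<Suc k. e j * (cmod (coord (Suc k) P v j))\<^sup>2)"
    using of_real_eq_iff by blast
  moreover have "d i * N \<le> (\<Sum>j<k. d j * (cmod (coord k Q v j))\<^sup>2)"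
    unfolding N1 sum_distrib_left using mono(1) i
    by (intro sum_mono) (auto simp: c1 \<gamma>_def intro!: mult_right_mono)
  moreover have "(\<Sum>j<Suc k. e j * (cmod (coord (Suc k) P v j))\<^sup>2) \<le> e i * N"
    unfolding N2 sum_distrib_left
  proof (rule sum_mono)
    fix j assume "j \<in> {..<Suc k}"
    then show "e j * (cmod (coord (Suc k) P v j))\<^sup>2 \<le> e i * (cmod (coord (Suc k) P v j))\<^sup>2"
      using c2[of j] mono(2)[of i j] by (cases "j < i") (auto intro!: mult_right_mono)
  qed
  ultimately have "d i * N \<le> e i * N" by linarith
  then show ?thesis using N0 by simp
qed

text \<open>Negation reverses the order of the eigenvalues, so the lower interlacing inequality
  becomes the upper one for -H. Reading the indices backwards makes the negated list decreasing
  again.\<close>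

lemma diagonalises_uminus_reverse:
  assumes "diagonalises k H d Q"
  shows "diagonalises k (\<lambda>i j. - H i j) (\<lambda>i. - d (k - 1 - i)) (\<lambda>i j. Q i (k - 1 - j))"
proof -
  have r: "(\<Sum>s<k. f (k - 1 - s)) = (\<Sum>s<k. f s)" for f :: "nat \<Rightarrow> complex"
    by (rule sum.reindex_bij_witness[of _ "\<lambda>s. k - 1 - s" "\<lambda>s. k - 1 - s"]) auto
  show ?thesis
    unfolding diagonalises_def
  proof (intro conjI allI impI)
    fix i j assume ij: "i < k" "j < k"
    have "k - 1 - i < k" "k - 1 - j < k" "(k - 1 - i = k - 1 - j) = (i = j)" using ij by auto
    then show "(\<Sum>s<k. cnj (Q s (k - 1 - i)) * Q s (k - 1 - j)) = of_bool (i = j)"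
      "(\<Sum>s<k. - H i s * Q s (k - 1 - j)) = complex_of_real (- d (k - 1 - j)) * Q i (k - 1 - j)"
      using assms ij by (auto simp: diagonalises_def sum_negf)
    show "(\<Sum>s<k. Q i (k - 1 - s) * cnj (Q j (k - 1 - s))) = of_bool (i = j)"
      using r[of "\<lambda>s. Q i s * cnj (Q j s)"] assms ij by (simp add: diagonalises_def)
  qed
qed

lemma cauchy_interlacing_lower:
  assumes dia: "diagonalises k H d Q" "diagonalises (Suc k) H e P"
    and herm: "\<And>i j. i < Suc k \<Longrightarrow> j < Suc k \<Longrightarrow> H j i = cnj (H i j)"
    and mono: "\<And>i j. i \<le> j \<Longrightarrow> j < k \<Longrightarrow> d j \<le> d i" "\<And>i j. i \<le> j \<Longrightarrow> j < Suc k \<Longrightarrow> e j \<le> e i"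
    and i: "i < k"
  shows "e (Suc i) \<le> d i"
proof -
  have "- d (k - 1 - (k - 1 - i)) \<le> - e (Suc k - 1 - (k - 1 - i))"
  proof (rule cauchy_interlacing_upper[OF diagonalises_uminus_reverse[OF dia(1)] diagonalises_uminus_reverse[OF dia(2)]])
    show "- H b a = cnj (- H a b)" if "a < Suc k" "b < Suc k" for a b using herm[OF that] by simp
  qed (use i in \<open>auto intro!: mono\<close>)
  moreover have "k - 1 - (k - 1 - i) = i" "Suc k - 1 - (k - 1 - i) = Suc i" using i by auto
  ultimately show ?thesis by simp
qed

section \<open>Triangles of interlacing rows\<close>

lemma down_closed_eq_interval:
  assumes "\<And>i i'. 1 \<le> i \<Longrightarrow> i \<le> i' \<Longrightarrow> i' \<le> j \<Longrightarrow> P i' \<Longrightarrow> P i"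
  shows "{i\<in>{1..j}. P i} = {1..card {i\<in>{1..j}. P i}}"
proof (cases "{i\<in>{1..j}. P i} = {}")
  case False
  let ?S = "{i\<in>{1..j}. P i}" let ?M = "Max ?S"
  have fin: "finite ?S" by simp
  have M: "?M \<in> ?S" using Max_in[OF fin False] .
  have "?S = {1..?M}"
  proof (intro equalityI subsetI)
    fix i assume "i \<in> ?S" then show "i \<in> {1..?M}" using Max_ge[OF fin] by auto
  next
    fix i assume "i \<in> {1..?M}" then show "i \<in> ?S" using M assms[of i ?M] by auto
  qed
  moreover from this have "card ?S = ?M" by (metis card_atLeastAtMost diff_Suc_1)
  ultimately show ?thesis by metis
qed simp

text \<open>Each end of the interval stays or moves by one, so its length changes iff exactly one
  end moves. Because the horizontal coordinate is 2i - j, that is also the case in which the centre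
  keeps its place in the next row.\<close>

lemma interval_step:
  fixes a h a' h' :: nat
  assumes "a \<le> a'" "a' \<le> Suc a" "h \<le> h'" "h' \<le> Suc h" "a \<le> h" "a' \<le> h'"
  shows "a' + h' = a + h + 1 \<longleftrightarrow> h - a \<noteq> h' - a'"
  using assms by (auto simp: le_Suc_eq)

section \<open>Rows as sequences of intervals of equal entries\<close>

locale gc_array =
  fixes n :: nat and T :: "nat \<times> nat \<Rightarrow> real"
  assumes interlacing: "interlacing n T"
begin

lemma interlace:
  assumes "1 \<le> i" "i \<le> j" "j < n"
  shows "T (Suc i, Suc j) \<le> T (i, j)" "T (i, j) \<le> T (i, Suc j)"
  using interlacing assms by (auto simp: interlacing_def)

lemma row_antitone_Suc:
  assumes "1 \<le> i" "Suc i \<le> j" "j \<le> n"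
  shows "T (Suc i, j) \<le> T (i, j)"
proof (cases "j < n")
  case True
  then show ?thesis using interlace(2)[of "Suc i" j] interlace(1)[of i j] assms by linarith
next
  case False
  then have "j = Suc (j - 1)" "j - 1 < n" using assms by auto
  then show ?thesis using interlace(1)[of i "j - 1"] interlace(2)[of i "j - 1"] assms by (metis Suc_le_mono order_trans)
qed

lemma row_antitone:
  assumes "1 \<le> i" "i \<le> i'" "i' \<le> j" "j \<le> n"
  shows "T (i', j) \<le> T (i, j)"
  using assms(2,1,3,4)
proof (induction i' rule: dec_induct)
  case (step i')
  then show ?case using row_antitone_Suc[of i' j] by auto
qed simp

lemma column_monotone:
  assumes "1 \<le> i" "i \<le> j" "j \<le> j'" "j' \<le> n"
  shows "T (i, j) \<le> T (i, j')"
  using assms(3,1,2,4)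
proof (induction j' rule: dec_induct)
  case (step j')
  then show ?case using interlace(2)[of i j'] by auto
qed simp

lemma diagonal_antitone:
  assumes "1 \<le> i" "i \<le> j" "j + d \<le> n"
  shows "T (i + d, j + d) \<le> T (i, j)"
  using assms(3)
proof (induction d)
  case (Suc d)
  then show ?case using interlace(1)[of "i + d" "j + d"] assms(1,2) by auto
qed simp

text \<open>As rows are antitone, m fills in row j the columns i with \<open>above m j\<close> < i
  \<le> \<open>atleast m j\<close>. Unlike the minimum and maximum of these columns, the two counts
  are meaningful also in rows without m, so they can be compared between any two consecutive
  rows.\<close>

definition above :: "real \<Rightarrow> nat \<Rightarrow> nat" where
  "above m j = card {i\<in>{1..j}. m < T (i, j)}"

definition atleast :: "real \<Rightarrow> nat \<Rightarrow> nat" where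
  "atleast m j = card {i\<in>{1..j}. m \<le> T (i, j)}"

definition mult :: "real \<Rightarrow> nat \<Rightarrow> nat" where
  "mult m j = card {i\<in>{1..j}. T (i, j) = m}"

lemma above_iff:
  assumes "1 \<le> i" "i \<le> j" "j \<le> n"
  shows "m < T (i, j) \<longleftrightarrow> i \<le> above m j"
proof -
  have "i \<in> {i\<in>{1..j}. m < T (i, j)} \<longleftrightarrow> i \<in> {1..above m j}"
    unfolding above_def
    by (rule arg_cong[of _ _ "\<lambda>S. i \<in> S"], rule down_closed_eq_interval) (use row_antitone[OF _ _ _ assms(3)] in \<open>meson less_le_trans\<close>)
  then show ?thesis using assms by auto
qed

lemma atleast_iff:
  assumes "1 \<le> i" "i \<le> j" "j \<le> n"
  shows "m \<le> T (i, j) \<longleftrightarrow> i \<le> atleast m j"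
proof -
  have "i \<in> {i\<in>{1..j}. m \<le> T (i, j)} \<longleftrightarrow> i \<in> {1..atleast m j}"
    unfolding atleast_def
    by (rule arg_cong[of _ _ "\<lambda>S. i \<in> S"], rule down_closed_eq_interval) (use row_antitone[OF _ _ _ assms(3)] in \<open>meson order_trans\<close>)
  then show ?thesis using assms by auto
qed

lemma atleast_le: "atleast m j \<le> j"
proof -
  have "card {i\<in>{1..j}. m \<le> T (i, j)} \<le> card {1..j}" by (rule card_mono) auto
  then show ?thesis by (simp add: atleast_def)
qed

lemma above_le_atleast: "above m j \<le> atleast m j"
  unfolding above_def atleast_def by (intro card_mono) auto

lemma value_iff:
  assumes "1 \<le> i" "i \<le> j" "j \<le> n"
  shows "T (i, j) = m \<longleftrightarrow> above m j < i \<and> i \<le> atleast m j"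
  using above_iff[OF assms, of m] atleast_iff[OF assms, of m] by auto

lemma mult_eq:
  assumes "j \<le> n"
  shows "mult m j = atleast m j - above m j"
proof -
  have "{i\<in>{1..j}. T (i, j) = m} = {above m j<..atleast m j}"
    using value_iff assms atleast_le[of m j] by fastforce
  then show ?thesis by (simp add: mult_def)
qed

lemma above_step:
  assumes "j < n"
  shows "above m j \<le> above m (Suc j)" "above m (Suc j) \<le> Suc (above m j)"
proof -
  show "above m j \<le> above m (Suc j)"
  proof (cases "above m j = 0")
    case False
    have "above m j \<le> j" using above_le_atleast atleast_le order_trans by blast
    then show ?thesis
      using False above_iff[of "above m j" j m] above_iff[of "above m j" "Suc j" m] interlace(2)[of "above m j" j] assms
      by (auto intro: less_le_trans)
  qed simp
  show "above m (Suc j) \<le> Suc (above m j)"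
  proof (cases "above m (Suc j) \<le> 1")
    case False
    then obtain i where i: "above m (Suc j) = Suc i" "1 \<le> i" by (cases "above m (Suc j)") auto
    have "Suc i \<le> Suc j" using above_le_atleast[of m "Suc j"] atleast_le[of m "Suc j"] i by auto
    then have "m < T (i, j)"
      using above_iff[of "Suc i" "Suc j" m] interlace(1)[of i j] assms i by (auto intro: less_le_trans)
    then show ?thesis using above_iff[of i j m] i \<open>Suc i \<le> Suc j\<close> assms by auto
  qed simp
qed

lemma atleast_step:
  assumes "j < n"
  shows "atleast m j \<le> atleast m (Suc j)" "atleast m (Suc j) \<le> Suc (atleast m j)"
proof -
  show "atleast m j \<le> atleast m (Suc j)"
  proof (cases "atleast m j = 0")
    case False
    then show ?thesis
      using atleast_le[of m j] atleast_iff[of "atleast m j" j m] atleast_iff[of "atleast m j" "Suc j" m]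
        interlace(2)[of "atleast m j" j] assms
      by (auto intro: order_trans)
  qed simp
  show "atleast m (Suc j) \<le> Suc (atleast m j)"
  proof (cases "atleast m (Suc j) \<le> 1")
    case False
    then obtain i where i: "atleast m (Suc j) = Suc i" "1 \<le> i" by (cases "atleast m (Suc j)") auto
    have "Suc i \<le> Suc j" using atleast_le[of m "Suc j"] i by auto
    then have "m \<le> T (i, j)"
      using atleast_iff[of "Suc i" "Suc j" m] interlace(1)[of i j] assms i by (auto intro: order_trans)
    then show ?thesis using atleast_iff[of i j m] i \<open>Suc i \<le> Suc j\<close> assms by auto
  qed simp
qed

section \<open>Chains as maximal runs of rows\<close>

definition occurs :: "real \<Rightarrow> nat \<Rightarrow> bool" where
  "occurs m j \<longleftrightarrow> above m j < atleast m j"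

lemma not_occurs_0: "\<not> occurs m 0"
  by (simp add: occurs_def atleast_def)

lemma occurs_iff_mult: "j \<le> n \<Longrightarrow> occurs m j \<longleftrightarrow> mult m j > 0"
  by (simp add: occurs_def mult_eq)

text \<open>Row 0 contains no value, so the condition at \<open>lo - 1\<close> also covers a run
  that starts in row 1. A run reaching row n has no condition above it.\<close>

definition run :: "real \<Rightarrow> nat \<Rightarrow> nat \<Rightarrow> bool" where
  "run m lo hi \<longleftrightarrow> 1 \<le> lo \<and> lo \<le> hi \<and> hi \<le> n \<and> (\<forall>j\<in>{lo..hi}. occurs m j) \<and>
     \<not> occurs m (lo - 1) \<and> (hi < n \<longrightarrow> \<not> occurs m (Suc hi))"

definition block :: "real \<Rightarrow> nat \<Rightarrow> nat \<Rightarrow> (nat \<times> nat) set" where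
  "block m lo hi = {(i, j). lo \<le> j \<and> j \<le> hi \<and> above m j < i \<and> i \<le> atleast m j}"

lemma run_exists:
  assumes "occurs m j" "j \<le> n"
  obtains lo hi where "run m lo hi" "lo \<le> j" "j \<le> hi"
proof -
  have "occurs m j \<Longrightarrow> \<exists>lo\<le>j. 1 \<le> lo \<and> (\<forall>c\<in>{lo..j}. occurs m c) \<and> \<not> occurs m (lo - 1)"
  proof (induction j)
    case (Suc j)
    show ?case
    proof (cases "occurs m j")
      case True
      with Suc.IH obtain lo where lo: "lo \<le> j" "1 \<le> lo" "\<forall>c\<in>{lo..j}. occurs m c" "\<not> occurs m (lo - 1)" by blast
      then have "\<forall>c\<in>{lo..Suc j}. occurs m c" using Suc.prems by (auto simp: le_Suc_eq)
      then show ?thesis using lo le_SucI by blast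
    next
      case False
      then show ?thesis using Suc.prems by (intro exI[of _ "Suc j"]) auto
    qed
  qed (simp add: not_occurs_0)
  with assms obtain lo where lo: "lo \<le> j" "1 \<le> lo" "\<forall>c\<in>{lo..j}. occurs m c" "\<not> occurs m (lo - 1)" by blast
  have "occurs m j \<Longrightarrow> \<exists>hi. j \<le> hi \<and> hi \<le> n \<and> (\<forall>c\<in>{j..hi}. occurs m c) \<and> (hi < n \<longrightarrow> \<not> occurs m (Suc hi))"
    using assms(2)
  proof (induction j rule: inc_induct)
    case base
    then show ?case by (intro exI[of _ n]) auto
  next
    case (step j)
    show ?case
    proof (cases "occurs m (Suc j)")
      case True
      with step.IH obtain hi where hi: "Suc j \<le> hi" "hi \<le> n" "\<forall>c\<in>{Suc j..hi}. occurs m c" "hi < n \<longrightarrow> \<not> occurs m (Suc hi)"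
        by blast
      then have "\<forall>c\<in>{j..hi}. occurs m c" using step.prems by (metis atLeastAtMost_iff le_eq_less_or_eq Suc_leI)
      then show ?thesis using hi Suc_leD by blast
    next
      case False
      then show ?thesis using step by (intro exI[of _ j]) auto
    qed
  qed
  with assms obtain hi where hi: "j \<le> hi" "hi \<le> n" "\<forall>c\<in>{j..hi}. occurs m c" "hi < n \<longrightarrow> \<not> occurs m (Suc hi)" by blast
  have "\<forall>c\<in>{lo..hi}. occurs m c" using lo(3) hi(3) by (metis atLeastAtMost_iff nle_le)
  then have "run m lo hi" unfolding run_def using lo hi by auto
  then show ?thesis using that lo(1) hi(1) by blast
qed

lemma block_value:
  assumes "run m lo hi" "(i, j) \<in> block m lo hi"
  shows "(i, j) \<in> positions n" "T (i, j) = m"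
proof -
  have *: "1 \<le> i" "i \<le> j" "j \<le> n" using assms atleast_le[of m j] by (auto simp: run_def block_def)
  then show "(i, j) \<in> positions n" by (simp add: positions_def)
  show "T (i, j) = m" using value_iff[OF *] assms(2) by (auto simp: block_def)
qed

lemma in_blockI:
  assumes "(i, j) \<in> positions n" "T (i, j) = m" "lo \<le> j" "j \<le> hi"
  shows "(i, j) \<in> block m lo hi"
  using assms value_iff[of i j m] by (auto simp: block_def positions_def)

lemma neighbour_rows:
  assumes "neighbours (a, j) (b, k)"
  shows "k = j \<or> k = Suc j \<or> j = Suc k"
  using assms by (auto simp: neighbours_def doubleton_eq_iff)

lemma neighbours_up: "neighbours (i, j) (i, Suc j)" "neighbours (i, j) (Suc i, Suc j)" "neighbours (i, j) (Suc i, j)"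
  unfolding neighbours_def by (rule exI[of _ i], rule exI[of _ j], simp)+

text \<open>Neighbours lie in the same or in adjacent rows, and the rows just outside a maximal run
  do not contain m.\<close>

lemma block_closed:
  assumes run: "run m lo hi" and p: "p \<in> block m lo hi" and e: "(p, q) \<in> equality_edges n T"
  shows "q \<in> block m lo hi"
proof -
  obtain i j k l where pq: "p = (i, j)" "q = (k, l)" by (cases p, cases q)
  have q: "(k, l) \<in> positions n" "T (k, l) = m"
    using block_value[OF run, of i j] p e pq by (auto simp: equality_edges_def)
  have occ: "occurs m l" using value_iff[of k l m] q by (auto simp: occurs_def positions_def)
  have l: "l = j \<or> l = Suc j \<or> j = Suc l" using e pq neighbour_rows by (auto simp: equality_edges_def)
  have j: "lo \<le> j" "j \<le> hi" using p pq by (auto simp: block_def)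
  have "lo \<le> l"
  proof (rule ccontr)
    assume "\<not> lo \<le> l"
    then have "l = lo - 1" using l j by auto
    then show False using occ run by (simp add: run_def)
  qed
  moreover have "l \<le> hi"
  proof (rule ccontr)
    assume "\<not> l \<le> hi"
    then have "l = Suc hi" using l j by auto
    moreover have "l \<le> n" using q by (simp add: positions_def)
    ultimately show False using occ run by (simp add: run_def)
  qed
  ultimately show ?thesis using in_blockI[OF q] pq by blast
qed

lemma equality_edges_sym: "(p, q) \<in> equality_edges n T \<Longrightarrow> (q, p) \<in> equality_edges n T"
  by (auto simp: equality_edges_def neighbours_def insert_commute)

lemma block_connected_row:
  assumes run: "run m lo hi" and j: "lo \<le> j" "j \<le> hi" and i: "above m j < i" "i \<le> atleast m j"
  shows "((Suc (above m j), j), (i, j)) \<in> (equality_edges n T)\<^sup>*"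
proof -
  have "Suc (above m j) \<le> i" using i by simp
  then show ?thesis using i(2)
  proof (induction i rule: dec_induct)
    case (step i)
    have "(i, j) \<in> block m lo hi" "(Suc i, j) \<in> block m lo hi" using step j by (auto simp: block_def)
    then have "((i, j), (Suc i, j)) \<in> equality_edges n T"
      using block_value[OF run] by (auto simp: equality_edges_def neighbours_up)
    with step show ?case by (meson Suc_leD rtrancl.rtrancl_into_rtrancl)
  qed simp
qed

lemma block_connected:
  assumes run: "run m lo hi" and p: "(i, j) \<in> block m lo hi"
  shows "((Suc (above m lo), lo), (i, j)) \<in> (equality_edges n T)\<^sup>*"
proof -
  have j: "lo \<le> j" "j \<le> hi" and i: "above m j < i" "i \<le> atleast m j" using p by (auto simp: block_def)
  \<comment> \<open>The first entries of m in consecutive rows of the run are neighbours, since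
    \<open>above\<close> moves by 0 or 1. Climbing along them reaches every row, and each row is
    connected by itself.\<close>
  have "j \<le> hi \<Longrightarrow> ((Suc (above m lo), lo), (Suc (above m j), j)) \<in> (equality_edges n T)\<^sup>*"
    using j(1)
  proof (induction j rule: dec_induct)
    case (step j)
    have "occurs m j" "occurs m (Suc j)" "j < n" using run step by (auto simp: run_def)
    then have "(Suc (above m j), j) \<in> block m lo hi" "(Suc (above m (Suc j)), Suc j) \<in> block m lo hi"
      using step by (auto simp: block_def occurs_def)
    moreover have "neighbours (Suc (above m j), j) (Suc (above m (Suc j)), Suc j)"
      using above_step[OF \<open>j < n\<close>, of m] neighbours_up by (auto simp: le_Suc_eq)
    ultimately have "((Suc (above m j), j), (Suc (above m (Suc j)), Suc j)) \<in> equality_edges n T"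
      using block_value[OF run] by (auto simp: equality_edges_def)
    with step show ?case by (meson Suc_leD rtrancl.rtrancl_into_rtrancl)
  qed simp
  then show ?thesis using block_connected_row[OF run j i] j(2) by (meson rtrancl_trans)
qed

lemma component_eq_block:
  assumes run: "run m lo hi" and p: "p \<in> block m lo hi"
  shows "(equality_edges n T)\<^sup>* `` {p} = block m lo hi"
proof (intro equalityI subsetI)
  fix q assume "q \<in> (equality_edges n T)\<^sup>* `` {p}"
  then have "(p, q) \<in> (equality_edges n T)\<^sup>*" by simp
  then show "q \<in> block m lo hi"
    by (induction rule: rtrancl_induct) (use p block_closed[OF run] in auto)
next
  fix q assume q: "q \<in> block m lo hi"
  let ?o = "(Suc (above m lo), lo)"
  have "sym ((equality_edges n T)\<^sup>*)" using equality_edges_sym by (intro sym_rtrancl) (auto simp: sym_def)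
  moreover have "(?o, p) \<in> (equality_edges n T)\<^sup>*" "(?o, q) \<in> (equality_edges n T)\<^sup>*"
    using block_connected[OF run] p q by (cases p; cases q; auto)+
  ultimately show "q \<in> (equality_edges n T)\<^sup>* `` {p}" by (metis Image_singleton_iff rtrancl_trans symD)
qed

lemma run_block_nonempty:
  assumes "run m lo hi" "lo \<le> j" "j \<le> hi"
  shows "(Suc (above m j), j) \<in> block m lo hi"
proof -
  have "occurs m j" using assms by (auto simp: run_def)
  then show ?thesis using assms by (auto simp: block_def occurs_def)
qed

lemma chains_eq: "chains n T = {block m lo hi | m lo hi. run m lo hi}"
proof (intro equalityI subsetI)
  fix C assume "C \<in> chains n T"
  then obtain i j where p: "(i, j) \<in> positions n" "C = (equality_edges n T)\<^sup>* `` {(i, j)}"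
    by (auto simp: chains_def)
  have "occurs (T (i, j)) j" using value_iff[of i j "T (i, j)"] p by (auto simp: occurs_def positions_def)
  then obtain lo hi where r: "run (T (i, j)) lo hi" "lo \<le> j" "j \<le> hi"
    using run_exists p by (metis (no_types, lifting) case_prodD mem_Collect_eq positions_def)
  then have "C = block (T (i, j)) lo hi" using component_eq_block[OF r(1)] in_blockI[OF p(1)] p(2) by blast
  then show "C \<in> {block m lo hi | m lo hi. run m lo hi}" using r(1) by blast
next
  fix C assume "C \<in> {block m lo hi | m lo hi. run m lo hi}"
  then obtain m lo hi where C: "C = block m lo hi" "run m lo hi" by blast
  have p: "(Suc (above m lo), lo) \<in> block m lo hi" using run_block_nonempty[OF C(2)] C(2) by (simp add: run_def)
  then show "C \<in> chains n T"
    unfolding chains_def using component_eq_block[OF C(2) p] block_value(1)[OF C(2) p] C(1) by blast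
qed

lemma block_row_card:
  assumes "run m lo hi" "lo \<le> j" "j \<le> hi"
  shows "card {p \<in> block m lo hi. snd p = j} = mult m j"
proof -
  have "{p \<in> block m lo hi. snd p = j} = (\<lambda>i. (i, j)) ` {above m j<..atleast m j}"
    using assms by (auto simp: block_def)
  then have "card {p \<in> block m lo hi. snd p = j} = atleast m j - above m j"
    by (simp add: card_image inj_on_def)
  then show ?thesis using assms mult_eq by (simp add: run_def)
qed

section \<open>Counting repetitions and descents\<close>

lemma chain_sequence_block:
  assumes run: "run m lo hi"
  shows "chain_sequence (block m lo hi) = map (mult m) [lo..<Suc hi]"
proof -
  have "snd ` block m lo hi = {lo..hi}"
    using run_block_nonempty[OF run] by (force simp: block_def)
  moreover have "Min {lo..hi} = lo" "Max {lo..hi} = hi" using run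
    by (auto simp: run_def intro!: Min_eqI Max_eqI)
  ultimately show ?thesis
    unfolding chain_sequence_def using block_row_card[OF run] by auto
qed

text \<open>A repetition between rows j and j + 1 is recorded at the upper row. This has list
  position j + 1 - lo, hence \<alpha> = j - lo + 2 in the count from 1.\<close>

lemma repeat_indices_block:
  assumes run: "run m lo hi"
  shows "repeat_indices (map (mult m) [lo..<Suc hi]) = (\<lambda>j. j - lo + 2) ` {j\<in>{lo..<hi}. mult m j = mult m (Suc j)}"
proof -
  have "\<alpha> \<in> repeat_indices (map (mult m) [lo..<Suc hi]) \<longleftrightarrow>
     \<alpha> \<in> (\<lambda>j. j - lo + 2) ` {j\<in>{lo..<hi}. mult m j = mult m (Suc j)}" for \<alpha>
  proof (cases "2 \<le> \<alpha> \<and> \<alpha> \<le> Suc hi - lo")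
    case True
    then obtain b where b: "\<alpha> = b + 2" by (metis le_add_diff_inverse2)
    have "map (mult m) [lo..<Suc hi] ! (b + 1) = mult m (Suc (lo + b))" "map (mult m) [lo..<Suc hi] ! b = mult m (lo + b)"
      using True b by (subst nth_map; simp del: upt_Suc)+
    then have "\<alpha> \<in> repeat_indices (map (mult m) [lo..<Suc hi]) \<longleftrightarrow> mult m (Suc (lo + b)) = mult m (lo + b)"
      using True b by (simp add: repeat_indices_def del: upt_Suc)
    also have "\<dots> \<longleftrightarrow> \<alpha> \<in> (\<lambda>j. j - lo + 2) ` {j\<in>{lo..<hi}. mult m j = mult m (Suc j)}"
      using True b by (auto intro!: image_eqI[of _ _ "lo + b"])
    finally show ?thesis .
  next
    case False
    then show ?thesis by (auto simp: repeat_indices_def simp del: upt_Suc)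
  qed
  then show ?thesis by blast
qed

lemma chain_defect:
  assumes run: "run m lo hi"
  shows "(\<Sum>\<alpha>\<in>repeat_indices (chain_sequence (block m lo hi)). chain_sequence (block m lo hi) ! (\<alpha> - 1)) =
    (\<Sum>j\<in>{j\<in>{lo..<hi}. mult m j = mult m (Suc j)}. mult m j)"
proof -
  have inj: "inj_on (\<lambda>j. j - lo + 2) {j\<in>{lo..<hi}. mult m j = mult m (Suc j)}"
    by (auto simp: inj_on_def)
  show ?thesis
    unfolding chain_sequence_block[OF run] repeat_indices_block[OF run] sum.reindex[OF inj]
  proof (rule sum.cong[OF refl])
    fix j assume j: "j \<in> {j\<in>{lo..<hi}. mult m j = mult m (Suc j)}"
    then have "map (mult m) [lo..<Suc hi] ! Suc (j - lo) = mult m (Suc j)"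
      by (subst nth_map) (auto simp del: upt_Suc)
    then show "((\<lambda>\<alpha>. map (mult m) [lo..<Suc hi] ! (\<alpha> - 1)) \<circ> (\<lambda>j. j - lo + 2)) j = mult m j"
      using j by simp
  qed
qed

lemma mult_0: "mult m 0 = 0"
  by (simp add: mult_def)

lemma mult_step:
  assumes "j < n"
  shows "mult m (Suc j) \<le> Suc (mult m j)" "mult m j \<le> Suc (mult m (Suc j))"
  using above_step[OF assms, of m] atleast_step[OF assms, of m] above_le_atleast[of m j] above_le_atleast[of m "Suc j"]
    mult_eq[of j m] mult_eq[of "Suc j" m] assms by auto

lemma run_unique:
  assumes "run m lo hi" "run m lo' hi'" "lo \<le> j" "j \<le> hi" "lo' \<le> j" "j \<le> hi'"
  shows "lo = lo'" "hi = hi'"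
proof -
  have "lo' \<le> lo" if "run m lo hi" "run m lo' hi'" "lo \<le> j" "j \<le> hi" "lo' \<le> j" "j \<le> hi'" for lo hi lo' hi'
  proof (rule ccontr)
    assume "\<not> lo' \<le> lo"
    then have "lo' - 1 \<in> {lo..hi}" using that by auto
    then show False using that(1,2) by (auto simp: run_def)
  qed
  then show "lo = lo'" using assms by (meson le_antisym)
  have "hi' \<le> hi" if "run m lo hi" "run m lo' hi'" "lo \<le> j" "j \<le> hi" "lo' \<le> j" "j \<le> hi'" for lo hi lo' hi'
  proof (rule ccontr)
    assume "\<not> hi' \<le> hi"
    then have "Suc hi \<in> {lo'..hi'}" "hi < n" using that by (auto simp: run_def)
    then show False using that(1,2) by (auto simp: run_def)
  qed
  then show "hi = hi'" using assms by (meson le_antisym)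
qed

lemma mult_pos_value:
  assumes "mult m j > 0" "1 \<le> j" "j \<le> n"
  shows "m \<in> T ` positions n"
proof -
  obtain i where "i \<in> {1..j}" "T (i, j) = m" using assms(1) unfolding mult_def card_gt_0_iff by blast
  then show ?thesis using assms by (auto simp: positions_def)
qed

text \<open>A repetition of positive multiplicity at (m, k) lies in exactly one run, so the sum over
  chains becomes a sum over values and rows; pairs of multiplicity 0 contribute nothing. V may
  contain further values, which allows two triangles to share it.\<close>

lemma dimension_defect_eq:
  assumes V: "finite V" "T ` positions n \<subseteq> V"
  shows "dimension_defect (chains n T) = (\<Sum>m\<in>V. \<Sum>k<n. if mult m k = mult m (Suc k) then mult m k else 0)"
proof -
  define R where "R = {(m, lo, hi). run m lo hi}"
  define J where "J = (\<lambda>(m, lo, hi). {j\<in>{lo..<hi}. mult m j = mult m (Suc j)})"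
  define B where "B = (\<lambda>(m, lo, hi). block m lo hi)"
  define S where "S = {(m, k). m \<in> V \<and> k < n \<and> mult m k = mult m (Suc k) \<and> mult m k > 0}"
  have pos: "mult m j > 0" if "run m lo hi" "lo \<le> j" "j \<le> hi" for m lo hi j
    using that occurs_iff_mult[of j m] by (auto simp: run_def)
  have val: "m \<in> T ` positions n" if "run m lo hi" for m lo hi
    using pos[OF that, of lo] mult_pos_value[of m lo] that by (auto simp: run_def)
  have R: "finite R"
  proof (rule finite_subset)
    show "R \<subseteq> V \<times> {..n} \<times> {..n}"
    proof
      fix x assume "x \<in> R"
      then obtain m lo hi where r: "x = (m, lo, hi)" "run m lo hi" by (auto simp: R_def)
      then show "x \<in> V \<times> {..n} \<times> {..n}" using val[OF r(2)] V(2) by (auto simp: run_def)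
    qed
  qed (use V in auto)
  have inj: "inj_on B R"
  proof (rule inj_onI)
    fix x y assume xy: "x \<in> R" "y \<in> R" "B x = B y"
    obtain m lo hi m' lo' hi' where e: "x = (m, lo, hi)" "y = (m', lo', hi')" by (cases x, cases y)
    have r: "run m lo hi" "run m' lo' hi'" "block m lo hi = block m' lo' hi'" using xy e by (auto simp: R_def B_def)
    have p: "(Suc (above m lo), lo) \<in> block m lo hi" using run_block_nonempty[OF r(1)] r(1) by (auto simp: run_def)
    then have "m = m'" using block_value(2)[OF r(1) p] block_value(2)[OF r(2), of "Suc (above m lo)" lo] r(3) by simp
    moreover have "lo' \<le> lo" "lo \<le> hi'" using p r(3) by (auto simp: block_def)
    ultimately show "x = y" using run_unique[OF r(1), of lo' hi' lo] r(1,2) e by (auto simp: run_def)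
  qed
  have "chains n T = B ` R" by (auto simp: chains_eq B_def R_def image_iff)
  then have "dimension_defect (chains n T) =
      (\<Sum>x\<in>R. \<Sum>\<alpha>\<in>repeat_indices (chain_sequence (B x)). chain_sequence (B x) ! (\<alpha> - 1))"
    unfolding dimension_defect_def by (simp add: sum.reindex[OF inj])
  also have "\<dots> = (\<Sum>x\<in>R. \<Sum>j\<in>J x. mult (fst x) j)"
  proof (rule sum.cong[OF refl])
    fix x assume "x \<in> R"
    then obtain m lo hi where r: "x = (m, lo, hi)" "run m lo hi" by (auto simp: R_def)
    show "(\<Sum>\<alpha>\<in>repeat_indices (chain_sequence (B x)). chain_sequence (B x) ! (\<alpha> - 1)) = (\<Sum>j\<in>J x. mult (fst x) j)"
      using chain_defect[OF r(2)] by (simp only: r(1) B_def J_def prod.case fst_conv)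
  qed
  also have "\<dots> = (\<Sum>(x, j)\<in>Sigma R J. mult (fst x) j)"
    by (rule sum.Sigma[OF R]) (auto simp: J_def)
  also have "\<dots> = (\<Sum>z\<in>Sigma R J. (\<lambda>(m, k). mult m k) ((\<lambda>(x, j). (fst x, j)) z))"
    by (rule sum.cong) auto
  also have "\<dots> = (\<Sum>(m, k)\<in>S. mult m k)"
  proof (rule sum.reindex_bij_betw)
    show "bij_betw (\<lambda>(x, j). (fst x, j)) (Sigma R J) S"
      unfolding bij_betw_def
    proof (intro conjI equalityI subsetI)
      show "inj_on (\<lambda>(x, j). (fst x, j)) (Sigma R J)"
      proof (rule inj_onI, clarsimp simp: R_def J_def)
        fix m lo hi j lo' hi'
        assume "run m lo hi" "run m lo' hi'" "lo \<le> j" "j < hi" "lo' \<le> j" "j < hi'"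
        then show "lo = lo' \<and> hi = hi'" using run_unique[of m lo hi lo' hi' j] by auto
      qed
      fix z assume "z \<in> (\<lambda>(x, j). (fst x, j)) ` Sigma R J"
      then obtain m lo hi j where z: "z = (m, j)" "run m lo hi" "lo \<le> j" "j < hi" "mult m j = mult m (Suc j)"
        by (auto simp: R_def J_def)
      then show "z \<in> S" using pos[of m lo hi j] val[OF z(2)] V(2) by (auto simp: S_def run_def)
    next
      fix z assume "z \<in> S"
      then obtain m k where z: "z = (m, k)" "k < n" "mult m k = mult m (Suc k)" "mult m k > 0" by (auto simp: S_def)
      then have "occurs m k" "occurs m (Suc k)" using occurs_iff_mult by auto
      then obtain lo hi where r: "run m lo hi" "lo \<le> k" "k \<le> hi" using run_exists[of m k] z(2) by auto
      then have "k < hi" using \<open>occurs m (Suc k)\<close> z(2) by (metis le_neq_implies_less run_def)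
      then have "((m, lo, hi), k) \<in> Sigma R J" using r z by (auto simp: R_def J_def)
      then show "z \<in> (\<lambda>(x, j). (fst x, j)) ` Sigma R J" using z(1) by force
    qed
  qed
  also have "\<dots> = (\<Sum>(m, k)\<in>V \<times> {..<n}. if mult m k = mult m (Suc k) then mult m k else 0)"
    by (rule sum.mono_neutral_cong_left) (use V in \<open>auto simp: S_def split: if_splits\<close>)
  also have "\<dots> = (\<Sum>m\<in>V. \<Sum>k<n. if mult m k = mult m (Suc k) then mult m k else 0)"
    by (simp add: sum.cartesian_product)
  finally show ?thesis .
qed

text \<open>This will be the dimension of the fiber, here a function of the triangle alone.\<close>

definition descent :: "real set \<Rightarrow> nat" where
  "descent V = (\<Sum>m\<in>V. \<Sum>k<n. if mult m (Suc k) < mult m k then 2 * mult m k - 1 else 0)"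

end

text \<open>In a single step a \<mapsto> a', the sum a + a' equals a'^2 - a^2 if a' = a + 1. If a' =
  a - 1 it equals a'^2 - a^2 + 2 (2a - 1), and if a' = a it is 2a. The differences of squares
  telescope.\<close>

lemma telescoping_squares:
  fixes a :: "nat \<Rightarrow> nat"
  assumes "a 0 = 0" "\<And>k. k < n \<Longrightarrow> a (Suc k) \<le> Suc (a k) \<and> a k \<le> Suc (a (Suc k))"
  shows "(\<Sum>k<n. a k + a (Suc k)) = (a n)\<^sup>2 + 2 * (\<Sum>k<n. if a (Suc k) < a k then 2 * a k - 1 else 0)
    + 2 * (\<Sum>k<n. if a k = a (Suc k) then a k else 0)"
  using assms(2)
proof (induction n)
  case (Suc n)
  have IH: "(\<Sum>k<n. a k + a (Suc k)) = (a n)\<^sup>2 + 2 * (\<Sum>k<n. if a (Suc k) < a k then 2 * a k - 1 else 0)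
    + 2 * (\<Sum>k<n. if a k = a (Suc k) then a k else 0)"
    using Suc by simp
  consider "a (Suc n) = Suc (a n)" | "a n = Suc (a (Suc n))" | "a n = a (Suc n)" using Suc.prems[of n] by force
  then show ?case
    unfolding sum.lessThan_Suc IH by cases (auto simp: power2_eq_square algebra_simps)
qed (simp add: assms(1))

context gc_array
begin

lemma mult_sum:
  assumes "finite V" "T ` positions n \<subseteq> V" "k \<le> n"
  shows "(\<Sum>m\<in>V. mult m k) = k"
proof -
  have "(\<Sum>m\<in>V. mult m k) = (\<Sum>m\<in>V. \<Sum>i\<in>{i\<in>{1..k}. T (i, k) = m}. 1)" by (simp add: mult_def)
  also have "\<dots> = (\<Sum>i\<in>{1..k}. 1)"
    by (rule sum.group) (use assms in \<open>auto simp: positions_def\<close>)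
  finally show ?thesis by simp
qed

text \<open>Summing \<open>a\<^sub>k + a\<^sub>k\<^sub>+\<^sub>1\<close> over all rows and values counts \<open>\<Sum>\<^sub>k (2 k + 1) = n\<^sup>2\<close>, while for a fixed
  value the descents, the repetitions and the final multiplicity account for the same sum.\<close>

lemma descent_plus_defect:
  assumes "finite V" "T ` positions n \<subseteq> V"
  shows "2 * descent V + 2 * dimension_defect (chains n T) + (\<Sum>m\<in>V. (mult m n)\<^sup>2) = n\<^sup>2"
proof -
  have "(\<Sum>m\<in>V. \<Sum>k<n. mult m k + mult m (Suc k)) = (\<Sum>k<n. \<Sum>m\<in>V. mult m k + mult m (Suc k))"
    by (rule sum.swap)
  also have "\<dots> = (\<Sum>k<n. 2 * k + 1)"
    by (rule sum.cong) (auto simp: sum.distrib mult_sum[OF assms])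
  also have "\<dots> = n\<^sup>2" by (induction n) (auto simp: power2_eq_square)
  finally have "n\<^sup>2 = (\<Sum>m\<in>V. \<Sum>k<n. mult m k + mult m (Suc k))" by simp
  also have "\<dots> = (\<Sum>m\<in>V. (mult m n)\<^sup>2 + 2 * (\<Sum>k<n. if mult m (Suc k) < mult m k then 2 * mult m k - 1 else 0)
    + 2 * (\<Sum>k<n. if mult m k = mult m (Suc k) then mult m k else 0))"
    by (intro sum.cong refl telescoping_squares) (auto simp: mult_0 mult_step)
  finally show ?thesis
    by (simp add: dimension_defect_eq[OF assms] descent_def sum.distrib sum_distrib_left)
qed

lemma dimension_defect_0_iff:
  "dimension_defect (chains n T) = 0 \<longleftrightarrow> (\<forall>m k. k < n \<longrightarrow> mult m k > 0 \<longrightarrow> mult m k \<noteq> mult m (Suc k))"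
proof -
  let ?V = "T ` positions n"
  have "positions n \<subseteq> {..n} \<times> {..n}" by (auto simp: positions_def)
  then have V: "finite ?V" using finite_subset by blast
  have e: "(if x = y then x else 0) = 0 \<longleftrightarrow> (0 < x \<longrightarrow> x \<noteq> y)" for x y :: nat by auto
  have "dimension_defect (chains n T) = 0 \<longleftrightarrow>
    (\<forall>m\<in>?V. \<forall>k<n. mult m k > 0 \<longrightarrow> mult m k \<noteq> mult m (Suc k))"
    unfolding dimension_defect_eq[OF V subset_refl]
    by (simp only: sum_eq_0_iff[OF V] sum_eq_0_iff[OF finite_lessThan] e lessThan_iff Ball_def)
  also have "\<dots> \<longleftrightarrow> (\<forall>m k. k < n \<longrightarrow> mult m k > 0 \<longrightarrow> mult m k \<noteq> mult m (Suc k))"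
    using mult_pos_value mult_0 by (metis One_nat_def Suc_leI less_imp_le_nat not_gr_zero)
  finally show ?thesis .
qed

end

section \<open>Axes of symmetry and diamonds\<close>

lemma vertical_axis_iff:
  "vertical_axis c C \<longleftrightarrow> (\<forall>i j. (i, j) \<in> C \<longrightarrow> (\<exists>i'. (i', j) \<in> C \<and> real i + real i' = c + real j))"
proof
  assume v: "vertical_axis c C"
  show "\<forall>i j. (i, j) \<in> C \<longrightarrow> (\<exists>i'. (i', j) \<in> C \<and> real i + real i' = c + real j)"
  proof (intro allI impI)
    fix i j assume "(i, j) \<in> C"
    \<comment> \<open>The horizontal coordinate being 2i - j, the reflection keeps row j and sends
      column i to the column i' with i + i' = c + j.\<close>
    then have "(2 * c - (2 * real i - real j), real j) \<in> (\<lambda>(x, y). (2 * c - x, y)) ` drawing ` C"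
      by (force simp: drawing_def)
    then have "(2 * c - (2 * real i - real j), real j) \<in> drawing ` C" using v by (simp add: vertical_axis_def)
    then show "\<exists>i'. (i', j) \<in> C \<and> real i + real i' = c + real j" by (auto simp: drawing_def)
  qed
next
  assume r: "\<forall>i j. (i, j) \<in> C \<longrightarrow> (\<exists>i'. (i', j) \<in> C \<and> real i + real i' = c + real j)"
  have sub: "(\<lambda>(x, y). (2 * c - x, y)) ` drawing ` C \<subseteq> drawing ` C"
  proof
    fix z assume "z \<in> (\<lambda>(x, y). (2 * c - x, y)) ` drawing ` C"
    then obtain p where p: "p \<in> C" "z = (case drawing p of (x, y) \<Rightarrow> (2 * c - x, y))" by blast
    obtain i j where "p = (i, j)" by (cases p)
    with p have ij: "(i, j) \<in> C" "z = (case drawing (i, j) of (x, y) \<Rightarrow> (2 * c - x, y))" by auto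
    then obtain i' where i': "(i', j) \<in> C" "real i + real i' = c + real j" using r by blast
    then have "z = drawing (i', j)" using ij(2) by (simp add: drawing_def)
    then show "z \<in> drawing ` C" using i'(1) by blast
  qed
  \<comment> \<open>The reflection is an involution, so this inclusion is the mirror image of the
    previous one.\<close>
  have "drawing ` C \<subseteq> (\<lambda>(x, y). (2 * c - x, y)) ` drawing ` C"
  proof
    fix z assume "z \<in> drawing ` C"
    then have "(\<lambda>(x, y). (2 * c - x, y)) z \<in> drawing ` C" using sub by blast
    then have "(\<lambda>(x, y). (2 * c - x, y)) ((\<lambda>(x, y). (2 * c - x, y)) z) \<in> (\<lambda>(x, y). (2 * c - x, y)) ` drawing ` C" by blast
    then show "z \<in> (\<lambda>(x, y). (2 * c - x, y)) ` drawing ` C" by (simp add: case_prod_unfold)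
  qed
  then show "vertical_axis c C" using sub by (auto simp: vertical_axis_def)
qed

lemma vertical_axis_row:
  assumes "vertical_axis c C" "\<And>i. (i, j) \<in> C \<longleftrightarrow> p \<le> i \<and> i \<le> q" "p \<le> q"
  shows "c = real p + real q - real j"
proof -
  have "(p, j) \<in> C" "(q, j) \<in> C" using assms by auto
  then obtain a b where "(a, j) \<in> C" "real p + real a = c + real j" "(b, j) \<in> C" "real q + real b = c + real j"
    using assms(1) unfolding vertical_axis_iff by meson
  moreover from this have "a \<le> q" "p \<le> b" using assms(2) by auto
  ultimately show ?thesis by linarith
qed

lemma diamond_axis:
  assumes "1 \<le> l"
  shows "vertical_axis c (diamond l i k) \<longleftrightarrow> c = 2 * real i + real l - 1 - real k"
proof
  assume v: "vertical_axis c (diamond l i k)"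
  have "(a, k) \<in> diamond l i k \<longleftrightarrow> i \<le> a \<and> a \<le> i + l - 1" for a using assms by (auto simp: diamond_def)
  from vertical_axis_row[OF v this] assms show "c = 2 * real i + real l - 1 - real k" by (simp add: of_nat_diff)
next
  assume c: "c = 2 * real i + real l - 1 - real k"
  show "vertical_axis c (diamond l i k)"
    unfolding vertical_axis_iff
  proof (intro allI impI)
    fix a j assume a: "(a, j) \<in> diamond l i k"
    \<comment> \<open>The mirror image of column a in row j, with the subtraction of natural numbers
      done last.\<close>
    let ?b = "(2 * i + l + j) - (1 + k + a)"
    have "(?b, j) \<in> diamond l i k" "1 + k + a \<le> 2 * i + l + j" using a by (auto simp: diamond_def)
    then show "\<exists>b. (b, j) \<in> diamond l i k \<and> real a + real b = c + real j"
      by (intro exI[of _ ?b]) (auto simp: c of_nat_diff)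
  qed
qed

text \<open>Overlapping symmetrically is a pairwise condition. Since a diamond has only one axis,
  all the others share the axis of one chosen diamond \<open>D0\<close>, which exists because C is
  nonempty.\<close>

lemma axially_symmetric_union_of_diamonds:
  assumes "union_of_symmetric_diamonds n C" "C \<noteq> {}"
  shows "axially_symmetric C"
proof -
  obtain \<D> where D: "\<D> \<subseteq> diamonds n" "\<And>D D'. D \<in> \<D> \<Longrightarrow> D' \<in> \<D> \<Longrightarrow> overlap_symmetrically D D'" "C = \<Union>\<D>"
    using assms(1) unfolding union_of_symmetric_diamonds_def by blast
  then obtain D0 where D0: "D0 \<in> \<D>" using assms(2) by blast
  then obtain l i k where l: "D0 = diamond l i k" "1 \<le> l" using D(1) by (auto simp: diamonds_def)
  let ?c = "2 * real i + real l - 1 - real k"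
  have "vertical_axis ?c D" if "D \<in> \<D>" for D
    using D(2)[OF that D0] diamond_axis[OF l(2)] l(1) by (auto simp: overlap_symmetrically_def)
  then have "vertical_axis ?c C" unfolding vertical_axis_iff D(3) by blast
  then show ?thesis by (auto simp: axially_symmetric_def)
qed

context gc_array
begin

lemma block_axis:
  assumes run: "run m lo hi"
  shows "vertical_axis c (block m lo hi) \<longleftrightarrow> (\<forall>j\<in>{lo..hi}. c = real (above m j) + real (atleast m j) + 1 - real j)"
proof
  assume v: "vertical_axis c (block m lo hi)"
  show "\<forall>j\<in>{lo..hi}. c = real (above m j) + real (atleast m j) + 1 - real j"
  proof
    fix j assume j: "j \<in> {lo..hi}"
    then have "Suc (above m j) \<le> atleast m j" using run_block_nonempty[OF run, of j] by (auto simp: block_def)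
    moreover have "(i, j) \<in> block m lo hi \<longleftrightarrow> Suc (above m j) \<le> i \<and> i \<le> atleast m j" for i
      using j by (auto simp: block_def)
    ultimately show "c = real (above m j) + real (atleast m j) + 1 - real j"
      using vertical_axis_row[OF v, of j "Suc (above m j)" "atleast m j"] by simp
  qed
next
  assume c: "\<forall>j\<in>{lo..hi}. c = real (above m j) + real (atleast m j) + 1 - real j"
  show "vertical_axis c (block m lo hi)"
    unfolding vertical_axis_iff
  proof (intro allI impI)
    fix i j assume i: "(i, j) \<in> block m lo hi"
    let ?i = "above m j + atleast m j + 1 - i"
    have "(?i, j) \<in> block m lo hi" "i \<le> above m j + atleast m j + 1" using i by (auto simp: block_def)
    then show "\<exists>i'. (i', j) \<in> block m lo hi \<and> real i + real i' = c + real j"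
      using c i by (intro exI[of _ ?i]) (auto simp: block_def of_nat_diff)
  qed
qed

lemma axially_symmetric_block_iff:
  assumes run: "run m lo hi"
  shows "axially_symmetric (block m lo hi) \<longleftrightarrow> (\<forall>j\<in>{lo..<hi}. mult m j \<noteq> mult m (Suc j))"
proof -
  let ?c = "\<lambda>j. real (above m j) + real (atleast m j) + 1 - real j"
  have lh: "lo \<le> hi" "hi \<le> n" using run by (auto simp: run_def)
  have step: "?c (Suc j) = ?c j \<longleftrightarrow> mult m j \<noteq> mult m (Suc j)" if "j \<in> {lo..<hi}" for j
  proof -
    have j: "j < n" using that lh by auto
    have "?c (Suc j) = ?c j \<longleftrightarrow> above m (Suc j) + atleast m (Suc j) = above m j + atleast m j + 1"
      by (rule iffI) linarith+
    also have "\<dots> \<longleftrightarrow> atleast m j - above m j \<noteq> atleast m (Suc j) - above m (Suc j)"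
      using above_step[OF j, of m] atleast_step[OF j, of m] above_le_atleast[of m j] above_le_atleast[of m "Suc j"]
      by (rule interval_step)
    finally show ?thesis using mult_eq[of j m] mult_eq[of "Suc j" m] j by simp
  qed
  have "axially_symmetric (block m lo hi) \<longleftrightarrow> (\<forall>j\<in>{lo..hi}. ?c j = ?c lo)"
    unfolding axially_symmetric_def block_axis[OF run] using lh(1) by (metis atLeastAtMost_iff order_refl)
  also have "\<dots> \<longleftrightarrow> (\<forall>j\<in>{lo..<hi}. ?c (Suc j) = ?c j)"
  proof (intro iffI ballI)
    fix j assume "\<forall>j\<in>{lo..hi}. ?c j = ?c lo" "j \<in> {lo..<hi}"
    then show "?c (Suc j) = ?c j" by (metis Suc_leI atLeastAtMost_iff atLeastLessThan_iff le_SucI less_imp_le_nat)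
  next
    fix j assume a: "\<forall>j\<in>{lo..<hi}. ?c (Suc j) = ?c j" and j: "j \<in> {lo..hi}"
    then have "lo \<le> j" "j \<le> hi" by auto
    then show "?c j = ?c lo"
    proof (induction j rule: dec_induct)
      case (step j)
      then show ?case using a by auto
    qed simp
  qed
  also have "\<dots> \<longleftrightarrow> (\<forall>j\<in>{lo..<hi}. mult m j \<noteq> mult m (Suc j))" using step by blast
  finally show ?thesis .
qed

lemma all_symmetric_iff:
  "(\<forall>C\<in>chains n T. axially_symmetric C) \<longleftrightarrow> dimension_defect (chains n T) = 0"
proof -
  have "(\<forall>C\<in>chains n T. axially_symmetric C) \<longleftrightarrow>
    (\<forall>m lo hi. run m lo hi \<longrightarrow> (\<forall>j\<in>{lo..<hi}. mult m j \<noteq> mult m (Suc j)))"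
    unfolding chains_eq using axially_symmetric_block_iff by blast
  also have "\<dots> \<longleftrightarrow> (\<forall>m k. k < n \<longrightarrow> mult m k > 0 \<longrightarrow> mult m k \<noteq> mult m (Suc k))"
  proof (intro iffI allI impI ballI)
    fix m k
    assume a: "\<forall>m lo hi. run m lo hi \<longrightarrow> (\<forall>j\<in>{lo..<hi}. mult m j \<noteq> mult m (Suc j))" and k: "k < n" "mult m k > 0"
    show "mult m k \<noteq> mult m (Suc k)"
    proof
      assume eq: "mult m k = mult m (Suc k)"
      then have "occurs m k" "occurs m (Suc k)" using occurs_iff_mult k by auto
      then obtain lo hi where r: "run m lo hi" "lo \<le> k" "k \<le> hi" using run_exists[of m k] k by auto
      then have "k < hi" using \<open>occurs m (Suc k)\<close> k by (metis le_neq_implies_less run_def)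
      then show False using a r eq by auto
    qed
  next
    fix m lo hi j
    assume a: "\<forall>m k. k < n \<longrightarrow> mult m k > 0 \<longrightarrow> mult m k \<noteq> mult m (Suc k)" and r: "run m lo hi" and j: "j \<in> {lo..<hi}"
    then have "occurs m j" "j < n" by (auto simp: run_def)
    then show "mult m j \<noteq> mult m (Suc j)" using a occurs_iff_mult[of j m] by auto
  qed
  finally show ?thesis using dimension_defect_0_iff by blast
qed

lemma symmetric_no_repeats:
  assumes "C \<in> chains n T" "axially_symmetric C" "2 \<le> \<alpha>" "\<alpha> \<le> length (chain_sequence C)"
  shows "chain_sequence C ! (\<alpha> - 1) \<noteq> chain_sequence C ! (\<alpha> - 2)"
proof
  assume eq: "chain_sequence C ! (\<alpha> - 1) = chain_sequence C ! (\<alpha> - 2)"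
  obtain m lo hi where C: "C = block m lo hi" "run m lo hi" using assms(1) by (auto simp: chains_eq)
  have "\<alpha> \<in> repeat_indices (chain_sequence C)" using assms(3,4) eq by (simp add: repeat_indices_def)
  then show False
    using assms(2) unfolding C(1) chain_sequence_block[OF C(2)] repeat_indices_block[OF C(2)] axially_symmetric_block_iff[OF C(2)]
    by auto
qed

text \<open>Row k contains m in l consecutive columns. Going up or down, monotonicity along columns
  and diagonals squeezes every entry of the diamond on this row between two entries of row k, both
  equal to m.\<close>

lemma diamond_in_block:
  assumes run: "run m lo hi" and k: "lo \<le> k" "k \<le> hi" and strict: "mult m n \<le> 1"
  defines "l \<equiv> mult m k" and "i \<equiv> Suc (above m k)"
  shows "diamond l i k \<in> diamonds n" "diamond l i k \<subseteq> block m lo hi"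
proof -
  have kn: "1 \<le> k" "k \<le> n" "occurs m k" using run k by (auto simp: run_def)
  have il: "i + l = Suc (atleast m k)" "1 \<le> l"
    using kn mult_eq[of k m] by (auto simp: l_def i_def occurs_def)
  have ik: "i + l \<le> k + 1" using il atleast_le[of m k] by auto
  have val: "T (a, k) = m" if "i \<le> a" "a < i + l" for a
    using that il value_iff[of a k m] kn atleast_le[of m k] by (auto simp: i_def)
  have up: "T (a, j) = m" if "k \<le> j" "i + j \<le> a + k" "a < i + l" "j \<le> n" for a j
  proof -
    have "T (a, k) \<le> T (a, j)" using that ik by (intro column_monotone) (auto simp: i_def)
    moreover have "T ((a + k - j) + (j - k), k + (j - k)) \<le> T (a + k - j, k)"
      using that ik by (intro diagonal_antitone) (auto simp: i_def)
    moreover have "(a + k - j) + (j - k) = a" "k + (j - k) = j" using that ik by (auto simp: i_def)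
    moreover have "T (a, k) = m" "T (a + k - j, k) = m" using that by (auto intro!: val)
    ultimately show ?thesis by auto
  qed
  have down: "T (a, j) = m" if "j \<le> k" "i \<le> a" "a + k < i + l + j" for a j
  proof -
    have aj: "a \<le> j" using that ik by auto
    have "T (a, j) \<le> T (a, k)" using that aj kn by (intro column_monotone) (auto simp: i_def)
    moreover have "T (a + (k - j), j + (k - j)) \<le> T (a, j)"
      using that aj kn by (intro diagonal_antitone) (auto simp: i_def)
    moreover have "j + (k - j) = k" using that by auto
    moreover have "T (a, k) = m" "T (a + (k - j), k) = m" using that by (auto intro!: val)
    ultimately show ?thesis by auto
  qed
  \<comment> \<open>A diamond protruding beyond row n would be cut by row n in at least two entries
    equal to m.\<close>
  have kl: "k + l \<le> n + 1"
  proof (rule ccontr)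
    assume "\<not> k + l \<le> n + 1"
    then have a: "i + (n - k) \<noteq> i + l - 1" "k \<le> n" "i + (n - k) < i + l - 1" using kn by auto
    have "T (i + (n - k), n) = m" "T (i + l - 1, n) = m" using a il by (auto intro!: up)
    then have "{i + (n - k), i + l - 1} \<subseteq> {a\<in>{1..n}. T (a, n) = m}" using a ik kn by (auto simp: i_def)
    then have "card {i + (n - k), i + l - 1} \<le> mult m n" unfolding mult_def by (intro card_mono) auto
    then show False using a(1) strict by simp
  qed
  show "diamond l i k \<in> diamonds n"
    unfolding diamonds_def
    by (intro CollectI exI[of _ l] exI[of _ i] exI[of _ k] conjI refl) (use il ik kl in \<open>auto simp: i_def\<close>)
  have in_pos: "(a, j) \<in> positions n \<and> T (a, j) = m" if "(a, j) \<in> diamond l i k" for a j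
    using that up[of j a] down[of j a] kl ik kn by (auto simp: diamond_def positions_def i_def)
  have occ: "occurs m j" if "k < j + l" "j < k + l" for j
  proof -
    have "(i + (j - k), j) \<in> diamond l i k" using that by (auto simp: diamond_def)
    from in_pos[OF this] show ?thesis
      using value_iff[of "i + (j - k)" j m] by (auto simp: positions_def occurs_def)
  qed
  show "diamond l i k \<subseteq> block m lo hi"
  proof
    fix z assume z: "z \<in> diamond l i k"
    obtain a j where aj: "z = (a, j)" by (cases z)
    have j: "k < j + l" "j < k + l" "j \<le> n" using z aj in_pos[of a j] il by (auto simp: diamond_def positions_def)
    have "lo \<le> j"
    proof (rule ccontr)
      assume "\<not> lo \<le> j"
      then have "occurs m (lo - 1)" using j k by (intro occ) auto
      then show False using run by (simp add: run_def)
    qed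
    moreover have "j \<le> hi"
    proof (rule ccontr)
      assume "\<not> j \<le> hi"
      then have "occurs m (Suc hi)" "hi < n" using j k by (auto intro!: occ)
      then show False using run by (simp add: run_def)
    qed
    ultimately show "z \<in> block m lo hi" using in_blockI[of a j m lo hi] in_pos z aj by auto
  qed
qed

text \<open>The diamonds are those spanned by the rows of the chain, one per row. They cover it, lie
  inside it, and have its axis because each row is centred on that axis.\<close>

lemma symmetric_block_union_of_diamonds:
  assumes run: "run m lo hi" and sym: "axially_symmetric (block m lo hi)" and strict: "mult m n \<le> 1"
  shows "union_of_symmetric_diamonds n (block m lo hi)"
proof -
  let ?D = "\<lambda>k. diamond (mult m k) (Suc (above m k)) k"
  obtain c where c: "vertical_axis c (block m lo hi)" using sym by (auto simp: axially_symmetric_def)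
  have ax: "vertical_axis c (?D k)" if k: "k \<in> {lo..hi}" for k
  proof -
    have "k \<le> n" "occurs m k" using run k by (auto simp: run_def)
    then have "1 \<le> mult m k" "real (mult m k) = real (atleast m k) - real (above m k)"
      using mult_eq[of k m] by (auto simp: occurs_def of_nat_diff)
    moreover have "c = real (above m k) + real (atleast m k) + 1 - real k" using c block_axis[OF run] k by blast
    ultimately show ?thesis using diamond_axis by simp
  qed
  have cover: "block m lo hi \<subseteq> \<Union> (?D ` {lo..hi})"
  proof
    fix z assume "z \<in> block m lo hi"
    then obtain a k where a: "z = (a, k)" "lo \<le> k" "k \<le> hi" "above m k < a" "a \<le> atleast m k" by (auto simp: block_def)
    moreover have "k \<le> n" using run a by (auto simp: run_def)
    ultimately have "z \<in> ?D k" using mult_eq[of k m] by (auto simp: diamond_def)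
    then show "z \<in> \<Union> (?D ` {lo..hi})" using a by auto
  qed
  show ?thesis
    unfolding union_of_symmetric_diamonds_def
  proof (intro exI[of _ "?D ` {lo..hi}"] conjI)
    show "?D ` {lo..hi} \<subseteq> diamonds n" using diamond_in_block(1)[OF run _ _ strict] by auto
    show "\<forall>D\<in>?D ` {lo..hi}. \<forall>D'\<in>?D ` {lo..hi}. overlap_symmetrically D D'"
      unfolding overlap_symmetrically_def using ax by blast
    show "block m lo hi = \<Union> (?D ` {lo..hi})"
      using cover diamond_in_block(2)[OF run _ _ strict] by fastforce
  qed
qed

lemma all_diamonds_iff:
  assumes "\<And>m. mult m n \<le> 1"
  shows "(\<forall>C\<in>chains n T. union_of_symmetric_diamonds n C) \<longleftrightarrow> (\<forall>C\<in>chains n T. axially_symmetric C)"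
proof (intro iffI ballI)
  fix C assume "\<forall>C\<in>chains n T. union_of_symmetric_diamonds n C" and C: "C \<in> chains n T"
  moreover have "C \<noteq> {}" using C by (auto simp: chains_def)
  ultimately show "axially_symmetric C" using axially_symmetric_union_of_diamonds by blast
next
  fix C assume "\<forall>C\<in>chains n T. axially_symmetric C" and C: "C \<in> chains n T"
  then show "union_of_symmetric_diamonds n C"
    using symmetric_block_union_of_diamonds assms by (auto simp: chains_eq)
qed

lemma top_row_bounds:
  assumes "1 \<le> i" "i \<le> j" "j \<le> n"
  shows "T (i + n - j, n) \<le> T (i, j)" "T (i, j) \<le> T (i, n)"
  using diagonal_antitone[of i j "n - j"] column_monotone[of i j n] assms by auto

end

text \<open>The triangle of averages over the windows \<open>\<lambda>\<^sub>i, \<dots>, \<lambda>\<^sub>i\<^sub>+\<^sub>n\<^sub>-\<^sub>j\<close> has no equalities but the forced ones.\<close>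

definition average_triangle :: "nat \<Rightarrow> (nat \<Rightarrow> real) \<Rightarrow> nat \<times> nat \<Rightarrow> real" where
  "average_triangle n lam = (\<lambda>(i, j). (\<Sum>s\<in>{i..i + (n - j)}. lam s) / (real (n - j) + 1))"

section \<open>The averaged triangle and regular values\<close>

context
  fixes n :: nat and lam :: "nat \<Rightarrow> real"
  assumes lam: "\<And>i j. 1 \<le> i \<Longrightarrow> i \<le> j \<Longrightarrow> j \<le> n \<Longrightarrow> lam j \<le> lam i"
begin

text \<open>One end of the window is kept exactly and all other terms are replaced by the other end.
  A cruder bound would not detect a difference between the two ends.\<close>

lemma window_sum_bounds:
  assumes "1 \<le> i" "i + N \<le> n"
  shows "lam i + real N * lam (i + N) \<le> (\<Sum>s\<in>{i..i + N}. lam s)"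
    "(\<Sum>s\<in>{i..i + N}. lam s) \<le> real N * lam i + lam (i + N)"
proof -
  have "(\<Sum>s\<in>{i..i + N}. lam s) = lam i + (\<Sum>s\<in>{Suc i..i + N}. lam s)" by (rule sum.atLeast_Suc_atMost) simp
  moreover have "(\<Sum>s\<in>{Suc i..i + N}. lam s) \<ge> (\<Sum>s\<in>{Suc i..i + N}. lam (i + N))"
    using assms by (intro sum_mono lam) auto
  ultimately show "lam i + real N * lam (i + N) \<le> (\<Sum>s\<in>{i..i + N}. lam s)" by simp
  have "(\<Sum>s\<in>{i..i + N}. lam s) = (\<Sum>s\<in>{i..<i + N}. lam s) + lam (i + N)"
    using sum.last_plus[of i "i + N" lam] by (simp add: add.commute)
  moreover have "(\<Sum>s\<in>{i..<i + N}. lam s) \<le> (\<Sum>s\<in>{i..<i + N}. lam i)"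
    using assms by (intro sum_mono lam) auto
  ultimately show "(\<Sum>s\<in>{i..i + N}. lam s) \<le> real N * lam i + lam (i + N)" by simp
qed

text \<open>Passing to row j + 1 drops the smallest or the largest term of a window of N + 2 terms.
  This cannot lower, respectively raise, the average, and leaves it unchanged only if both ends of
  the window agree.\<close>

lemma average_triangle_steps:
  assumes "1 \<le> i" "i \<le> j" "j < n"
  shows "average_triangle n lam (i, j) \<le> average_triangle n lam (i, Suc j)"
    "average_triangle n lam (Suc i, Suc j) \<le> average_triangle n lam (i, j)"
    "average_triangle n lam (i, j) = average_triangle n lam (i, Suc j) \<Longrightarrow> lam i = lam (i + (n - j))"
    "average_triangle n lam (i, j) = average_triangle n lam (Suc i, Suc j) \<Longrightarrow> lam i = lam (i + (n - j))"
proof -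
  define N where "N = n - Suc j"
  have nj: "n - j = Suc N" using assms by (simp add: N_def)
  define S where "S = (\<Sum>s\<in>{i..i + Suc N}. lam s)"
  have b: "lam i + real (Suc N) * lam (i + Suc N) \<le> S" "S \<le> real (Suc N) * lam i + lam (i + Suc N)"
    using window_sum_bounds[of i "Suc N"] assms nj by (auto simp: S_def)
  have l: "lam (i + Suc N) \<le> lam i" using assms nj by (intro lam) auto
  have "S = (\<Sum>s\<in>{i..i + N}. lam s) + lam (i + Suc N)" by (simp add: S_def)
  then have t1: "average_triangle n lam (i, Suc j) = (S - lam (i + Suc N)) / (real N + 1)"
    by (simp add: average_triangle_def N_def[symmetric])
  have "S = lam i + (\<Sum>s\<in>{Suc i..i + Suc N}. lam s)" unfolding S_def by (rule sum.atLeast_Suc_atMost) simp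
  then have t2: "average_triangle n lam (Suc i, Suc j) = (S - lam i) / (real N + 1)"
    by (simp add: average_triangle_def N_def[symmetric])
  have t0: "average_triangle n lam (i, j) = S / (real N + 2)"
    by (simp add: average_triangle_def nj S_def add.commute)
  have d1: "(S - x) / (real N + 1) - S / (real N + 2) = (S - (real N + 2) * x) / ((real N + 1) * (real N + 2))" for x
    by (simp add: field_simps)
  have pos: "(real N + 1) * (real N + 2) > 0" by simp
  have b': "lam i + (real N + 1) * lam (i + Suc N) \<le> S" "S \<le> (real N + 1) * lam i + lam (i + Suc N)"
    using b by (simp_all add: add.commute)
  have up: "S - (real N + 2) * lam (i + Suc N) \<ge> lam i - lam (i + Suc N)" using b'(1) by (simp add: algebra_simps)
  have dn: "S - (real N + 2) * lam i \<le> lam (i + Suc N) - lam i" using b'(2) by (simp add: algebra_simps)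
  have "(S - (real N + 2) * lam (i + Suc N)) / ((real N + 1) * (real N + 2)) \<ge> 0"
    using up l pos by (intro divide_nonneg_pos) auto
  then show "average_triangle n lam (i, j) \<le> average_triangle n lam (i, Suc j)"
    unfolding t0 t1 using d1[of "lam (i + Suc N)"] by linarith
  have "(S - (real N + 2) * lam i) / ((real N + 1) * (real N + 2)) \<le> 0"
    using dn l pos by (intro divide_nonpos_pos) auto
  then show "average_triangle n lam (Suc i, Suc j) \<le> average_triangle n lam (i, j)"
    unfolding t0 t2 using d1[of "lam i"] by linarith
  show "lam i = lam (i + (n - j))" if "average_triangle n lam (i, j) = average_triangle n lam (i, Suc j)"
  proof -
    have "(S - (real N + 2) * lam (i + Suc N)) / ((real N + 1) * (real N + 2)) = 0"
      using that unfolding t0 t1 using d1[of "lam (i + Suc N)"] by linarith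
    then have "S - (real N + 2) * lam (i + Suc N) = 0" using pos by (metis divide_eq_0_iff less_irrefl)
    then show ?thesis using up l nj by simp
  qed
  show "lam i = lam (i + (n - j))" if "average_triangle n lam (i, j) = average_triangle n lam (Suc i, Suc j)"
  proof -
    have "(S - (real N + 2) * lam i) / ((real N + 1) * (real N + 2)) = 0"
      using that unfolding t0 t2 using d1[of "lam i"] by linarith
    then have "S - (real N + 2) * lam i = 0" using pos by (metis divide_eq_0_iff less_irrefl)
    then show ?thesis using dn l nj by simp
  qed
qed

lemma gc_triangle_average: "j \<le> n \<Longrightarrow> gc_triangle n lam (average_triangle n lam) (i, j) = average_triangle n lam (i, j)"
  by (simp add: gc_triangle_def average_triangle_def)

lemma interlacing_average: "interlacing n (gc_triangle n lam (average_triangle n lam))"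
  using average_triangle_steps by (auto simp: interlacing_def gc_triangle_average)

text \<open>Suppose m fills the columns g + 1, ..., h of row k and has the same multiplicity in row
  k + 1. Both extreme entries equal a neighbour above them, so these equalities are forced and the
  averaged triangle shows that \<open>lam\<close> is constant on the windows belonging to them. Thus
  \<open>lam\<close> is m from g + 1 to h + n - k, which forces m in the columns g + 1, ..., h + 1
  of row k + 1, one more than before.\<close>

lemma regular_value_defect:
  assumes inter: "interlacing n (gc_triangle n lam \<Lambda>)" and reg: "regular_value n lam \<Lambda>"
  shows "dimension_defect (chains n (gc_triangle n lam \<Lambda>)) = 0"
proof -
  define T where "T = gc_triangle n lam \<Lambda>"
  interpret gc_array n T by unfold_locales (simp add: T_def inter)
  have top: "T (i, n) = lam i" for i by (simp add: T_def gc_triangle_def)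
  have forced: "lam i = lam (i + (n - k))"
    if "1 \<le> i" "i \<le> k" "k < n" "i' = i \<or> i' = Suc i" "T (i, k) = T (i', Suc k)" for i i' k
  proof -
    have "neighbours (i, k) (i', Suc k)" using that(4) neighbours_up by auto
    moreover have "(i, k) \<in> positions n" "(i', Suc k) \<in> positions n" using that by (auto simp: positions_def)
    ultimately have "gc_triangle n lam (average_triangle n lam) (i, k) = gc_triangle n lam (average_triangle n lam) (i', Suc k)"
      using reg interlacing_average that(5) unfolding regular_value_def T_def by blast
    then have "average_triangle n lam (i, k) = average_triangle n lam (i', Suc k)"
      using that by (simp add: gc_triangle_average)
    then show ?thesis using average_triangle_steps(3,4)[OF that(1-3)] that(4) by blast
  qed
  have "mult m k \<noteq> mult m (Suc k)" if k: "k < n" "mult m k > 0" for m k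
  proof
    assume eq: "mult m k = mult m (Suc k)"
    define g h where "g = above m k" "h = atleast m k"
    have k1: "1 \<le> k" using k(2) mult_0[of m] by (cases k) auto
    have gh: "g < h" "h \<le> k" using k mult_eq[of k m] atleast_le by (auto simp: g_h_def)
    have occ: "above m (Suc k) < atleast m (Suc k)" using eq k mult_eq[of "Suc k" m] by auto
    have g': "above m (Suc k) = g \<or> above m (Suc k) = Suc g" "atleast m (Suc k) = h \<or> atleast m (Suc k) = Suc h"
      using above_step[OF k(1), of m] atleast_step[OF k(1), of m] by (auto simp: g_h_def)
    have v: "T (Suc g, k) = m" "T (h, k) = m"
      using value_iff[of "Suc g" k m] value_iff[of h k m] gh k1 k by (auto simp: g_h_def)
    have v': "T (Suc (above m (Suc k)), Suc k) = m" "T (atleast m (Suc k), Suc k) = m"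
      using value_iff[of "Suc (above m (Suc k))" "Suc k" m] value_iff[of "atleast m (Suc k)" "Suc k" m] occ
        atleast_le[of m "Suc k"] k by auto
    have f1: "lam (Suc g) = lam (Suc g + (n - k))"
      using forced[of "Suc g" k "Suc (above m (Suc k))"] g'(1) v v' gh k by auto
    have f2: "lam h = lam (h + (n - k))"
      using forced[of h k "atleast m (Suc k)"] g'(2) v v' gh k by auto
    have "T (h + n - k, n) \<le> m" using top_row_bounds(1)[of h k] v gh k by auto
    moreover have "m \<le> lam h" using top_row_bounds(2)[of h k] v gh k top by auto
    ultimately have m: "lam (h + (n - k)) = m" "lam h = m" using f2 k by (auto simp: top)
    have "Suc g + n - k = Suc g + (n - k)" using k by simp
    moreover have "T (Suc g + n - k, n) \<le> m" using top_row_bounds(1)[of "Suc g" k] v gh k by auto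
    ultimately have "lam (Suc g + (n - k)) \<le> m" by (simp only: top)
    moreover have "m \<le> lam (Suc g)" using top_row_bounds(2)[of "Suc g" k] v gh k top by auto
    ultimately have m': "lam (Suc g) = m" using f1 by linarith
    have "T (a, Suc k) = m" if a: "Suc g \<le> a" "a \<le> Suc h" for a
    proof -
      have ak: "1 \<le> a" "a \<le> Suc k" "Suc k \<le> n" using a gh k by auto
      have "m \<le> lam (a + n - Suc k)" unfolding m(1)[symmetric] using a gh k by (intro lam) auto
      moreover have "lam a \<le> m" unfolding m'[symmetric] using a gh k by (intro lam) auto
      ultimately show ?thesis using top_row_bounds[OF ak] by (simp add: top)
    qed
    then have "{Suc g..Suc h} \<subseteq> {i\<in>{1..Suc k}. T (i, Suc k) = m}" using gh by auto
    then have "card {Suc g..Suc h} \<le> mult m (Suc k)" unfolding mult_def by (intro card_mono) auto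
    then show False using eq mult_eq[of k m] k gh by (auto simp: g_h_def)
  qed
  then show ?thesis using dimension_defect_0_iff by (simp add: T_def)
qed

end

section \<open>Spectra of leading submatrices\<close>

text \<open>With numbers as indices, the leading blocks of all sizes are restrictions of one
  function.\<close>

definition ent :: "'n::{finite,linorder} cmatrix \<Rightarrow> nat \<Rightarrow> nat \<Rightarrow> complex" where
  "ent X i j = vec_nth (vec_nth X (nth_index i)) (nth_index j)"

lemma leading_submatrix_ent: "leading_submatrix X k = Matrix.mat k k (\<lambda>(i, j). ent X i j)"
  by (simp add: leading_submatrix_def ent_def)

lemma leading_submatrix_carrier: "leading_submatrix X k \<in> carrier_mat k k"
  by (simp add: leading_submatrix_def)

lemma hermitian_ent: "hermitian X \<Longrightarrow> ent X j i = cnj (ent X i j)"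
  unfolding hermitian_def ent_def by blast

text \<open>For a unit eigenvector q the eigenvalue is the value of the Hermitian form at q, which
  equals its own conjugate.\<close>

lemma hermitian_eigenvalue_real:
  assumes A: "A \<in> carrier_mat n n" and herm: "\<And>i j. i < n \<Longrightarrow> j < n \<Longrightarrow> A $$ (j, i) = cnj (A $$ (i, j))"
    and ev: "eigenvalue A e"
  shows "e = complex_of_real (Re e)"
proof -
  obtain q :: "nat \<Rightarrow> complex" and t where q: "(\<Sum>i<n. (cmod (q i))\<^sup>2) = 1" "q 0 = complex_of_real t" "t \<le> 0"
    "\<And>i. i < n \<Longrightarrow> (\<Sum>s<n. A $$ (i, s) * q s) = e * q i"
    by (rule unit_eigenvector[OF A ev]) (rule that)
  define z where "z = (\<Sum>i<n. \<Sum>s<n. cnj (q i) * (A $$ (i, s) * q s))"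
  have "z = (\<Sum>i<n. cnj (q i) * (e * q i))"
    unfolding z_def using q(4) by (intro sum.cong) (auto simp: sum_distrib_left[symmetric])
  also have "\<dots> = e * (\<Sum>i<n. complex_of_real ((cmod (q i))\<^sup>2))"
    unfolding sum_distrib_left by (intro sum.cong refl) (simp add: complex_norm_square del: of_real_power)
  also have "\<dots> = e" using q(1) by (metis mult.right_neutral of_real_1 of_real_sum)
  finally have "z = e" .
  moreover have "cnj z = z"
  proof -
    have "cnj z = (\<Sum>i<n. \<Sum>s<n. cnj (q s) * (A $$ (s, i) * q i))"
      unfolding z_def cnj_sum
    proof (intro sum.cong refl)
      fix i s assume "i \<in> {..<n}" "s \<in> {..<n}"
      then have "A $$ (s, i) = cnj (A $$ (i, s))" using herm[of i s] by simp
      then show "cnj (cnj (q i) * (A $$ (i, s) * q s)) = cnj (q s) * (A $$ (s, i) * q i)" by (simp only: complex_cnj_mult complex_cnj_cnj mult_ac)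
    qed
    also have "\<dots> = z" unfolding z_def by (rule sum.swap)
    finally show ?thesis .
  qed
  ultimately have "cnj e = e" by simp
  then show ?thesis by (metis Reals_cnj_iff complex_is_Real_iff of_real_Re)
qed

lemma char_poly_eq_prod_proots:
  fixes A :: "complex mat"
  assumes "A \<in> carrier_mat n n"
  shows "char_poly A = (\<Prod>a\<in>#proots (char_poly A). [:- a, 1:])" "size (proots (char_poly A)) = n"
proof -
  obtain as where as: "char_poly A = (\<Prod>a\<leftarrow>as. [:- a, 1:])" "length as = n"
    using char_poly_factorized[OF assms] by blast
  have "proots (\<Prod>a\<leftarrow>as. [:- a, 1:]) = mset as"
  proof (induction as)
    case (Cons a as)
    have "(\<Prod>a\<leftarrow>as. [:- a, 1:]) \<noteq> 0" by (induction as) (auto simp del: mult_pCons_left)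
    then show ?case using Cons by (simp add: proots_mult del: mult_pCons_left)
  qed simp
  then have p: "proots (char_poly A) = mset as" using as(1) by simp
  show "char_poly A = (\<Prod>a\<in>#proots (char_poly A). [:- a, 1:])"
    unfolding p unfolding as(1) by (simp only: mset_map[symmetric] prod_mset_prod_list)
  show "size (proots (char_poly A)) = n" using p as(2) by simp
qed

context
  fixes X :: "'n::{finite,linorder} cmatrix"
  assumes herm: "hermitian X"
begin

lemma eigenvalue_mset_real: "eigenvalue_mset X k = image_mset complex_of_real (image_mset Re (eigenvalue_mset X k))"
proof -
  have "a = complex_of_real (Re a)" if "a \<in># eigenvalue_mset X k" for a
  proof -
    let ?A = "leading_submatrix X k"
    have "char_poly ?A \<noteq> 0" using degree_monic_char_poly[OF leading_submatrix_carrier[of X k]] by auto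
    then have "poly (char_poly ?A) a = 0" using that by (simp add: eigenvalue_mset_def)
    then have "eigenvalue ?A a" using eigenvalue_root_char_poly[OF leading_submatrix_carrier] by blast
    then show ?thesis
    proof (rule hermitian_eigenvalue_real[OF leading_submatrix_carrier, rotated])
      show "?A $$ (j, i) = cnj (?A $$ (i, j))" if "i < k" "j < k" for i j
        using that hermitian_ent[OF herm, of j i] by (simp add: leading_submatrix_ent)
    qed
  qed
  then have "image_mset complex_of_real (image_mset Re (eigenvalue_mset X k)) = image_mset (\<lambda>a. a) (eigenvalue_mset X k)"
    unfolding multiset.map_comp by (intro image_mset_cong) (simp add: o_def)
  then show ?thesis by simp
qed

lemma char_poly_gc_eigenvalue:
  "char_poly (leading_submatrix X k) = (\<Prod>i<k. [:- complex_of_real (gc_eigenvalue X (Suc i) k), 1:])"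
proof -
  define es where "es = rev (sorted_list_of_multiset (image_mset Re (eigenvalue_mset X k)))"
  have m: "mset es = image_mset Re (eigenvalue_mset X k)" by (simp add: es_def)
  have len: "length es = k"
    using arg_cong[OF m, of size] char_poly_eq_prod_proots(2)[OF leading_submatrix_carrier[of X k]]
    by (simp add: eigenvalue_mset_def)
  have "char_poly (leading_submatrix X k) = (\<Prod>a\<in>#eigenvalue_mset X k. [:- a, 1:])"
    using char_poly_eq_prod_proots(1)[OF leading_submatrix_carrier[of X k]] by (simp add: eigenvalue_mset_def)
  also have "\<dots> = (\<Prod>a\<in>#image_mset complex_of_real (mset es). [:- a, 1:])"
    unfolding m by (subst eigenvalue_mset_real) (rule refl)
  also have "\<dots> = (\<Prod>r\<leftarrow>es. [:- complex_of_real r, 1:])"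
    by (simp add: image_mset.compositionality o_def flip: mset_map prod_mset_prod_list)
  also have "\<dots> = (\<Prod>i<k. [:- complex_of_real (es ! i), 1:])"
    using len by (simp add: prod.list_conv_set_nth lessThan_atLeast0)
  finally show ?thesis by (simp add: gc_eigenvalue_def es_def)
qed

lemma gc_eigenvalue_antitone:
  assumes "i \<le> j" "j < k"
  shows "gc_eigenvalue X (Suc j) k \<le> gc_eigenvalue X (Suc i) k"
proof -
  define l where "l = sorted_list_of_multiset (image_mset Re (eigenvalue_mset X k))"
  have "mset l = image_mset Re (eigenvalue_mset X k)" by (simp add: l_def)
  then have len: "length l = k"
    using char_poly_eq_prod_proots(2)[OF leading_submatrix_carrier[of X k]]
    by (metis eigenvalue_mset_def size_image_mset size_mset)
  have "sorted l" by (simp add: l_def sorted_sorted_list_of_multiset)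
  then have "l ! (k - Suc j) \<le> l ! (k - Suc i)" using assms len by (intro sorted_nth_mono) auto
  then show ?thesis using assms len by (simp add: gc_eigenvalue_def l_def[symmetric] rev_nth)
qed

end

lemma fiber_hermitian: "A \<in> gc_fiber lam \<Lambda> \<Longrightarrow> hermitian A"
  by (simp add: gc_fiber_def coadjoint_orbit_def)

lemma fiber_triangle:
  fixes A :: "'n::{finite,linorder} cmatrix"
  assumes A: "A \<in> gc_fiber lam \<Lambda>" and k: "k < CARD('n)" "i < k"
  shows "gc_triangle CARD('n) lam \<Lambda> (Suc i, k) = gc_eigenvalue A (Suc i) k"
proof -
  have "gc_map A = \<Lambda>" using A by (simp add: gc_fiber_def)
  then have "\<Lambda> (Suc i, k) = gc_map A (Suc i, k)" by simp
  then show ?thesis using k by (simp add: gc_map_def gc_triangle_def)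
qed

lemma fiber_char_poly:
  fixes A :: "'n::{finite,linorder} cmatrix"
  assumes A: "A \<in> gc_fiber lam \<Lambda>" and k: "k \<le> CARD('n)"
  shows "char_poly (leading_submatrix A k) =
    (\<Prod>i<k. [:- complex_of_real (gc_triangle CARD('n) lam \<Lambda> (Suc i, k)), 1:])"
proof (cases "k = CARD('n)")
  case False
  then show ?thesis
    using char_poly_gc_eigenvalue[OF fiber_hermitian[OF A], of k] fiber_triangle[OF A, of k] k by simp
next
  case True
  have "char_poly (leading_submatrix A k) = (\<Prod>a\<in>#eigenvalue_mset A k. [:- a, 1:])"
    using char_poly_eq_prod_proots(1)[OF leading_submatrix_carrier[of A k]] by (simp add: eigenvalue_mset_def)
  also have "eigenvalue_mset A k = image_mset (\<lambda>i. complex_of_real (lam i)) (mset_set {1..k})"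
    using A True by (simp add: gc_fiber_def coadjoint_orbit_def)
  also have "(\<Prod>a\<in>#image_mset (\<lambda>i. complex_of_real (lam i)) (mset_set {1..k}). [:- a, 1:]) = (\<Prod>i\<in>{1..k}. [:- complex_of_real (lam i), 1:])"
    by (simp add: prod_unfold_prod_mset image_mset.compositionality o_def)
  also have "\<dots> = (\<Prod>i<k. [:- complex_of_real (lam (Suc i)), 1:])"
    by (rule prod.reindex_bij_witness[of _ Suc "\<lambda>i. i - 1"]) auto
  finally show ?thesis using True by (simp add: gc_triangle_def)
qed

text \<open>Membership is described relative to a point A of the fiber and by characteristic
  polynomials only. From here on neither sorting nor multisets of eigenvalues occur in the
  construction of charts.\<close>

lemma fiber_iff:
  fixes A X :: "'n::{finite,linorder} cmatrix"
  assumes A: "A \<in> gc_fiber lam \<Lambda>"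
  shows "X \<in> gc_fiber lam \<Lambda> \<longleftrightarrow>
    hermitian X \<and> (\<forall>k\<le>CARD('n). char_poly (leading_submatrix X k) = char_poly (leading_submatrix A k))"
proof
  assume X: "X \<in> gc_fiber lam \<Lambda>"
  then show "hermitian X \<and> (\<forall>k\<le>CARD('n). char_poly (leading_submatrix X k) = char_poly (leading_submatrix A k))"
    using fiber_char_poly[OF A] fiber_char_poly[OF X] fiber_hermitian[OF X] by simp
next
  assume X: "hermitian X \<and> (\<forall>k\<le>CARD('n). char_poly (leading_submatrix X k) = char_poly (leading_submatrix A k))"
  then have e: "eigenvalue_mset X k = eigenvalue_mset A k" if "k \<le> CARD('n)" for k
    using that by (simp add: eigenvalue_mset_def)
  have "gc_map X = gc_map A"
    unfolding gc_map_def by (rule restrict_ext) (auto simp: gc_eigenvalue_def e)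
  moreover have "X \<in> coadjoint_orbit lam" using A X e by (simp add: gc_fiber_def coadjoint_orbit_def)
  ultimately show "X \<in> gc_fiber lam \<Lambda>" using A by (simp add: gc_fiber_def)
qed

lemma fiber_row_antitone:
  fixes A :: "'n::{finite,linorder} cmatrix"
  assumes A: "A \<in> gc_fiber lam \<Lambda>" and lam: "\<And>i j. 1 \<le> i \<Longrightarrow> i \<le> j \<Longrightarrow> j \<le> CARD('n) \<Longrightarrow> lam j \<le> lam i"
    and "k \<le> CARD('n)" "i \<le> j" "j < k"
  shows "gc_triangle CARD('n) lam \<Lambda> (Suc j, k) \<le> gc_triangle CARD('n) lam \<Lambda> (Suc i, k)"
proof (cases "k = CARD('n)")
  case True
  then show ?thesis using lam[of "Suc i" "Suc j"] assms by (simp add: gc_triangle_def)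
next
  case False
  then show ?thesis
    using gc_eigenvalue_antitone[OF fiber_hermitian[OF A] assms(4,5)] fiber_triangle[OF A] assms by simp
qed

lemma fiber_diagonalises:
  fixes A :: "'n::{finite,linorder} cmatrix"
  assumes A: "A \<in> gc_fiber lam \<Lambda>" and k: "k \<le> CARD('n)"
  shows "\<exists>Q. diagonalises k (ent A) (\<lambda>i. gc_triangle CARD('n) lam \<Lambda> (Suc i, k)) Q"
proof (rule diagonalises_exists)
  show "ent A j i = cnj (ent A i j)" for i j by (rule hermitian_ent[OF fiber_hermitian[OF A]])
  show "char_poly (Matrix.mat k k (\<lambda>(i, j). ent A i j)) =
    (\<Prod>i<k. [:- complex_of_real (gc_triangle CARD('n) lam \<Lambda> (Suc i, k)), 1:])"
    using fiber_char_poly[OF A k] by (simp only: leading_submatrix_ent)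
qed

lemma fiber_interlacing:
  fixes A :: "'n::{finite,linorder} cmatrix"
  assumes A: "A \<in> gc_fiber lam \<Lambda>" and lam: "\<And>i j. 1 \<le> i \<Longrightarrow> i \<le> j \<Longrightarrow> j \<le> CARD('n) \<Longrightarrow> lam j \<le> lam i"
  shows "interlacing CARD('n) (gc_triangle CARD('n) lam \<Lambda>)"
  unfolding interlacing_def
proof (intro allI impI)
  fix i j assume ij: "1 \<le> i \<and> i \<le> j \<and> j < CARD('n)"
  let ?T = "gc_triangle CARD('n) lam \<Lambda>"
  obtain Q P where QP: "diagonalises j (ent A) (\<lambda>i. ?T (Suc i, j)) Q" "diagonalises (Suc j) (ent A) (\<lambda>i. ?T (Suc i, Suc j)) P"
    using fiber_diagonalises[OF A, of j] fiber_diagonalises[OF A, of "Suc j"] ij by auto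
  note h = hermitian_ent[OF fiber_hermitian[OF A]]
  have "?T (Suc (i - 1), j) \<le> ?T (Suc (i - 1), Suc j)"
    by (rule cauchy_interlacing_upper[OF QP h])
      (use fiber_row_antitone[OF A lam] ij in auto)
  moreover have "?T (Suc (Suc (i - 1)), Suc j) \<le> ?T (Suc (i - 1), j)"
    by (rule cauchy_interlacing_lower[OF QP h])
      (use fiber_row_antitone[OF A lam] ij in auto)
  ultimately show "?T (i + 1, j + 1) \<le> ?T (i, j) \<and> ?T (i, j) \<le> ?T (i, j + 1)" using ij by simp
qed

section \<open>Charts of the fibers\<close>

text \<open>Polynomials in H are needed only in factorised form and applied to a vector, so products
  of matrices are avoided.\<close>

primrec shift_product :: "nat \<Rightarrow> (nat \<Rightarrow> nat \<Rightarrow> complex) \<Rightarrow> real list \<Rightarrow> (nat \<Rightarrow> complex) \<Rightarrow> nat \<Rightarrow> complex" where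
  "shift_product k H [] v = v"
| "shift_product k H (m # ms) v =
    (\<lambda>i. (\<Sum>s<k. H i s * shift_product k H ms v s) - complex_of_real m * shift_product k H ms v i)"

lemma coord_cong: "(\<And>s. s < k \<Longrightarrow> v s = v' s) \<Longrightarrow> coord k Q v i = coord k Q v' i"
  by (simp add: coord_def)

lemma coord_diff_scale: "coord k Q (\<lambda>i. a i - c * b i) j = coord k Q a j - c * coord k Q b j"
  by (simp add: coord_def right_diff_distrib sum_subtractf sum_distrib_left mult.left_commute)

lemma coord_add_scale: "coord k Q (\<lambda>i. a i + c * b i) j = coord k Q a j + c * coord k Q b j"
  by (simp add: coord_def distrib_left sum.distrib sum_distrib_left mult.left_commute)

lemma coord_scale: "coord k Q (\<lambda>i. c * b i) j = c * coord k Q b j"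
  by (simp add: coord_def sum_distrib_left mult.left_commute)

lemma coord_sum: "coord k Q (\<lambda>i. \<Sum>s\<in>S. c s * w s i) j = (\<Sum>s\<in>S. c s * coord k Q (w s) j)"
  unfolding coord_def sum_distrib_left by (subst sum.swap) (simp add: mult.left_commute)

lemma coord_eq_0:
  assumes "diagonalises k H d Q" "\<And>j. j < k \<Longrightarrow> coord k Q v j = 0" "i < k"
  shows "v i = 0"
  using coord_expand[OF assms(1,3), of v] assms(2) by simp

lemma shift_product_coord:
  assumes dia: "diagonalises k H d Q" and herm: "\<And>i j. i < k \<Longrightarrow> j < k \<Longrightarrow> H j i = cnj (H i j)" and j: "j < k"
  shows "coord k Q (shift_product k H ms v) j = complex_of_real (\<Prod>m\<leftarrow>ms. d j - m) * coord k Q v j"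
proof (induction ms)
  case (Cons m ms)
  have "coord k Q (shift_product k H (m # ms) v) j =
      d j * coord k Q (shift_product k H ms v) j - m * coord k Q (shift_product k H ms v) j"
    unfolding shift_product.simps coord_diff_scale using coord_apply[OF dia herm j] by simp
  then show ?case unfolding Cons.IH by (simp add: algebra_simps)
qed simp

lemma shift_product_cong:
  assumes "\<And>i s. i < k \<Longrightarrow> s < k \<Longrightarrow> H i s = H' i s" "\<And>i. i < k \<Longrightarrow> v i = v' i" "i < k"
  shows "shift_product k H ms v i = shift_product k H' ms v' i"
  using assms(3) by (induction ms arbitrary: i) (simp_all add: assms(1,2))

lemma shift_product_sum:
  "shift_product k H ms (\<lambda>i. \<Sum>s\<in>S. c s * w s i) i = (\<Sum>s\<in>S. c s * shift_product k H ms (w s) i)"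
proof (induction ms arbitrary: i)
  case (Cons m ms)
  have "shift_product k H (m # ms) (\<lambda>i. \<Sum>s\<in>S. c s * w s i) i =
     (\<Sum>t<k. \<Sum>s\<in>S. c s * (H i t * shift_product k H ms (w s) t)) - (\<Sum>s\<in>S. c s * (m * shift_product k H ms (w s) i))"
    by (simp add: Cons.IH sum_distrib_left mult.left_commute)
  also have "(\<Sum>t<k. \<Sum>s\<in>S. c s * (H i t * shift_product k H ms (w s) t)) = (\<Sum>s\<in>S. c s * (\<Sum>t<k. H i t * shift_product k H ms (w s) t))"
    by (subst sum.swap) (simp add: sum_distrib_left)
  finally show ?case by (simp add: right_diff_distrib sum_subtractf)
qed simp

text \<open>Up to the nonzero factor \<open>Lagrange_factor\<close>, \<open>eigencomponent\<close> is the Lagrange polynomial of the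
  spectrum \<open>d\<close> at \<open>m\<close>, evaluated at \<open>H\<close> and applied to \<open>v\<close>.  It is polynomial in \<open>H\<close>, and it is the
  projection to the eigenspace when the spectrum of \<open>H\<close> is \<open>d\<close>.\<close>

definition other_values :: "nat \<Rightarrow> (nat \<Rightarrow> real) \<Rightarrow> real \<Rightarrow> real list" where
  "other_values k d m = sorted_list_of_set (d ` {..<k} - {m})"

definition Lagrange_factor :: "nat \<Rightarrow> (nat \<Rightarrow> real) \<Rightarrow> real \<Rightarrow> real" where
  "Lagrange_factor k d m = (\<Prod>m'\<leftarrow>other_values k d m. m - m')"

definition eigencomponent ::
  "nat \<Rightarrow> (nat \<Rightarrow> nat \<Rightarrow> complex) \<Rightarrow> (nat \<Rightarrow> real) \<Rightarrow> real \<Rightarrow> (nat \<Rightarrow> complex) \<Rightarrow> nat \<Rightarrow> complex" where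
  "eigencomponent k H d m v = shift_product k H (other_values k d m) v"

lemma set_other_values: "set (other_values k d m) = d ` {..<k} - {m}"
  by (simp add: other_values_def)

lemma Lagrange_factor_nonzero: "Lagrange_factor k d m \<noteq> 0"
  unfolding Lagrange_factor_def prod_list_zero_iff using set_other_values[of k d m] by auto

lemma eigencomponent_coord:
  assumes dia: "diagonalises k H d Q" and herm: "\<And>i j. i < k \<Longrightarrow> j < k \<Longrightarrow> H j i = cnj (H i j)" and j: "j < k"
  shows "coord k Q (eigencomponent k H d m v) j =
    (if d j = m then complex_of_real (Lagrange_factor k d m) * coord k Q v j else 0)"
proof (cases "d j = m")
  case False
  then have "d j \<in> set (other_values k d m)" using j by (simp add: set_other_values)
  then have "(\<Prod>m'\<leftarrow>other_values k d m. d j - m') = 0" unfolding prod_list_zero_iff by force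
  then show ?thesis using False shift_product_coord[OF dia herm j] by (simp add: eigencomponent_def)
qed (use shift_product_coord[OF dia herm j] in \<open>simp add: eigencomponent_def Lagrange_factor_def\<close>)

lemma eigencomponent_inner:
  assumes dia: "diagonalises k H d Q" and herm: "\<And>i j. i < k \<Longrightarrow> j < k \<Longrightarrow> H j i = cnj (H i j)"
  shows "(\<Sum>s<k. cnj (v s) * eigencomponent k H d m v s) =
    complex_of_real (Lagrange_factor k d m * (\<Sum>i\<in>{i\<in>{..<k}. d i = m}. (cmod (coord k Q v i))\<^sup>2))"
proof -
  have "(\<Sum>s<k. cnj (v s) * eigencomponent k H d m v s) =
     (\<Sum>j<k. cnj (coord k Q v j) * (if d j = m then complex_of_real (Lagrange_factor k d m) * coord k Q v j else 0))"
    by (subst coord_inner[OF dia]) (use eigencomponent_coord[OF dia herm] in \<open>intro sum.cong; simp\<close>)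
  also have "\<dots> = (\<Sum>j\<in>{i\<in>{..<k}. d i = m}. complex_of_real (Lagrange_factor k d m * (cmod (coord k Q v j))\<^sup>2))"
    by (intro sum.mono_neutral_cong_right) (auto simp: complex_norm_square mult_ac simp del: of_real_power)
  finally show ?thesis by (simp add: sum_distrib_left del: of_real_power)
qed

text \<open>Row i is the functional that sends v to coordinate i, in the basis Q, of the
  eigencomponent of v at \<open>d i\<close>. If Q diagonalises H, this matrix is the adjoint of Q
  with its rows scaled by nonzero Lagrange factors, hence invertible. With Q fixed it stays
  invertible for nearby H.\<close>

definition transfer_entry ::
  "nat \<Rightarrow> (nat \<Rightarrow> nat \<Rightarrow> complex) \<Rightarrow> (nat \<Rightarrow> real) \<Rightarrow> (nat \<Rightarrow> nat \<Rightarrow> complex) \<Rightarrow> nat \<Rightarrow> nat \<Rightarrow> complex" where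
  "transfer_entry k H d Q i s = coord k Q (eigencomponent k H d (d i) (\<lambda>t. of_bool (t = s))) i"

lemma transfer_apply:
  assumes "i < k"
  shows "(\<Sum>s<k. transfer_entry k H d Q i s * v s) = coord k Q (eigencomponent k H d (d i) v) i"
proof -
  have "(\<Sum>s<k. transfer_entry k H d Q i s * v s) =
      coord k Q (\<lambda>l. \<Sum>s<k. v s * eigencomponent k H d (d i) (\<lambda>t. of_bool (t = s)) l) i"
    unfolding coord_sum by (simp add: transfer_entry_def mult.commute)
  also have "\<dots> = coord k Q (eigencomponent k H d (d i) (\<lambda>l. \<Sum>s<k. v s * of_bool (l = s))) i"
    by (intro coord_cong) (simp only: eigencomponent_def shift_product_sum)
  also have "\<dots> = coord k Q (eigencomponent k H d (d i) v) i"
    unfolding eigencomponent_def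
    by (intro coord_cong shift_product_cong) (auto simp: of_bool_def if_distrib cong: if_cong)
  finally show ?thesis .
qed

lemma det_nonzero_kernel:
  fixes N :: "nat \<Rightarrow> nat \<Rightarrow> complex"
  assumes det: "det (Matrix.mat k k (\<lambda>(i, s). N i s)) \<noteq> 0" and 0: "\<And>i. i < k \<Longrightarrow> (\<Sum>s<k. N i s * v s) = 0" and s: "s < k"
  shows "v s = 0"
proof -
  let ?N = "Matrix.mat k k (\<lambda>(i, s). N i s)" let ?v = "Matrix.vec k v"
  have N: "?N \<in> carrier_mat k k" by simp
  have "?N *\<^sub>v ?v = 0\<^sub>v k"
    by (rule eq_vecI) (use 0 in \<open>auto simp: scalar_prod_def lessThan_atLeast0\<close>)
  then have "?v = 0\<^sub>v k" using det det_0_iff_vec_prod_zero[OF N] by (meson vec_carrier)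
  then have "?v $ s = 0\<^sub>v k $ s" by simp
  then show ?thesis using s by simp
qed

lemma det_transfer_nonzero:
  assumes dia: "diagonalises k H d Q" and herm: "\<And>i j. i < k \<Longrightarrow> j < k \<Longrightarrow> H j i = cnj (H i j)"
  shows "det (Matrix.mat k k (\<lambda>(i, s). transfer_entry k H d Q i s)) \<noteq> 0"
proof
  let ?N = "Matrix.mat k k (\<lambda>(i, s). transfer_entry k H d Q i s)"
  have N: "?N \<in> carrier_mat k k" by simp
  assume "det ?N = 0"
  then obtain v where v: "v \<in> carrier_vec k" "v \<noteq> 0\<^sub>v k" "?N *\<^sub>v v = 0\<^sub>v k"
    using det_0_iff_vec_prod_zero[OF N] by blast
  have "coord k Q (\<lambda>s. v $ s) i = 0" if i: "i < k" for i
  proof -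
    have "(?N *\<^sub>v v) $ i = 0" using v(3) i by simp
    then have "(\<Sum>s<k. transfer_entry k H d Q i s * v $ s) = 0"
      using i v(1) by (simp add: scalar_prod_def lessThan_atLeast0)
    then have "complex_of_real (Lagrange_factor k d (d i)) * coord k Q (\<lambda>s. v $ s) i = 0"
      using transfer_apply[OF i, of H d Q "\<lambda>s. v $ s"] eigencomponent_coord[OF dia herm i, of "d i" "\<lambda>s. v $ s"] by simp
    then show ?thesis using Lagrange_factor_nonzero by simp
  qed
  then have "v $ s = 0" if "s < k" for s using coord_eq_0[OF dia _ that, of "\<lambda>s. v $ s"] by simp
  then have "v = 0\<^sub>v k" using v(1) by (intro eq_vecI) auto
  then show False using v(2) by simp
qed

text \<open>Here \<open>Q\<close> need not diagonalise \<open>H\<close>: the eigenvectors of a base point still detect the eigencomponents of the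
  matrices near to it.\<close>

lemma weight_eq_0I:
  assumes dia: "diagonalises k H d P" and herm: "\<And>i j. i < k \<Longrightarrow> j < k \<Longrightarrow> H j i = cnj (H i j)"
    and det: "det (Matrix.mat k k (\<lambda>(i, s). transfer_entry k H d Q i s)) \<noteq> 0"
    and 0: "\<And>i. i < k \<Longrightarrow> d i = m \<Longrightarrow> coord k Q (eigencomponent k H d m (\<lambda>s. H s k)) i = 0"
  shows "weight k H d P m = 0"
proof -
  define b where "b = (\<lambda>s. H s k)"
  define u where "u = eigencomponent k H d m b"
  let ?\<kappa> = "complex_of_real (Lagrange_factor k d m)"
  have cu: "coord k P u j = (if d j = m then ?\<kappa> * coord k P b j else 0)" if "j < k" for j
    using eigencomponent_coord[OF dia herm that] by (simp add: u_def)
  have u0: "u s = 0" if "s < k" for s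
  proof (rule det_nonzero_kernel[OF det _ that])
    fix i assume i: "i < k"
    \<comment> \<open>The vector u is zero or an eigenvector for m, so its own eigencomponents are a
      multiple of u at m and 0 elsewhere. The transfer matrix therefore sees nothing of u but the
      coordinates that vanish by hypothesis.\<close>
    let ?x = "\<lambda>l. eigencomponent k H d (d i) u l - (if d i = m then ?\<kappa> else 0) * u l"
    have "?x l = 0" if l: "l < k" for l
    proof (rule coord_eq_0[OF dia _ l])
      fix j assume "j < k"
      then show "coord k P ?x j = 0"
        unfolding coord_diff_scale by (simp add: eigencomponent_coord[OF dia herm] cu)
    qed
    then have "coord k Q (eigencomponent k H d (d i) u) i = coord k Q (\<lambda>l. (if d i = m then ?\<kappa> else 0) * u l) i"
      by (intro coord_cong) simp
    also have "\<dots> = 0" unfolding coord_scale using 0[OF i] by (auto simp: u_def b_def)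
    finally show "(\<Sum>s<k. transfer_entry k H d Q i s * u s) = 0" unfolding transfer_apply[OF i] .
  qed
  have "coord k P b j = 0" if "j < k" "d j = m" for j
  proof -
    have "coord k P u j = coord k P (\<lambda>_. 0) j" using u0 by (intro coord_cong)
    then show ?thesis using cu[OF that(1)] that(2) Lagrange_factor_nonzero by (simp add: coord_def)
  qed
  then show ?thesis by (simp add: weight_def b_def)
qed

lemma eigencomponent_eq_0:
  assumes dia: "diagonalises k H d P" and herm: "\<And>i j. i < k \<Longrightarrow> j < k \<Longrightarrow> H j i = cnj (H i j)"
    and w: "weight k H d P m = 0" and s: "s < k"
  shows "eigencomponent k H d m (\<lambda>s. H s k) s = 0"
proof (rule coord_eq_0[OF dia _ s])
  fix j assume j: "j < k"
  have "\<forall>i\<in>{i\<in>{..<k}. d i = m}. (cmod (coord k P (\<lambda>s. H s k) i))\<^sup>2 = 0"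
    using w unfolding weight_def by (subst (asm) sum_nonneg_eq_0_iff) auto
  then show "coord k P (eigencomponent k H d m (\<lambda>s. H s k)) j = 0"
    using j by (simp add: eigencomponent_coord[OF dia herm j])
qed

section \<open>Index types and smoothness of functions of a matrix\<close>

lemma bij_nth_index: "bij_betw nth_index {..<CARD('n)} (UNIV :: 'n::{finite,linorder} set)"
  unfolding nth_index_def using bij_betw_nth[of "sorted_list_of_set (UNIV :: 'n set)"] by simp

definition position :: "'n::{finite,linorder} \<Rightarrow> nat" where
  "position = inv_into {..<CARD('n)} nth_index"

lemma position_nth_index: "i < CARD('n) \<Longrightarrow> position (nth_index i :: 'n::{finite,linorder}) = i"
  unfolding position_def using bij_betw_inv_into_left[OF bij_nth_index] by simp

lemma nth_index_position: "nth_index (position a) = (a :: 'n::{finite,linorder})"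
  unfolding position_def using bij_betw_inv_into_right[OF bij_nth_index] by simp

lemma position_less: "position (a :: 'n::{finite,linorder}) < CARD('n)"
  unfolding position_def using bij_betw_inv_into[OF bij_nth_index] bij_betwE by fastforce

lemma smooth_on_matrixI:
  fixes F :: "'a::euclidean_space \<Rightarrow> 'n::finite \<Rightarrow> 'n \<Rightarrow> complex"
  assumes U: "open U" and F: "\<And>i j. smooth_on U (\<lambda>X. F X i j)"
  shows "smooth_on U (\<lambda>X. vec_lambda (\<lambda>i. vec_lambda (\<lambda>j. F X i j)))"
proof -
  define E :: "'n \<Rightarrow> 'n \<Rightarrow> complex \<Rightarrow> ((complex, 'n) Finite_Cartesian_Product.vec, 'n) Finite_Cartesian_Product.vec"
    where "E i j c = vec_lambda (\<lambda>a. vec_lambda (\<lambda>b. if a = i \<and> b = j then c else 0))" for i j c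
  have E: "bounded_linear (E i j)" for i j
    unfolding linear_conv_bounded_linear[symmetric]
    by (rule linearI) (auto simp: E_def Finite_Cartesian_Product.vec_eq_iff)
  have "vec_lambda (\<lambda>i. vec_lambda (\<lambda>j. F X i j)) = (\<Sum>i\<in>UNIV. \<Sum>j\<in>UNIV. E i j (F X i j))" for X
  proof (subst Finite_Cartesian_Product.vec_eq_iff, intro allI, subst Finite_Cartesian_Product.vec_eq_iff, intro allI)
    fix a b
    have "vec_nth (vec_nth (\<Sum>i\<in>UNIV. \<Sum>j\<in>UNIV. E i j (F X i j)) a) b =
       (\<Sum>i\<in>UNIV. \<Sum>j\<in>UNIV. if a = i \<and> b = j then F X i j else 0)"
      by (simp add: E_def)
    also have "\<dots> = (\<Sum>i\<in>UNIV. \<Sum>j\<in>UNIV. if j = b then (if i = a then F X a b else 0) else 0)"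
      by (intro sum.cong refl) auto
    finally have "vec_nth (vec_nth (\<Sum>i\<in>UNIV. \<Sum>j\<in>UNIV. E i j (F X i j)) a) b = F X a b" by simp
    then show "vec_nth (vec_nth (vec_lambda (\<lambda>i. vec_lambda (\<lambda>j. F X i j))) a) b =
        vec_nth (vec_nth (\<Sum>i\<in>UNIV. \<Sum>j\<in>UNIV. E i j (F X i j)) a) b"
      by simp
  qed
  then show ?thesis
    by (simp only:) (intro smooth_on_sum[OF U] smooth_on_linear_compose[OF U E] F)
qed

lemma bounded_linear_ent: "bounded_linear (\<lambda>X. ent X i j)"
  unfolding ent_def by (intro bounded_linear_compose[OF bounded_linear_vec_nth] bounded_linear_vec_nth)

lemma smooth_on_ent: "smooth_on UNIV (\<lambda>X. ent X i j)"
  by (rule smooth_on_linear[OF open_UNIV bounded_linear_ent])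

lemma smooth_on_mult:
  "smooth_on UNIV f \<Longrightarrow> smooth_on UNIV g \<Longrightarrow> smooth_on UNIV (\<lambda>x. f x * g x :: complex)"
  by (rule smooth_on_bilinear[OF open_UNIV bounded_bilinear_mult])

lemma smooth_on_if: "smooth_on U f \<Longrightarrow> smooth_on U g \<Longrightarrow> smooth_on U (\<lambda>x. if P then f x else g x)"
  by (cases P) simp_all

lemma smooth_on_shift_product:
  assumes "\<And>i. smooth_on UNIV (\<lambda>X. v X i)"
  shows "smooth_on UNIV (\<lambda>X. shift_product k (ent X) ms (v X) i)"
proof (induction ms arbitrary: i)
  case (Cons m ms)
  then show ?case
    by (simp add: smooth_on_diff smooth_on_sum smooth_on_mult smooth_on_ent smooth_on_const)
qed (simp add: assms)

lemma smooth_on_coord: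
  assumes "\<And>i. smooth_on UNIV (\<lambda>X. v X i)"
  shows "smooth_on UNIV (\<lambda>X. coord k Q (v X) i)"
  unfolding coord_def by (intro smooth_on_sum[OF open_UNIV] smooth_on_mult smooth_on_const assms)

lemma continuous_on_det:
  fixes N :: "'a::topological_space \<Rightarrow> nat \<Rightarrow> nat \<Rightarrow> complex"
  assumes "\<And>i j. continuous_on S (\<lambda>X. N X i j)"
  shows "continuous_on S (\<lambda>X. det (Matrix.mat k k (\<lambda>(i, j). N X i j)))"
proof -
  have e: "det (Matrix.mat k k (\<lambda>(i, j). N X i j)) =
      (\<Sum>p\<in>{p. p permutes {0..<k}}. signof p * (\<Prod>i = 0..<k. N X i (p i)))" for X
  proof -
    have "det (Matrix.mat k k (\<lambda>(i, j). N X i j)) =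
      (\<Sum>p\<in>{p. p permutes {0..<k}}. signof p * (\<Prod>i = 0..<k. Matrix.mat k k (\<lambda>(i, j). N X i j) $$ (i, p i)))"
      by (rule det_def') simp
    also have "\<dots> = (\<Sum>p\<in>{p. p permutes {0..<k}}. signof p * (\<Prod>i = 0..<k. N X i (p i)))"
    proof (intro sum.cong refl arg_cong2[of _ _ _ _ "(*)"] prod.cong)
      fix p i assume "p \<in> {p. p permutes {0..<k}}" "i \<in> {0..<k}"
      then show "Matrix.mat k k (\<lambda>(i, j). N X i j) $$ (i, p i) = N X i (p i)"
        using permutes_in_image[of p "{0..<k}" i] by auto
    qed
    finally show ?thesis .
  qed
  show ?thesis
    unfolding e by (intro continuous_on_sum continuous_on_mult continuous_on_prod continuous_on_const assms)
qed

section \<open>The chart at a point of the fiber\<close>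

locale gc_chart =
  fixes A :: "'n::{finite,linorder} cmatrix" and d :: "nat \<Rightarrow> nat \<Rightarrow> real" and Q :: "nat \<Rightarrow> nat \<Rightarrow> nat \<Rightarrow> complex"
  assumes hermA: "hermitian A"
    and diaA: "\<And>k. k < CARD('n) \<Longrightarrow> diagonalises k (ent A) (d k) (Q k)"
    and cpA: "\<And>k. k \<le> CARD('n) \<Longrightarrow>
      char_poly (Matrix.mat k k (\<lambda>(i, j). ent A i j)) = (\<Prod>i<k. [:- complex_of_real (d k i), 1:])"
begin

definition colweight :: "nat \<Rightarrow> real \<Rightarrow> real" where
  "colweight k m = weight k (ent A) (d k) (Q k) m"

definition basecoord :: "nat \<Rightarrow> nat \<Rightarrow> complex" where
  "basecoord k i = coord k (Q k) (\<lambda>s. ent A s k) i"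

text \<open>The Lagrange polynomial is evaluated at X, but the coordinate is taken in the fixed
  eigenbasis of the base point; so this is polynomial in the entries of X.\<close>

definition colcoord :: "'n cmatrix \<Rightarrow> nat \<Rightarrow> nat \<Rightarrow> complex" where
  "colcoord X k i = coord k (Q k) (eigencomponent k (ent X) (d k) (d k i) (\<lambda>s. ent X s k)) i"

text \<open>Equals the Lagrange factor times the weight if X is Hermitian and its k-th leading block
  has the spectrum \<open>d k\<close>. Its real part is the equation of the sphere.\<close>

definition colform :: "'n cmatrix \<Rightarrow> nat \<Rightarrow> real \<Rightarrow> complex" where
  "colform X k m = (\<Sum>s<k. cnj (ent X s k) * eigencomponent k (ent X) (d k) m (\<lambda>s. ent X s k) s)"

text \<open>A coordinate that is nonzero at the base point. The radius of the sphere then has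
  nonzero derivative along this coordinate, so the sphere equation can replace one real coordinate
  there.\<close>

definition pivot :: "nat \<Rightarrow> real \<Rightarrow> nat" where
  "pivot k m = (SOME i. i < k \<and> d k i = m \<and> basecoord k i \<noteq> 0)"

lemma pivot:
  assumes "colweight k m \<noteq> 0"
  shows "pivot k m < k" "d k (pivot k m) = m" "basecoord k (pivot k m) \<noteq> 0"
proof -
  have "\<exists>i. i < k \<and> d k i = m \<and> basecoord k i \<noteq> 0"
  proof (rule ccontr)
    assume "\<not> ?thesis"
    then have "colweight k m = 0"
      unfolding colweight_def weight_def basecoord_def[symmetric] by (intro sum.neutral) auto
    then show False using assms by simp
  qed
  then have "pivot k m < k \<and> d k (pivot k m) = m \<and> basecoord k (pivot k m) \<noteq> 0"
    unfolding pivot_def by (rule someI_ex)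
  then show "pivot k m < k" "d k (pivot k m) = m" "basecoord k (pivot k m) \<noteq> 0" by auto
qed

text \<open>The entries of the chart.  On and below the diagonal they express that the matrix is Hermitian with
  the right diagonal.  In the column \<open>k\<close>, an eigenvalue \<open>m\<close> of the \<open>k\<close>-th leading block with zero weight gives
  the equations \<open>colcoord = 0\<close>; otherwise the only equation is that the weight (the squared radius of a
  sphere) is right, which is the real part of the pivot entry.\<close>

definition chart_entry :: "'n cmatrix \<Rightarrow> nat \<Rightarrow> nat \<Rightarrow> complex" where
  "chart_entry X i k =
    (if k < i then ent X i k - cnj (ent X k i)
     else if i = k then ent X k k - ent A k k
     else if colweight k (d k i) \<noteq> 0 \<and> i = pivot k (d k i)
     then Complex (Re (colform X k (d k i)) - Lagrange_factor k (d k) (d k i) * colweight k (d k i))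
            (Im (cnj (basecoord k i) * colcoord X k i))
     else colcoord X k i)"

definition chart :: "'n cmatrix \<Rightarrow> 'n cmatrix" where
  "chart X = vec_lambda (\<lambda>a. vec_lambda (\<lambda>b. chart_entry X (position a) (position b)))"

lemma ent_chart: "i < CARD('n) \<Longrightarrow> j < CARD('n) \<Longrightarrow> ent (chart X) i j = chart_entry X i j"
  by (simp add: ent_def chart_def position_nth_index)

lemma smooth_on_eigencomponent:
  assumes "\<And>i. smooth_on UNIV (\<lambda>X. v X i)"
  shows "smooth_on UNIV (\<lambda>X. eigencomponent k (ent X) d' m (v X) i)"
  unfolding eigencomponent_def by (rule smooth_on_shift_product[OF assms])

lemma smooth_on_chart: "smooth_on UNIV chart"
proof -
  have y: "smooth_on UNIV (\<lambda>X. colcoord X k i)" for k i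
    unfolding colcoord_def by (intro smooth_on_coord smooth_on_eigencomponent smooth_on_ent)
  have cnj: "smooth_on UNIV (\<lambda>X. cnj (ent X i j))" for i j
    by (intro smooth_on_linear_compose[OF open_UNIV bounded_linear_cnj] smooth_on_ent)
  have N: "smooth_on UNIV (\<lambda>X. colform X k m)" for k m
    unfolding colform_def
    by (intro smooth_on_sum[OF open_UNIV] smooth_on_mult smooth_on_eigencomponent smooth_on_ent cnj)
  have C: "smooth_on UNIV (\<lambda>X. Complex (Re (f X) - r) (Im (c * g X)))"
    if "smooth_on UNIV f" "smooth_on UNIV g" for f g :: "'n cmatrix \<Rightarrow> complex" and r c
  proof -
    have 1: "bounded_linear (\<lambda>z. complex_of_real (Re z))"
      by (intro bounded_linear_compose[OF bounded_linear_of_real bounded_linear_Re])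
    have 2: "bounded_linear (\<lambda>z. complex_of_real (Im z))"
      by (intro bounded_linear_compose[OF bounded_linear_of_real bounded_linear_Im])
    have "Complex (Re (f X) - r) (Im (c * g X)) =
        (complex_of_real (Re (f X)) - complex_of_real r) + \<i> * complex_of_real (Im (c * g X))" for X
      by (simp add: complex_eq_iff)
    then show ?thesis
      by (simp only:) (intro smooth_on_add[OF open_UNIV] smooth_on_diff[OF open_UNIV] smooth_on_mult smooth_on_const
          smooth_on_linear_compose[OF open_UNIV 1] smooth_on_linear_compose[OF open_UNIV 2] that)
  qed
  have "smooth_on UNIV (\<lambda>X. chart_entry X i k)" for i k
    unfolding chart_entry_def
    by (intro smooth_on_if C N y smooth_on_diff[OF open_UNIV] smooth_on_ent cnj smooth_on_const)
  then show ?thesis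
    unfolding chart_def by (intro smooth_on_matrixI[OF open_UNIV])
qed

text \<open>The neighbourhood of A on which vanishing coordinates in the eigenbases of A still imply
  vanishing eigencomponents.\<close>

definition nondegenerate :: "'n cmatrix set" where
  "nondegenerate = {X. \<forall>k<CARD('n). det (Matrix.mat k k (\<lambda>(i, s). transfer_entry k (ent X) (d k) (Q k) i s)) \<noteq> 0}"

lemma open_nondegenerate: "open nondegenerate"
proof -
  have "continuous_on UNIV (\<lambda>X. transfer_entry k (ent X) (d k) (Q k) i s)" for k i s
    unfolding transfer_entry_def
    by (intro smooth_on_continuous_on smooth_on_coord smooth_on_eigencomponent smooth_on_const)
  then have c: "continuous_on UNIV (\<lambda>X. det (Matrix.mat k k (\<lambda>(i, s). transfer_entry k (ent X) (d k) (Q k) i s)))" for k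
    by (intro continuous_on_det)
  have "nondegenerate = (\<Inter>k\<in>{..<CARD('n)}. {X. det (Matrix.mat k k (\<lambda>(i, s). transfer_entry k (ent X) (d k) (Q k) i s)) \<noteq> 0})"
    by (auto simp: nondegenerate_def)
  moreover have "open {X. det (Matrix.mat k k (\<lambda>(i, s). transfer_entry k (ent X) (d k) (Q k) i s)) \<noteq> 0}" for k
    by (rule open_Collect_neq[OF c continuous_on_const])
  ultimately show ?thesis by auto
qed

lemma A_nondegenerate: "A \<in> nondegenerate"
  unfolding nondegenerate_def
proof (intro CollectI allI impI)
  fix k assume k: "k < CARD('n)"
  show "det (Matrix.mat k k (\<lambda>(i, s). transfer_entry k (ent A) (d k) (Q k) i s)) \<noteq> 0"
    by (rule det_transfer_nonzero[OF diaA[OF k]]) (rule hermitian_ent[OF hermA])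
qed

text \<open>The linear slice of the chart. The radius uses up the real part at a pivot, which leaves
  2a - 1 real coordinates for each value of multiplicity a and nonzero weight.\<close>

definition model :: "'n cmatrix set" where
  "model = {Y. \<forall>i<CARD('n). \<forall>k<CARD('n).
     (k \<le> i \<longrightarrow> ent Y i k = 0) \<and>
     (i < k \<longrightarrow> colweight k (d k i) = 0 \<longrightarrow> ent Y i k = 0) \<and>
     (i < k \<longrightarrow> colweight k (d k i) \<noteq> 0 \<longrightarrow> i = pivot k (d k i) \<longrightarrow> Re (ent Y i k) = 0)}"

lemma chart_in_model:
  assumes herm: "hermitian X"
    and cp: "\<And>k. k \<le> CARD('n) \<Longrightarrow> char_poly (Matrix.mat k k (\<lambda>(i, j). ent X i j)) = char_poly (Matrix.mat k k (\<lambda>(i, j). ent A i j))"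
  shows "chart X \<in> model"
proof -
  note hX = hermitian_ent[OF herm] and hA = hermitian_ent[OF hermA]
  have w: "\<exists>P. diagonalises k (ent X) (d k) P \<and> ent X k k = ent A k k \<and> (\<forall>m\<in>d k ` {..<k}. weight k (ent X) (d k) P m = colweight k m)"
    if k: "k < CARD('n)" for k
  proof -
    have cX: "char_poly (Matrix.mat k k (\<lambda>(i, j). ent X i j)) = (\<Prod>i<k. [:- complex_of_real (d k i), 1:])"
      using cp[of k] cpA[of k] k by simp
    obtain P where P: "diagonalises k (ent X) (d k) P"
      using diagonalises_exists[of k "ent X" "d k", OF hX cX] by blast
    have e: "char_poly (Matrix.mat (Suc k) (Suc k) (\<lambda>(i, j). ent X i j)) = char_poly (Matrix.mat (Suc k) (Suc k) (\<lambda>(i, j). ent A i j))"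
      using cp[of "Suc k"] k by simp
    show ?thesis
      using char_poly_bordered_eq_iff[OF P diaA[OF k] hX hA cX cpA] e k P by (auto simp: colweight_def)
  qed
  show ?thesis
    unfolding model_def
  proof (intro CollectI allI impI conjI)
    fix i k assume ik: "i < CARD('n)" "k < CARD('n)"
    obtain P where P: "diagonalises k (ent X) (d k) P" "ent X k k = ent A k k"
      "\<And>m. m \<in> d k ` {..<k} \<Longrightarrow> weight k (ent X) (d k) P m = colweight k m" using w[OF ik(2)] by blast
    show "ent (chart X) i k = 0" if "k \<le> i"
    proof (cases "k < i")
      case True
      then show ?thesis using hX[of i k] by (simp add: ent_chart ik chart_entry_def)
    next
      case False
      then show ?thesis using that P(2) by (simp add: ent_chart ik chart_entry_def)
    qed
    show "ent (chart X) i k = 0" if i: "i < k" and 0: "colweight k (d k i) = 0"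
    proof -
      have "weight k (ent X) (d k) P (d k i) = 0" using P(3)[of "d k i"] i 0 by auto
      then have "eigencomponent k (ent X) (d k) (d k i) (\<lambda>s. ent X s k) s = 0" if "s < k" for s
        using eigencomponent_eq_0[OF P(1) hX _ that] by blast
      then have "colcoord X k i = 0" by (simp add: colcoord_def coord_def)
      then show ?thesis using i 0 by (simp add: ent_chart ik chart_entry_def)
    qed
    show "Re (ent (chart X) i k) = 0" if i: "i < k" and n0: "colweight k (d k i) \<noteq> 0" and p: "i = pivot k (d k i)"
    proof -
      have "colform X k (d k i) = complex_of_real (Lagrange_factor k (d k) (d k i) * weight k (ent X) (d k) P (d k i))"
        unfolding colform_def weight_def by (rule eigencomponent_inner[OF P(1) hX])
      then have "Re (colform X k (d k i)) = Lagrange_factor k (d k) (d k i) * colweight k (d k i)"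
        using P(3)[of "d k i"] i by simp
      then show ?thesis using i n0 p by (simp add: ent_chart ik chart_entry_def)
    qed
  qed
qed

text \<open>The equations of column k determine the weights only when the k-th leading block is
  Hermitian and has the spectrum \<open>d k\<close>. So the Hermitian symmetry comes first, then the
  characteristic polynomials by induction on k.\<close>

lemma chart_in_modelD:
  assumes X: "X \<in> nondegenerate" and model: "chart X \<in> model"
  shows "hermitian X"
    and "k \<le> CARD('n) \<Longrightarrow> char_poly (Matrix.mat k k (\<lambda>(i, j). ent X i j)) = char_poly (Matrix.mat k k (\<lambda>(i, j). ent A i j))"
proof -
  note hA = hermitian_ent[OF hermA]
  have m: "k \<le> i \<Longrightarrow> chart_entry X i k = 0"
    "i < k \<Longrightarrow> colweight k (d k i) = 0 \<Longrightarrow> chart_entry X i k = 0"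
    "i < k \<Longrightarrow> colweight k (d k i) \<noteq> 0 \<Longrightarrow> i = pivot k (d k i) \<Longrightarrow> Re (chart_entry X i k) = 0"
    if "i < CARD('n)" "k < CARD('n)" for i k
    using model that unfolding model_def by (auto simp: ent_chart)
  have diag: "ent X k k = ent A k k" if "k < CARD('n)" for k
    using m(1)[OF that that] by (simp add: chart_entry_def)
  have low: "ent X i k = cnj (ent X k i)" if "i < CARD('n)" "k < CARD('n)" for i k
  proof -
    consider "k < i" | "i < k" | "i = k" by linarith
    then show ?thesis
    proof cases
      case 1 then show ?thesis using m(1)[OF that] by (simp add: chart_entry_def)
    next
      case 2 then show ?thesis using m(1)[OF that(2,1)] by (simp add: chart_entry_def)
    next
      case 3
      have "ent A k k = cnj (ent A k k)" by (rule hA)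
      then show ?thesis using diag that 3 by simp
    qed
  qed
  show herm: "hermitian X"
    unfolding hermitian_def
  proof (intro allI)
    fix a b :: 'n
    show "vec_nth (vec_nth X a) b = cnj (vec_nth (vec_nth X b) a)"
      using low[OF position_less[of a] position_less[of b]] by (simp add: ent_def nth_index_position)
  qed
  note hX = hermitian_ent[OF herm]
  show "char_poly (Matrix.mat k k (\<lambda>(i, j). ent X i j)) = char_poly (Matrix.mat k k (\<lambda>(i, j). ent A i j))"
    if "k \<le> CARD('n)"
    using that
  proof (induction k)
    case 0
    have "Matrix.mat 0 0 (\<lambda>(i, j). ent X i j) = Matrix.mat 0 0 (\<lambda>(i, j). ent A i j)" by (rule eq_matI) auto
    then show ?case by simp
  next
    case (Suc k)
    then have k: "k < CARD('n)" by simp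
    have cX: "char_poly (Matrix.mat k k (\<lambda>(i, j). ent X i j)) = (\<Prod>i<k. [:- complex_of_real (d k i), 1:])"
      using Suc cpA[of k] by simp
    obtain P where P: "diagonalises k (ent X) (d k) P"
      using diagonalises_exists[of k "ent X" "d k", OF hX cX] by blast
    have "weight k (ent X) (d k) P m = colweight k m" if "m \<in> d k ` {..<k}" for m
    proof (cases "colweight k m = 0")
      case True
      have "weight k (ent X) (d k) P m = 0"
      proof (rule weight_eq_0I[OF P hX])
        show "det (Matrix.mat k k (\<lambda>(i, s). transfer_entry k (ent X) (d k) (Q k) i s)) \<noteq> 0"
          using X k by (simp add: nondegenerate_def)
        fix i assume i: "i < k" "d k i = m"
        then have "chart_entry X i k = 0" using m(2)[of i k] k True by auto
        then show "coord k (Q k) (eigencomponent k (ent X) (d k) m (\<lambda>s. ent X s k)) i = 0"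
          using i True by (simp add: chart_entry_def colcoord_def)
      qed
      then show ?thesis using True by simp
    next
      case False
      have p: "pivot k m < k" "d k (pivot k m) = m" using pivot[OF False] by auto
      have "Re (chart_entry X (pivot k m) k) = 0" using m(3)[of "pivot k m" k] p k False by auto
      then have "Re (colform X k m) = Lagrange_factor k (d k) m * colweight k m"
        using p False by (simp add: chart_entry_def)
      moreover have "colform X k m = complex_of_real (Lagrange_factor k (d k) m * weight k (ent X) (d k) P m)"
        unfolding colform_def weight_def by (rule eigencomponent_inner[OF P hX])
      ultimately show ?thesis using Lagrange_factor_nonzero[of k "d k" m] by simp
    qed
    then show ?case
      using char_poly_bordered_eq_iff[OF P diaA[OF k] hX hA cX cpA] diag[OF k] k by (auto simp: colweight_def)
  qed
qed

end

section \<open>Injectivity of the derivative\<close>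

lemma affine_derivative_0D:
  fixes a b :: complex
  assumes "((\<lambda>t::real. a + complex_of_real t * b) has_vector_derivative 0) (at 0)"
  shows "b = 0"
proof -
  have "((\<lambda>t::real. a + complex_of_real t * b) has_vector_derivative b) (at 0)"
    by (auto intro!: derivative_eq_intros)
  then show ?thesis using assms vector_derivative_unique_at by blast
qed

lemma quadratic_derivative_0D:
  fixes a b c :: real
  assumes "((\<lambda>t::real. a + t * b + t\<^sup>2 * c) has_vector_derivative 0) (at 0)"
  shows "b = 0"
proof -
  have "((\<lambda>t::real. a + t * b + t\<^sup>2 * c) has_vector_derivative b) (at 0)"
    unfolding has_real_derivative_iff_has_vector_derivative[symmetric]
    by (auto intro!: derivative_eq_intros)
  then show ?thesis using assms vector_derivative_unique_at by blast
qed

lemma cmod_add_scaled_square: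
  "(cmod (b + complex_of_real t * c))\<^sup>2 = (cmod b)\<^sup>2 + t * (2 * Re (cnj b * c)) + t\<^sup>2 * (cmod c)\<^sup>2"
  unfolding cmod_power2 by (simp add: power2_eq_square algebra_simps)

context gc_chart
begin

text \<open>The chart is restricted to the line A + t h, so that only derivatives in the real
  variable t are computed. The induction enlarges the leading block on which h is known to vanish;
  while it vanishes there, only the next column moves with t.\<close>

lemma chart_derivative_injective:
  assumes h: "frechet_derivative chart (at A) h = 0"
  shows "h = 0"
proof -
  let ?X = "\<lambda>t::real. A + t *\<^sub>R h"
  have entX: "ent (?X t) i j = ent A i j + complex_of_real t * ent h i j" for t i j
    unfolding ent_def by (simp add: scaleR_conv_of_real[where 'a = complex])
  have E: "((\<lambda>t. chart_entry (?X t) i k) has_vector_derivative 0) (at 0)" if "i < CARD('n)" "k < CARD('n)" for i k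
  proof -
    have "(chart has_derivative frechet_derivative chart (at A)) (at (?X 0))"
      using smooth_on_differentiable[OF smooth_on_chart, of A] by (simp add: frechet_derivative_works)
    moreover have "(?X has_derivative (\<lambda>t. t *\<^sub>R h)) (at 0)"
      by (auto intro!: derivative_eq_intros)
    ultimately have "((\<lambda>t. chart (?X t)) has_derivative (\<lambda>t. frechet_derivative chart (at A) (t *\<^sub>R h))) (at 0)"
      using has_derivative_compose[of ?X "\<lambda>t. t *\<^sub>R h" 0 UNIV chart] by simp
    then have "((\<lambda>t. ent (chart (?X t)) i k) has_derivative (\<lambda>t. ent (frechet_derivative chart (at A) (t *\<^sub>R h)) i k)) (at 0)"
      by (rule bounded_linear.has_derivative[OF bounded_linear_ent])
    moreover have "frechet_derivative chart (at A) (t *\<^sub>R h) = 0" for t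
      using linear_frechet_derivative[OF smooth_on_differentiable[OF smooth_on_chart, of A]] h
      by (simp add: linear_scale)
    ultimately show ?thesis
      by (simp add: ent_chart that has_vector_derivative_def linear_0[OF bounded_linear.linear[OF bounded_linear_ent]])
  qed
  have diag: "ent h k k = 0" if k: "k < CARD('n)" for k
  proof (rule affine_derivative_0D)
    show "((\<lambda>t. 0 + complex_of_real t * ent h k k) has_vector_derivative 0) (at 0)"
      using E[OF k k] by (simp add: chart_entry_def entX)
  qed
  have low: "ent h i k = cnj (ent h k i)" if ik: "k < i" "i < CARD('n)" for i k
  proof -
    have "ent h i k - cnj (ent h k i) = 0"
    proof (rule affine_derivative_0D)
      have "(\<lambda>t. chart_entry (?X t) i k) = (\<lambda>t. (ent A i k - cnj (ent A k i)) + complex_of_real t * (ent h i k - cnj (ent h k i)))"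
        using ik by (simp add: chart_entry_def entX fun_eq_iff algebra_simps)
      then show "((\<lambda>t. (ent A i k - cnj (ent A k i)) + complex_of_real t * (ent h i k - cnj (ent h k i))) has_vector_derivative 0) (at 0)"
        using E[of i k] ik by simp
    qed
    then show ?thesis by (simp only: right_minus_eq)
  qed
  have "k \<le> CARD('n) \<Longrightarrow> i < k \<Longrightarrow> j < k \<Longrightarrow> ent h i j = 0" for k i j
  proof (induction k arbitrary: i j)
    case (Suc k)
    then have k: "k < CARD('n)" and IH: "\<And>i j. i < k \<Longrightarrow> j < k \<Longrightarrow> ent h i j = 0" by auto
    note dia = diaA[OF k] and hA = hermitian_ent[OF hermA]
    define c where "c = coord k (Q k) (\<lambda>s. ent h s k)"
    let ?\<kappa> = "\<lambda>m. Lagrange_factor k (d k) m"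
    have b: "coord k (Q k) (\<lambda>s. ent A s k + complex_of_real t * ent h s k) i = basecoord k i + complex_of_real t * c i" for t i
      by (simp add: coord_add_scale basecoord_def c_def)
    \<comment> \<open>By the induction hypothesis the k-th leading block does not depend on t, so
      the Lagrange polynomials are those of A, for which they act as scaled
      eigenprojections.\<close>
    have ec: "eigencomponent k (ent (?X t)) (d k) m (\<lambda>s. ent (?X t) s k) s =
        eigencomponent k (ent A) (d k) m (\<lambda>s. ent A s k + complex_of_real t * ent h s k) s" if "s < k" for t m s
      unfolding eigencomponent_def by (rule shift_product_cong[OF _ _ that]) (simp_all add: entX IH)
    have y: "colcoord (?X t) k i = ?\<kappa> (d k i) * (basecoord k i + complex_of_real t * c i)" if "i < k" for t i
    proof -
      have "colcoord (?X t) k i = coord k (Q k) (eigencomponent k (ent A) (d k) (d k i) (\<lambda>s. ent A s k + complex_of_real t * ent h s k)) i"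
        unfolding colcoord_def by (rule coord_cong) (rule ec)
      also have "\<dots> = ?\<kappa> (d k i) * (basecoord k i + complex_of_real t * c i)"
        using eigencomponent_coord[OF dia hA that] by (simp add: b)
      finally show ?thesis .
    qed
    have N: "colform (?X t) k m = complex_of_real (?\<kappa> m * (\<Sum>i\<in>{i\<in>{..<k}. d k i = m}. (cmod (basecoord k i + complex_of_real t * c i))\<^sup>2))" for t m
    proof -
      have "colform (?X t) k m = (\<Sum>s<k. cnj (ent A s k + complex_of_real t * ent h s k) *
          eigencomponent k (ent A) (d k) m (\<lambda>s. ent A s k + complex_of_real t * ent h s k) s)"
        unfolding colform_def
      proof (intro sum.cong refl)
        fix s assume "s \<in> {..<k}"
        then have s: "s < k" by simp
        show "cnj (ent (?X t) s k) * eigencomponent k (ent (?X t)) (d k) m (\<lambda>s. ent (?X t) s k) s =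
          cnj (ent A s k + complex_of_real t * ent h s k) *
          eigencomponent k (ent A) (d k) m (\<lambda>s. ent A s k + complex_of_real t * ent h s k) s"
          unfolding ec[OF s] by (simp only: entX)
      qed
      also have "\<dots> = complex_of_real (?\<kappa> m * (\<Sum>i\<in>{i\<in>{..<k}. d k i = m}. (cmod (basecoord k i + complex_of_real t * c i))\<^sup>2))"
        unfolding eigencomponent_inner[OF dia hA] b ..
      finally show ?thesis .
    qed
    have c1: "c i = 0" if i: "i < k" and np: "\<not> (colweight k (d k i) \<noteq> 0 \<and> i = pivot k (d k i))" for i
    proof -
      have "complex_of_real (?\<kappa> (d k i)) * c i = 0"
      proof (rule affine_derivative_0D)
        have "(\<lambda>t. chart_entry (?X t) i k) = (\<lambda>t. ?\<kappa> (d k i) * basecoord k i + complex_of_real t * (?\<kappa> (d k i) * c i))"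
          unfolding chart_entry_def if_not_P[OF np] using i by (simp add: y fun_eq_iff algebra_simps)
        then show "((\<lambda>t. ?\<kappa> (d k i) * basecoord k i + complex_of_real t * (?\<kappa> (d k i) * c i)) has_vector_derivative 0) (at 0)"
          using E[of i k] i k by simp
      qed
      then show ?thesis using Lagrange_factor_nonzero by simp
    qed
    have c2: "c i = 0" if i: "i < k" for i
    proof (cases "colweight k (d k i) \<noteq> 0 \<and> i = pivot k (d k i)")
      case True
      define m where "m = d k i"
      let ?I = "{j\<in>{..<k}. d k j = m}"
      have w0: "colweight k m \<noteq> 0" and p: "i = pivot k m" using True by (auto simp: m_def)
      have bi: "basecoord k i \<noteq> 0" using pivot(3)[OF w0] p by simp
      \<comment> \<open>The other coordinates for the eigenvalue m are not pivots and are settled by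
        \<open>c1\<close>; their share R of the radius is therefore constant in t.\<close>
      have oth: "c j = 0" if "j \<in> ?I - {i}" for j using that p c1[of j] by auto
      define R where "R = (\<Sum>j\<in>?I - {i}. (cmod (basecoord k j))\<^sup>2)"
      have S: "(\<Sum>j\<in>?I. (cmod (basecoord k j + complex_of_real t * c j))\<^sup>2) =
          (cmod (basecoord k i + complex_of_real t * c i))\<^sup>2 + R" for t
      proof -
        have "(\<Sum>j\<in>?I. (cmod (basecoord k j + complex_of_real t * c j))\<^sup>2) =
          (cmod (basecoord k i + complex_of_real t * c i))\<^sup>2 + (\<Sum>j\<in>?I - {i}. (cmod (basecoord k j + complex_of_real t * c j))\<^sup>2)"
          by (rule sum.remove) (use i m_def in auto)
        also have "(\<Sum>j\<in>?I - {i}. (cmod (basecoord k j + complex_of_real t * c j))\<^sup>2) = R"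
          unfolding R_def by (intro sum.cong refl) (simp add: oth)
        finally show ?thesis .
      qed
      have entry: "chart_entry (?X t) i k = Complex
         (?\<kappa> m * ((cmod (basecoord k i + complex_of_real t * c i))\<^sup>2 + R) - ?\<kappa> m * colweight k m)
         (Im (cnj (basecoord k i) * (?\<kappa> m * (basecoord k i + complex_of_real t * c i))))" for t
      proof -
        have i': "\<not> k < i" "i \<noteq> k" using i by auto
        show ?thesis
          unfolding chart_entry_def if_not_P[OF i'(1)] if_not_P[OF i'(2)] y[OF i] N m_def[symmetric] S
            Re_complex_of_real if_P[OF True[folded m_def]] ..
      qed
      have Ei: "((\<lambda>t. chart_entry (?X t) i k) has_vector_derivative 0) (at 0)" using E[of i k] i k by simp
      let ?z = "cnj (basecoord k i) * c i"
      \<comment> \<open>The real part of the pivot entry gives the radial derivative Re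
        \<open>?z\<close>, the imaginary part gives Im \<open>?z\<close>. Together they yield
        \<open>?z\<close> = 0, and \<open>basecoord k i\<close> is nonzero by the choice of the
        pivot.\<close>
      have "?\<kappa> m * (2 * Re ?z) = 0"
      proof (rule quadratic_derivative_0D)
        have "(\<lambda>t. Re (chart_entry (?X t) i k)) = (\<lambda>t. (?\<kappa> m * ((cmod (basecoord k i))\<^sup>2 + R) - ?\<kappa> m * colweight k m)
            + t * (?\<kappa> m * (2 * Re ?z)) + t\<^sup>2 * (?\<kappa> m * (cmod (c i))\<^sup>2))"
          unfolding entry cmod_add_scaled_square by (simp add: fun_eq_iff algebra_simps)
        moreover have "((\<lambda>t. Re (chart_entry (?X t) i k)) has_vector_derivative Re 0) (at 0)"
          by (rule bounded_linear.has_vector_derivative[OF bounded_linear_Re Ei])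
        ultimately show "((\<lambda>t. (?\<kappa> m * ((cmod (basecoord k i))\<^sup>2 + R) - ?\<kappa> m * colweight k m)
            + t * (?\<kappa> m * (2 * Re ?z)) + t\<^sup>2 * (?\<kappa> m * (cmod (c i))\<^sup>2)) has_vector_derivative 0) (at 0)" by simp
      qed
      moreover have "?\<kappa> m * Im ?z = 0"
      proof (rule quadratic_derivative_0D)
        have "(\<lambda>t. Im (chart_entry (?X t) i k)) = (\<lambda>t. 0 + t * (?\<kappa> m * Im ?z) + t\<^sup>2 * 0)"
          unfolding entry by (simp add: fun_eq_iff algebra_simps)
        moreover have "((\<lambda>t. Im (chart_entry (?X t) i k)) has_vector_derivative Im 0) (at 0)"
          by (rule bounded_linear.has_vector_derivative[OF bounded_linear_Im Ei])
        ultimately show "((\<lambda>t. 0 + t * (?\<kappa> m * Im ?z) + t\<^sup>2 * 0) has_vector_derivative 0) (at 0)" by simp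
      qed
      ultimately have "?z = 0" using Lagrange_factor_nonzero by (simp add: complex_eq_iff)
      then show ?thesis using bi by simp
    qed (use c1[OF i] in blast)
    have col: "ent h s k = 0" if "s < k" for s
      by (rule coord_eq_0[OF dia _ that, of "\<lambda>s. ent h s k"]) (use c2 in \<open>simp add: c_def\<close>)
    consider "i < k" "j < k" | "i < k" "j = k" | "i = k" "j < k" | "i = k" "j = k" using Suc.prems by linarith
    then show ?case
    proof cases
      case 3
      then show ?thesis using low[of j k] col[of j] k by simp
    qed (use IH col diag k in auto)
  qed simp
  then have "ent h (position a) (position b) = 0" for a b :: 'n using position_less by blast
  then show "h = 0" by (simp add: ent_def nth_index_position Finite_Cartesian_Product.vec_eq_iff)
qed

section \<open>The dimension of the model\<close>

definition unit_matrix :: "nat \<times> nat \<times> complex \<Rightarrow> 'n cmatrix" where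
  "unit_matrix = (\<lambda>(i, k, u). axis (nth_index i) (axis (nth_index k) u))"

definition free_coordinates :: "(nat \<times> nat \<times> complex) set" where
  "free_coordinates = {(i, k, u). i < k \<and> k < CARD('n) \<and> u \<in> {1, \<i>} \<and> colweight k (d k i) \<noteq> 0 \<and>
     (i = pivot k (d k i) \<longrightarrow> u = \<i>)}"

lemma Basis_eq_unit_matrix: "(Basis :: 'n cmatrix set) = unit_matrix ` ({..<CARD('n)} \<times> {..<CARD('n)} \<times> {1, \<i>})"
proof (intro equalityI subsetI)
  fix e :: "'n cmatrix" assume "e \<in> Basis"
  then obtain a b u where e: "e = axis a (axis b u)" "u \<in> {1, \<i>}"
    by (auto simp: Basis_vec_def Basis_complex_def)
  then have "e = unit_matrix (position a, position b, u)" by (simp add: unit_matrix_def nth_index_position)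
  then show "e \<in> unit_matrix ` ({..<CARD('n)} \<times> {..<CARD('n)} \<times> {1, \<i>})" using e(2) position_less by blast
qed (auto simp: unit_matrix_def Basis_vec_def Basis_complex_def)

lemma inj_unit_matrix: "inj_on unit_matrix ({..<CARD('n)} \<times> {..<CARD('n)} \<times> {1, \<i>})"
proof (rule inj_onI)
  fix x y assume xy: "x \<in> {..<CARD('n)} \<times> {..<CARD('n)} \<times> {1, \<i>}" "y \<in> {..<CARD('n)} \<times> {..<CARD('n)} \<times> {1, \<i>}"
    "unit_matrix x = unit_matrix y"
  obtain i k u i' k' u' where e: "x = (i, k, u)" "y = (i', k', u')" by (cases x, cases y)
  have "u \<noteq> 0" "u' \<noteq> 0" using xy e by auto
  then have "nth_index i = (nth_index i' :: 'n)" "nth_index k = (nth_index k' :: 'n)" "u = u'"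
    using xy(3) e by (auto simp: unit_matrix_def axis_eq_axis)
  then show "x = y" using xy(1,2) e position_nth_index by (metis SigmaD1 SigmaD2 lessThan_iff)
qed

lemma inner_unit_matrix: "Y \<bullet> unit_matrix (i, k, u) = ent Y i k \<bullet> u"
  by (simp add: unit_matrix_def inner_axis ent_def)

text \<open>In this form the model is spanned by part of the standard basis, so its dimension is a
  number of basis vectors.\<close>

lemma model_eq: "model = {Y. \<forall>e\<in>Basis. e \<notin> unit_matrix ` free_coordinates \<longrightarrow> Y \<bullet> e = 0}"
proof -
  let ?I = "{..<CARD('n)} \<times> {..<CARD('n)} \<times> {1, \<i>}"
  have sub: "free_coordinates \<subseteq> ?I" by (auto simp: free_coordinates_def)
  have mem: "unit_matrix x \<in> unit_matrix ` free_coordinates \<longleftrightarrow> x \<in> free_coordinates" if "x \<in> ?I" for x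
    using inj_on_image_mem_iff[OF inj_unit_matrix that sub] .
  have "(\<forall>e\<in>Basis. e \<notin> unit_matrix ` free_coordinates \<longrightarrow> Y \<bullet> e = 0) \<longleftrightarrow>
     (\<forall>x\<in>?I. x \<notin> free_coordinates \<longrightarrow> Y \<bullet> unit_matrix x = 0)" for Y
    unfolding Basis_eq_unit_matrix ball_simps(9) using mem by blast
  also have "(\<forall>x\<in>?I. x \<notin> free_coordinates \<longrightarrow> Y \<bullet> unit_matrix x = 0) \<longleftrightarrow>
     (\<forall>i<CARD('n). \<forall>k<CARD('n). ((i, k, 1) \<notin> free_coordinates \<longrightarrow> Re (ent Y i k) = 0) \<and>
        ((i, k, \<i>) \<notin> free_coordinates \<longrightarrow> Im (ent Y i k) = 0))" for Y
    by (auto simp: inner_unit_matrix inner_complex_def)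
  also have "(\<forall>i<CARD('n). \<forall>k<CARD('n). ((i, k, 1) \<notin> free_coordinates \<longrightarrow> Re (ent Y i k) = 0) \<and>
        ((i, k, \<i>) \<notin> free_coordinates \<longrightarrow> Im (ent Y i k) = 0)) \<longleftrightarrow> Y \<in> model" for Y
    unfolding model_def mem_Collect_eq
  proof (intro all_cong1 imp_cong refl)
    fix i k assume "k < CARD('n)"
    then show "((i, k, 1) \<notin> free_coordinates \<longrightarrow> Re (ent Y i k) = 0) \<and> ((i, k, \<i>) \<notin> free_coordinates \<longrightarrow> Im (ent Y i k) = 0) \<longleftrightarrow>
      (k \<le> i \<longrightarrow> ent Y i k = 0) \<and> (i < k \<longrightarrow> colweight k (d k i) = 0 \<longrightarrow> ent Y i k = 0) \<and>
      (i < k \<longrightarrow> colweight k (d k i) \<noteq> 0 \<longrightarrow> i = pivot k (d k i) \<longrightarrow> Re (ent Y i k) = 0)"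
      by (cases "i < k"; cases "colweight k (d k i) = 0"; cases "i = pivot k (d k i)")
        (simp_all add: free_coordinates_def complex_eq_iff)
  qed
  finally show ?thesis by blast
qed

lemma subspace_model: "subspace model"
  unfolding model_eq by (rule subspace_substandard)

definition multiplicity :: "real \<Rightarrow> nat \<Rightarrow> nat" where
  "multiplicity m k = card {i\<in>{..<k}. d k i = m}"

lemma colweight_eq_0_iff:
  assumes "k < CARD('n)" "m \<in> d k ` {..<k}"
  shows "colweight k m = 0 \<longleftrightarrow> multiplicity m k \<le> multiplicity m (Suc k)"
  unfolding colweight_def multiplicity_def
  by (rule weight_eq_0_iff[OF diaA[OF assms(1)] hermitian_ent[OF hermA] cpA cpA assms(2)]) (use assms(1) in auto)

text \<open>By \<open>colweight_eq_0_iff\<close>, whether a weight vanishes depends on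
  multiplicities alone. Thus the count does not involve the point A or the pivots chosen for
  it.\<close>

lemma dim_model: "dim model =
  (\<Sum>k<CARD('n). \<Sum>m\<in>d k ` {..<k}. if multiplicity m (Suc k) < multiplicity m k then 2 * multiplicity m k - 1 else 0)"
proof -
  let ?I = "{..<CARD('n)} \<times> {..<CARD('n)} \<times> {1, \<i>}"
  have sub: "free_coordinates \<subseteq> ?I" by (auto simp: free_coordinates_def)
  have "unit_matrix ` free_coordinates \<subseteq> Basis" using sub Basis_eq_unit_matrix by blast
  then have "dim model = card (unit_matrix ` free_coordinates)" unfolding model_eq by (rule dim_substandard)
  also have "\<dots> = card free_coordinates" using inj_on_subset[OF inj_unit_matrix sub] by (rule card_image)
  also have "\<dots> = (\<Sum>x\<in>free_coordinates. 1)" by simp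
  also have "\<dots> = (\<Sum>k<CARD('n). \<Sum>x\<in>{x\<in>free_coordinates. fst (snd x) = k}. 1)"
    using sub finite_subset[OF sub] by (intro sum.group[symmetric]) auto
  also have "\<dots> = (\<Sum>k<CARD('n). \<Sum>m\<in>d k ` {..<k}. if multiplicity m (Suc k) < multiplicity m k then 2 * multiplicity m k - 1 else 0)"
  proof (rule sum.cong[OF refl])
    fix k assume "k \<in> {..<CARD('n)}"
    then have k: "k < CARD('n)" by simp
    let ?F = "{x\<in>free_coordinates. fst (snd x) = k}"
    have finF: "finite ?F" using finite_subset[OF sub] by auto
    have "(\<Sum>x\<in>?F. 1 :: nat) = (\<Sum>m\<in>d k ` {..<k}. \<Sum>x\<in>{x\<in>?F. d k (fst x) = m}. 1)"
      by (rule sum.group[symmetric]) (use finF in \<open>auto simp: free_coordinates_def\<close>)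
    also have "\<dots> = (\<Sum>m\<in>d k ` {..<k}. if multiplicity m (Suc k) < multiplicity m k then 2 * multiplicity m k - 1 else 0)"
    proof (rule sum.cong[OF refl])
      fix m assume m: "m \<in> d k ` {..<k}"
      let ?J = "{i\<in>{..<k}. d k i = m}"
      show "(\<Sum>x\<in>{x\<in>?F. d k (fst x) = m}. 1) = (if multiplicity m (Suc k) < multiplicity m k then 2 * multiplicity m k - 1 else 0)"
      proof (cases "colweight k m = 0")
        case True
        then have "{x\<in>?F. d k (fst x) = m} = {}" by (auto simp: free_coordinates_def)
        then show ?thesis using True colweight_eq_0_iff[OF k m] by (simp only: sum.empty) simp
      next
        case False
        have p: "pivot k m < k" "d k (pivot k m) = m" using pivot[OF False] by auto
        have im: "(\<lambda>(i, u). (i, k, u)) ` S = {(i, k', u). k' = k \<and> (i, u) \<in> S}" for S :: "(nat \<times> complex) set"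
          by force
        have "{x\<in>?F. d k (fst x) = m} = (\<lambda>(i, u). (i, k, u)) ` (?J \<times> {1, \<i>} - {(pivot k m, 1)})"
          unfolding im using False k by (auto simp: free_coordinates_def)
        then have "card {x\<in>?F. d k (fst x) = m} = card (?J \<times> {1, \<i>} - {(pivot k m, 1)})"
          by (simp only:) (rule card_image, auto simp: inj_on_def)
        also have "\<dots> = card (?J \<times> {1, \<i>}) - 1" using p by (intro card_Diff_singleton) auto
        also have "card (?J \<times> {1, \<i>}) = 2 * multiplicity m k"
          by (simp add: card_cartesian_product multiplicity_def complex_eq_iff)
        finally show ?thesis using False colweight_eq_0_iff[OF k m] by simp
      qed
    qed
    finally show "(\<Sum>x\<in>?F. 1) = (\<Sum>m\<in>d k ` {..<k}. if multiplicity m (Suc k) < multiplicity m k then 2 * multiplicity m k - 1 else 0)" .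
  qed
  finally show ?thesis .
qed

end

section \<open>The fibers as submanifolds, and the conclusion\<close>

lemma fiber_gc_chart:
  fixes A :: "'n::{finite,linorder} cmatrix"
  assumes A: "A \<in> gc_fiber lam \<Lambda>"
  shows "\<exists>Q. gc_chart A (\<lambda>k i. gc_triangle CARD('n) lam \<Lambda> (Suc i, k)) Q"
proof -
  have "\<forall>k\<in>{..<CARD('n)}. \<exists>Q. diagonalises k (ent A) (\<lambda>i. gc_triangle CARD('n) lam \<Lambda> (Suc i, k)) Q"
    using fiber_diagonalises[OF A] by simp
  from bchoice[OF this] obtain Q where
    Q: "\<forall>k\<in>{..<CARD('n)}. diagonalises k (ent A) (\<lambda>i. gc_triangle CARD('n) lam \<Lambda> (Suc i, k)) (Q k)" by blast
  have "gc_chart A (\<lambda>k i. gc_triangle CARD('n) lam \<Lambda> (Suc i, k)) Q"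
    using fiber_hermitian[OF A] Q fiber_char_poly[OF A]
    by unfold_locales (auto simp: leading_submatrix_ent)
  then show ?thesis by blast
qed

text \<open>Every point of the fiber gets its own chart, but all models have the same dimension
  because it is read off the triangle.\<close>

lemma fiber_smooth_submanifold:
  fixes lam :: "nat \<Rightarrow> real" and \<Lambda> :: "nat \<times> nat \<Rightarrow> real"
  defines "T \<equiv> gc_triangle CARD('n::{finite,linorder}) lam \<Lambda>"
  assumes inter: "interlacing CARD('n) T" and V: "finite V" "T ` positions CARD('n) \<subseteq> V"
  shows "smooth_submanifold (gc_array.descent CARD('n) T V) (gc_fiber lam \<Lambda> :: 'n cmatrix set)"
  unfolding smooth_submanifold_def
proof
  fix A :: "'n cmatrix" assume A: "A \<in> gc_fiber lam \<Lambda>"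
  interpret T: gc_array "CARD('n)" T by unfold_locales (rule inter)
  define d where "d k i = T (Suc i, k)" for k i
  obtain Q where "gc_chart A d Q" using fiber_gc_chart[OF A] by (auto simp: d_def[abs_def] T_def)
  then interpret gc_chart A d Q .
  obtain U W g where U: "open U" "A \<in> U" "U \<subseteq> nondegenerate" "open W" "homeomorphism U W chart g"
    "smooth_on U chart" "smooth_on W g"
    using smooth_inverse_function[OF open_nondegenerate A_nondegenerate smooth_on_subset[OF smooth_on_chart subset_UNIV]
        chart_derivative_injective] by blast
  have iff: "X \<in> gc_fiber lam \<Lambda> \<longleftrightarrow> hermitian X \<and> (\<forall>k\<le>CARD('n).
      char_poly (Matrix.mat k k (\<lambda>(i, j). ent X i j)) = char_poly (Matrix.mat k k (\<lambda>(i, j). ent A i j)))" for X :: "'n cmatrix"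
    using fiber_iff[OF A, of X] by (simp only: leading_submatrix_ent)
  have img: "chart ` (U \<inter> gc_fiber lam \<Lambda>) = W \<inter> model"
  proof (intro equalityI subsetI)
    fix y assume "y \<in> chart ` (U \<inter> gc_fiber lam \<Lambda>)"
    then obtain X where X: "X \<in> U" "X \<in> gc_fiber lam \<Lambda>" "y = chart X" by blast
    then have "chart X \<in> W" using U(5) by (auto simp: homeomorphism_def)
    moreover have "chart X \<in> model" using X(2) unfolding iff by (intro chart_in_model) auto
    ultimately show "y \<in> W \<inter> model" using X(3) by simp
  next
    fix y assume y: "y \<in> W \<inter> model"
    then have g: "g y \<in> U" "chart (g y) = y" using U(5) by (auto simp: homeomorphism_def)
    then have "g y \<in> nondegenerate" "chart (g y) \<in> model" using U(3) y by auto
    then have "g y \<in> gc_fiber lam \<Lambda>" unfolding iff using chart_in_modelD[of "g y"] by blast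
    then show "y \<in> chart ` (U \<inter> gc_fiber lam \<Lambda>)" using g by (metis IntI imageI)
  qed
  have mult: "multiplicity m k = T.mult m k" for m k
  proof -
    have "{i\<in>{1..k}. T (i, k) = m} = Suc ` {i\<in>{..<k}. d k i = m}"
      by (auto simp: d_def image_iff gr0_conv_Suc Suc_le_eq)
    then show ?thesis by (simp add: multiplicity_def T.mult_def card_image)
  qed
  \<comment> \<open>The inner sum over the eigenvalues of a leading block is extended to V; a value
    absent from row k has multiplicity 0 there and cannot drop.\<close>
  have "dim model = (\<Sum>k<CARD('n). \<Sum>m\<in>V. if T.mult m (Suc k) < T.mult m k then 2 * T.mult m k - 1 else 0)"
    unfolding dim_model mult
  proof (rule sum.cong[OF refl], rule sum.mono_neutral_left)
    fix k assume k: "k \<in> {..<CARD('n)}"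
    show "d k ` {..<k} \<subseteq> V" using V(2) k by (force simp: d_def positions_def)
    show "\<forall>m\<in>V - d k ` {..<k}. (if T.mult m (Suc k) < T.mult m k then 2 * T.mult m k - 1 else 0) = 0"
    proof
      fix m assume "m \<in> V - d k ` {..<k}"
      then have "{i\<in>{..<k}. d k i = m} = {}" by auto
      then have "T.mult m k = 0" unfolding mult[symmetric] multiplicity_def by (simp only: card.empty)
      then show "(if T.mult m (Suc k) < T.mult m k then 2 * T.mult m k - 1 else 0) = 0" by simp
    qed
  qed (use V in auto)
  also have "\<dots> = T.descent V" unfolding T.descent_def by (rule sum.swap)
  finally have "dim model = T.descent V" .
  then show "\<exists>U (V' :: 'n cmatrix set) \<phi> \<psi> L. open U \<and> A \<in> U \<and> open V' \<and> homeomorphism U V' \<phi> \<psi> \<and>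
      smooth_on U \<phi> \<and> smooth_on V' \<psi> \<and> subspace L \<and> dim L = T.descent V \<and> \<phi> ` (U \<inter> gc_fiber lam \<Lambda>) = V' \<inter> L"
    by (intro exI[of _ U] exI[of _ W] exI[of _ chart] exI[of _ g] exI[of _ model] conjI U img subspace_model)
qed

theorem proposition5p3:
  fixes n :: nat
    and lam :: "nat \<Rightarrow> real"
    and \<Lambda> \<Lambda>\<^sub>0 :: "nat \<times> nat \<Rightarrow> real"
    and fib fib\<^sub>0 :: "'n::{finite,linorder} cmatrix set"
    and \<C> :: "(nat \<times> nat) set set"
  assumes n: "n = CARD('n)"
    and lam: "\<And>i j. 1 \<le> i \<Longrightarrow> i \<le> j \<Longrightarrow> j \<le> n \<Longrightarrow> lam j \<le> lam i"
    and val: "\<Lambda> \<in> gc_map ` (coadjoint_orbit lam :: 'n cmatrix set)"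
    and val\<^sub>0: "\<Lambda>\<^sub>0 \<in> gc_map ` (coadjoint_orbit lam :: 'n cmatrix set)"
    and regular\<^sub>0: "regular_value n lam \<Lambda>\<^sub>0"
    and fib: "fib = gc_fiber lam \<Lambda>"
    and fib\<^sub>0: "fib\<^sub>0 = gc_fiber lam \<Lambda>\<^sub>0"
    and chains: "\<C> = chains n (gc_triangle n lam \<Lambda>)"
  shows "smooth_submanifold (submanifold_dim fib) fib \<and>
         smooth_submanifold (submanifold_dim fib\<^sub>0) fib\<^sub>0 \<and>
         int (submanifold_dim fib) = int (submanifold_dim fib\<^sub>0) - int (dimension_defect \<C>) \<and>
         submanifold_dim fib \<le> submanifold_dim fib\<^sub>0 \<and>
         (submanifold_dim fib = submanifold_dim fib\<^sub>0 \<longleftrightarrow> (\<forall>C\<in>\<C>. axially_symmetric C)) \<and>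
         ((\<forall>C\<in>\<C>. axially_symmetric C) \<longrightarrow>
            (\<forall>C\<in>\<C>. \<forall>\<alpha>. 2 \<le> \<alpha> \<and> \<alpha> \<le> length (chain_sequence C) \<longrightarrow>
               chain_sequence C ! (\<alpha> - 1) \<noteq> chain_sequence C ! (\<alpha> - 2))) \<and>
         ((\<forall>i j. 1 \<le> i \<and> i < j \<and> j \<le> n \<longrightarrow> lam j < lam i) \<longrightarrow>
            (submanifold_dim fib = submanifold_dim fib\<^sub>0 \<longleftrightarrow>
               (\<forall>C\<in>\<C>. union_of_symmetric_diamonds n C)))"
proof -
  define T T0 where "T = gc_triangle n lam \<Lambda>" and "T0 = gc_triangle n lam \<Lambda>\<^sub>0"
  have lam': "lam j \<le> lam i" if "1 \<le> i" "i \<le> j" "j \<le> CARD('n)" for i j using lam that n by simp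
  obtain A A0 where A: "A \<in> fib" "A0 \<in> fib\<^sub>0"
    using val val\<^sub>0 unfolding fib fib\<^sub>0 gc_fiber_def by blast
  have inter: "interlacing n T" "interlacing n T0"
    using fiber_interlacing[OF A(1)[unfolded fib] lam'] fiber_interlacing[OF A(2)[unfolded fib\<^sub>0] lam']
    by (simp_all add: T_def T0_def n)
  interpret T: gc_array n T by unfold_locales (rule inter)
  interpret T0: gc_array n T0 by unfold_locales (rule inter)
  \<comment> \<open>One set of values for both triangles, so that their top rows contribute the same
    sum of squares.\<close>
  define V where "V = T ` positions n \<union> T0 ` positions n"
  have "positions n \<subseteq> {..n} \<times> {..n}" by (auto simp: positions_def)
  then have "finite (positions n)" by (rule finite_subset) simp
  then have V: "finite V" "T ` positions n \<subseteq> V" "T0 ` positions n \<subseteq> V"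
    by (auto simp: V_def)
  have sub: "smooth_submanifold (T.descent V) fib" "smooth_submanifold (T0.descent V) fib\<^sub>0"
    using fiber_smooth_submanifold[of lam \<Lambda> V, where 'n = 'n] fiber_smooth_submanifold[of lam \<Lambda>\<^sub>0 V, where 'n = 'n] inter V
    by (simp_all add: T_def T0_def n fib fib\<^sub>0)
  have dims: "submanifold_dim fib = T.descent V" "submanifold_dim fib\<^sub>0 = T0.descent V"
    using submanifold_dim_eqI[OF sub(1)] submanifold_dim_eqI[OF sub(2)] A by auto
  have top: "T.mult m n = T0.mult m n" for m
    unfolding T.mult_def T0.mult_def by (simp add: T_def T0_def gc_triangle_def)
  have defect0: "dimension_defect (chains n T0) = 0"
    using regular_value_defect[OF lam inter(2)[unfolded T0_def] regular\<^sub>0] by (simp add: T0_def)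
  have C: "\<C> = chains n T" by (simp add: chains T_def)
  \<comment> \<open>Both identities have the value n^2 and the same contribution of the top row, and
    the regular triangle has no defect. Subtraction leaves the difference of the two
    dimensions.\<close>
  have dim: "T0.descent V = T.descent V + dimension_defect \<C>"
    using T.descent_plus_defect[OF V(1,2)] T0.descent_plus_defect[OF V(1,3)] defect0 by (simp add: top C)
  then have eq: "submanifold_dim fib = submanifold_dim fib\<^sub>0 \<longleftrightarrow> (\<forall>C\<in>\<C>. axially_symmetric C)"
    using T.all_symmetric_iff by (simp add: dims C)
  have strict: "T.mult m n \<le> 1" if "\<forall>i j. 1 \<le> i \<and> i < j \<and> j \<le> n \<longrightarrow> lam j < lam i" for m
  proof -
    have "i = j" if "i \<in> {i\<in>{1..n}. T (i, n) = m}" "j \<in> {i\<in>{1..n}. T (i, n) = m}" for i j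
    proof (rule ccontr)
      assume "i \<noteq> j"
      then have "lam i \<noteq> lam j" using that \<open>\<forall>i j. 1 \<le> i \<and> i < j \<and> j \<le> n \<longrightarrow> lam j < lam i\<close>
        by (metis (no_types, lifting) atLeastAtMost_iff less_irrefl linorder_neqE_nat mem_Collect_eq)
      then show False using that by (simp add: T_def gc_triangle_def)
    qed
    then show ?thesis unfolding T.mult_def by (simp add: card_le_Suc0_iff_eq)
  qed
  show ?thesis
    using sub dim eq T.symmetric_no_repeats T.all_diamonds_iff strict
    by (simp add: dims C)
qed

end
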